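(* Let $\psi\in(\mathfrak h[t])^*$ and assume there exist $\mu_1,\dots,\mu_s\in P^+$ and pairwise distinct $z_1,\dots,z_s\in\mathbb C$ such that $\psi(h\otimes t^p)=\sum_{i=1}^s z_i^p\mu_i(h)$ for all $h\in\mathfrak h$, $p\ge0$. Let $n=\psi(h_2)$. Then the vectors $v_{\mathfrak P^s}\,w_\psi$, as $\mathfrak P^s$ ranges over all super POPs for $n$, form a basis of $W(\psi)$.
   Context: $\mathfrak g=\mathfrak{sl}(1|2)$ ($3\times3$ complex supertrace-zero matrices, superbracket $[A,B]=AB-(-1)^{|A||B|}BA$), with $x_1=E_{12},x_2=E_{23},x_3=E_{13},y_1=E_{21},y_2=E_{32},y_3=E_{31}$ ($x_2,y_2$ even, the others odd), $h_1=E_{11}+E_{22}$, $h_2=E_{22}-E_{33}$, $\mathfrak h=\operatorname{span}\{h_1,h_2\}$, $\mathfrak n^+=\operatorname{span}\{y_1,x_2,x_3\}$; $P^+=\{\lambda\in\mathfrak h^*:\lambda(h_2)\in\mathbb Z_{>0}\}\cup\{0\}$; $\mathfrak g[t]=\mathfrak g\otimes\mathbb C[t]$ with $[a\otimes t^r,b\otimes t^s]=[a,b]\otimes t^{r+s}$. For $\psi\in(\mathfrak h[t])^*$ with $\psi(h_2)\in\mathbb Z_+$, $W(\psi)$ is the $\mathfrak g[t]$-module generated by an even vector $w_\psi$ with relations $\mathfrak n^+[t]w_\psi=0$, $xw_\psi=\psi(x)w_\psi$ ($x\in\mathfrak h[t]$), $(y_2\otimes1)^{\psi(h_2)+1}w_\psi=0$.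 POPs: for integers $n_1\ge n_2\ge 0$, a POP with bounding sequence $n_1\ge n_2$ is a pair $\mathfrak P=(m;\underline\pi)$ where $m$ is an integer with $n_1\ge m\ge n_2$ (the Gelfand–Tsetlin pattern with top row $n_1,n_2$ and middle entry $m$) and $\underline\pi$ is a partition with at most $n_1-m$ parts, each part at most $m-n_2$. Let $\underline\pi(k)$ be the number of parts equal to $k$ ($1\le k\le m-n_2$) and $\underline\pi(0)=n_1-m-\sum_{k\ge1}\underline\pi(k)$; set $\rho_{\mathfrak P}=(y_2\otimes1)^{\underline\pi(0)}(y_2\otimes t)^{\underline\pi(1)}\cdots(y_2\otimes t^{m-n_2})^{\underline\pi(m-n_2)}\in U(\mathfrak g[t])$. Super POPs: let $\mathcal S_n$ be the set of $2\times n$ matrices $A=(a_{ij})$ with entries in $\{0,1\}$ such that $a_{1k}=0$ for all $k>n-\sum_{j=1}^n a_{2j}$; let $s(A)=\sum_{i,j}a_{ij}$ and $x_A=\prod_{j=1}^{n}(x_1\otimes t^{j-1})^{a_{1j}}\prod_{j=1}^{n}(y_3\otimes t^{j-1})^{a_{2j}}$ (factors in increasing order of $j$). A super POP for $n$ is a pair $\mathfrak P^s=(A,\mathfrak P_A)$ with $A\in\mathcal S_n$ and $\mathfrak P_A$ a POP with bounding sequence $n-s(A)\ge0$; its monomial is $v_{\mathfrak P^s}=\rho_{\mathfrak P_A}\,x_A\in U(\mathfrak g[t])$. *)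

theory Defs
  imports Complex_Main
begin

text \<open>Basis of sl(1|2): x1=E12, x2=E23, x3=E13, y1=E21, y2=E32, y3=E31,
  h1=E11+E22, h2=E22-E33.\<close>
datatype gen = X1 | X2 | X3 | Y1 | Y2 | Y3 | H1 | H2

definition gens :: "gen set" where
  "gens = {X1, X2, X3, Y1, Y2, Y3, H1, H2}"

fun par :: "gen \<Rightarrow> nat" where
  "par X1 = 1" | "par X3 = 1" | "par Y1 = 1" | "par Y3 = 1"
| "par X2 = 0" | "par Y2 = 0" | "par H1 = 0" | "par H2 = 0"

type_synonym cmat = "nat \<Rightarrow> nat \<Rightarrow> complex"

definition E :: "nat \<Rightarrow> nat \<Rightarrow> cmat" where
  "E i j = (\<lambda>a b. if a = i \<and> b = j then 1 else 0)"

fun gmat :: "gen \<Rightarrow> cmat" where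
  "gmat X1 = E 1 2" | "gmat X2 = E 2 3" | "gmat X3 = E 1 3"
| "gmat Y1 = E 2 1" | "gmat Y2 = E 3 2" | "gmat Y3 = E 3 1"
| "gmat H1 = (\<lambda>a b. E 1 1 a b + E 2 2 a b)"
| "gmat H2 = (\<lambda>a b. E 2 2 a b - E 3 3 a b)"

definition mmul :: "cmat \<Rightarrow> cmat \<Rightarrow> cmat" where
  "mmul A B = (\<lambda>i j. \<Sum>k\<in>{1..3::nat}. A i k * B k j)"

definition sbracket :: "gen \<Rightarrow> gen \<Rightarrow> cmat" where
  "sbracket a b = (\<lambda>i j. mmul (gmat a) (gmat b) i j
      - (-1) ^ (par a * par b) * mmul (gmat b) (gmat a) i j)"

text \<open>coordinates of a supertrace-zero matrix in the basis above
  (diagonal part diag(m11, m22, m33) = m11 h1 - m33 h2 when m11 = m22 + m33)\<close>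
fun coord :: "cmat \<Rightarrow> gen \<Rightarrow> complex" where
  "coord M X1 = M 1 2" | "coord M X2 = M 2 3" | "coord M X3 = M 1 3"
| "coord M Y1 = M 2 1" | "coord M Y2 = M 3 2" | "coord M Y3 = M 3 1"
| "coord M H1 = M 1 1" | "coord M H2 = - M 3 3"

text \<open>Tensor algebra T(g[t]) on the basis (a, r) ~ a \<otimes> t^r of g[t]:
  elements are coefficient functions on words (finitely supported ones are the
  actual elements).\<close>
type_synonym word = "(gen \<times> nat) list"
type_synonym tens = "word \<Rightarrow> complex"

definition wmono :: "word \<Rightarrow> tens" where
  "wmono w = (\<lambda>u. if u = w then 1 else 0)"

definition tmul :: "tens \<Rightarrow> tens \<Rightarrow> tens" where
  "tmul f g = (\<lambda>w. \<Sum>i\<in>{0..length w}. f (take i w) * g (drop i w))"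

definition comm_rel :: "gen \<Rightarrow> nat \<Rightarrow> gen \<Rightarrow> nat \<Rightarrow> tens" where
  "comm_rel a r b s = (\<lambda>w. wmono [(a, r), (b, s)] w
      - (-1) ^ (par a * par b) * wmono [(b, s), (a, r)] w
      - (\<Sum>c\<in>gens. coord (sbracket a b) c * wmono [(c, r + s)] w))"

definition nplus :: "gen set" where "nplus = {Y1, X2, X3}"
definition hgens :: "gen set" where "hgens = {H1, H2}"

text \<open>Relations of W(psi): n+[t] w = 0, x w = psi(x) w, (y2 \<otimes> 1)^{psi(h2)+1} w = 0.
  psi h r stands for psi(h \<otimes> t^r), h \<in> {h1,h2}.\<close>
definition Wrels :: "(gen \<Rightarrow> nat \<Rightarrow> complex) \<Rightarrow> nat \<Rightarrow> tens set" where
  "Wrels psi n =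
     {wmono [(a, r)] | a r. a \<in> nplus}
   \<union> {(\<lambda>w. wmono [(h, r)] w - psi h r * wmono [] w) | h r. h \<in> hgens}
   \<union> {wmono (replicate (Suc n) (Y2, 0))}"

text \<open>Wker psi n = (two-sided ideal defining U(g[t])) + (left ideal of the
  relations of W(psi)) inside T(g[t]); thus W(psi) = T / Wker psi n,
  with w_psi the class of the empty word.\<close>
inductive_set Wker :: "(gen \<Rightarrow> nat \<Rightarrow> complex) \<Rightarrow> nat \<Rightarrow> tens set"
  for psi n where
  zero: "(\<lambda>w. 0) \<in> Wker psi n"
| add: "f \<in> Wker psi n \<Longrightarrow> g \<in> Wker psi n \<Longrightarrow> (\<lambda>w. f w + g w) \<in> Wker psi n"
| smult: "f \<in> Wker psi n \<Longrightarrow> (\<lambda>w. c * f w) \<in> Wker psi n"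
| comm: "a \<in> gens \<Longrightarrow> b \<in> gens \<Longrightarrow>
     tmul (tmul (wmono u) (comm_rel a r b s)) (wmono v) \<in> Wker psi n"
| left: "\<rho> \<in> Wrels psi n \<Longrightarrow> tmul (wmono u) \<rho> \<in> Wker psi n"

text \<open>P^+ (weights given by their values on h1, h2)\<close>
definition inPplus :: "(gen \<Rightarrow> complex) \<Rightarrow> bool" where
  "inPplus mu = ((\<exists>k::nat. 0 < k \<and> mu H2 = of_nat k) \<or> (mu H1 = 0 \<and> mu H2 = 0))"

text \<open>POPs with bounding sequence n1 \<ge> n2: middle entry m, partition given as a
  weakly decreasing list of positive parts.\<close>
definition isPOP :: "nat \<Rightarrow> nat \<Rightarrow> nat \<Rightarrow> nat list \<Rightarrow> bool" where
  "isPOP n1 n2 m xs = (n2 \<le> m \<and> m \<le> n1 \<and> sorted (rev xs)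
      \<and> (\<forall>k\<in>set xs. 0 < k \<and> k \<le> m - n2) \<and> length xs \<le> n1 - m)"

definition pop_mult :: "nat \<Rightarrow> nat \<Rightarrow> nat list \<Rightarrow> nat \<Rightarrow> nat" where
  "pop_mult n1 m xs k = (if k = 0 then n1 - m - length xs else count_list xs k)"

definition rho_word :: "nat \<Rightarrow> nat \<Rightarrow> nat \<Rightarrow> nat list \<Rightarrow> word" where
  "rho_word n1 n2 m xs =
     concat (map (\<lambda>k. replicate (pop_mult n1 m xs k) (Y2, k)) [0..<m - n2 + 1])"

definition inS :: "nat \<Rightarrow> (nat \<Rightarrow> nat \<Rightarrow> nat) \<Rightarrow> bool" where
  "inS n A = ((\<forall>i j. A i j \<le> 1)
      \<and> (\<forall>i j. (i \<notin> {1, 2} \<or> j \<notin> {1..n}) \<longrightarrow> A i j = 0)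
      \<and> (\<forall>k. n - (\<Sum>j\<in>{1..n}. A 2 j) < k \<longrightarrow> A 1 k = 0))"

definition sA :: "nat \<Rightarrow> (nat \<Rightarrow> nat \<Rightarrow> nat) \<Rightarrow> nat" where
  "sA n A = (\<Sum>i\<in>{1, 2}. \<Sum>j\<in>{1..n}. A i j)"

definition xA_word :: "nat \<Rightarrow> (nat \<Rightarrow> nat \<Rightarrow> nat) \<Rightarrow> word" where
  "xA_word n A = [(X1, j - 1). j \<leftarrow> [1..<n + 1], A 1 j = 1]
               @ [(Y3, j - 1). j \<leftarrow> [1..<n + 1], A 2 j = 1]"

definition superPOPs :: "nat \<Rightarrow> ((nat \<Rightarrow> nat \<Rightarrow> nat) \<times> nat \<times> nat list) set" where
  "superPOPs n = {(A, m, xs). inS n A \<and> isPOP (n - sA n A) 0 m xs}"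

definition spop_word :: "nat \<Rightarrow> (nat \<Rightarrow> nat \<Rightarrow> nat) \<times> nat \<times> nat list \<Rightarrow> word" where
  "spop_word n P = (case P of (A, m, xs) \<Rightarrow> rho_word (n - sA n A) 0 m xs @ xA_word n A)"

end

(* Write the weight psi as sum of point evaluations: psi(h2 t^p) = sum_i zeta_i^p and
   psi(h1 t^p) = sum_i alpha_i zeta_i^p with n points zeta_i, repetitions allowed.

   Spanning holds over any Q-algebra of scalars.  Filter the module by the number s of odd factors.
   Modulo lower filtration the vectors with s odd factors are highest weight vectors of weight n - s
   for the current algebra of the sl(2) spanned by x2, y2, h2, so by Garland the series
   Lambda(u) = exp(- sum_p h2 t^p u^p / p) acts on them as a polynomial of degree at most n - s.
   Commuting Lambda(u) past one odd generator bounds the exponents of y3 by n - 1 and those of x1 by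
   n - 1 - (number of y3 factors).  For y2-monomials of length l the same identities, polarised by
   h2 t^p, say that symmetric functions in l variables act modulo the complete homogeneous ones
   of degree > n - s - l, and monomial symmetric functions with exponents <= n - s - l span this
   quotient.

   For independence deform zeta_i to zeta_i + i eps.  For generic eps the points are distinct, the
   tensor product of n four-dimensional evaluation modules is cyclic of dimension 4^n, and there are
   at most 4^n super POPs, so the spanning vectors are independent there.  Spanning over the ring of
   polynomials in eps provides coordinate functions that are polynomial in eps; the relations they satisfy
   for generic eps persist at eps = 0. *)
theory Submission
  imports Defs
    "HOL-Library.Function_Algebras"
    "HOL-Library.Multiset"
    "HOL-Combinatorics.Transposition"
    "HOL-Computational_Algebra.Formal_Power_Series"
    "HOL-Computational_Algebra.Polynomial"
begin

text \<open>The obstacle is coincidence of points: there the tensor product of evaluation modules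
  need not be generated by the product of the highest weight vectors, so it gives no lower bound for
  W(psi) directly. A limit of generic fibres helps only if the dependence on eps is under control,
  and this is why spanning is proved with polynomial coefficients. At generic eps the super POP
  vectors form a basis of the tensor product, so the polynomial coordinates of a word are unique
  there. Any identity that the defining relations impose on coordinates is then an identity of
  polynomials. At eps = 0 the coordinates thus become functionals on W(psi) dual to the super POPs,
  and no flatness argument is required. The slopes i in zeta_i + i eps are distinct, so any two
  points meet for at most one eps; the values alpha_i stay fixed. The number 4 is the case n = 1,
  with basis w, x1 w, y3 w, y2 w.\<close>

section \<open>Symmetric functions modulo high complete homogeneous ones\<close>

text \<open>Exponent vectors of the monomials of degree \<open>c\<close> in \<open>l\<close>
  variables. Functions vanishing from \<open>l\<close> on, rather than lists, let one vector serve
  every larger number of variables.\<close>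

definition comps :: "nat \<Rightarrow> nat \<Rightarrow> (nat \<Rightarrow> nat) set" where
  "comps l c = {b. (\<forall>i\<ge>l. b i = 0) \<and> (\<Sum>i<l. b i) = c}"

lemma finite_comps [simp]: "finite (comps l c)"
proof (rule finite_subset)
  show "comps l c \<subseteq> {b. \<forall>i. (i \<in> {..<l} \<longrightarrow> b i \<in> {..c}) \<and> (i \<notin> {..<l} \<longrightarrow> b i = 0)}"
    by (auto simp: comps_def not_less intro: member_le_sum)
  show "finite {b :: nat \<Rightarrow> nat. \<forall>i. (i \<in> {..<l} \<longrightarrow> b i \<in> {..c}) \<and> (i \<notin> {..<l} \<longrightarrow> b i = 0)}"
    by (rule finite_set_of_finite_funs) auto
qed

lemma comps_0_right: "comps l 0 = {\<lambda>_. 0}"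
  by (auto simp: comps_def fun_eq_iff) (meson lessThan_iff linorder_not_less)

lemma comps_0_left: "comps 0 c = (if c = 0 then {\<lambda>_. 0} else {})"
  by (auto simp: comps_def)

lemma comps_Suc_iff: "b l = 0 \<Longrightarrow> b \<in> comps (Suc l) c \<longleftrightarrow> b \<in> comps l c"
  unfolding comps_def by (auto simp: not_less_eq_eq) (metis le_eq_less_or_eq Suc_leI)

text \<open>\<open>\<Phi>\<close> stands for a linear map on polynomials, given by its values on
  monomials x^a. The sum is its value at x^a times the complete homogeneous polynomial of degree
  \<open>c\<close> in the first \<open>l\<close> variables.\<close>

definition hsum :: "((nat \<Rightarrow> nat) \<Rightarrow> 'a::comm_monoid_add) \<Rightarrow> nat \<Rightarrow> nat \<Rightarrow> (nat \<Rightarrow> nat) \<Rightarrow> 'a" where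
  "hsum \<Phi> l c a = (\<Sum>b\<in>comps l c. \<Phi> (\<lambda>i. a i + b i))"

lemma hsum_0_right [simp]: "hsum \<Phi> l 0 a = \<Phi> a"
  by (simp add: hsum_def comps_0_right)

lemma hsum_0_left: "hsum \<Phi> 0 c a = (if c = 0 then \<Phi> a else 0)"
  by (simp add: hsum_def comps_0_left)

text \<open>This is h_{c+1}(x_0..x_l) = x_l h_c(x_0..x_l) + h_{c+1}(x_0..x_{l-1}): the monomials
  divisible by x_l are separated from the others.\<close>

lemma hsum_Suc:
  "hsum \<Phi> (Suc l) (Suc c) a = hsum \<Phi> (Suc l) c (a(l := Suc (a l))) + hsum \<Phi> l (Suc c) a"
proof -
  define P where "P = {b \<in> comps (Suc l) (Suc c). b l \<noteq> 0}"
  have split: "comps (Suc l) (Suc c) = P \<union> comps l (Suc c)" "P \<inter> comps l (Suc c) = {}"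
    using comps_Suc_iff[of _ l "Suc c"] by (auto simp: P_def) (auto simp: comps_def)
  have "(\<Sum>b\<in>P. \<Phi> (\<lambda>i. a i + b i)) = (\<Sum>b\<in>comps (Suc l) c. \<Phi> (\<lambda>i. (a(l := Suc (a l))) i + b i))"
  proof (rule sum.reindex_bij_witness[where i = "\<lambda>b. b(l := Suc (b l))" and j = "\<lambda>b. b(l := b l - 1)"])
    fix b assume b: "b \<in> P"
    then show "(b(l := b l - 1))(l := Suc ((b(l := b l - 1)) l)) = b" by (auto simp: P_def)
    have "(\<Sum>i<l. (b(l := b l - 1)) i) = (\<Sum>i<l. b i)" by (intro sum.cong) auto
    with b show "b(l := b l - 1) \<in> comps (Suc l) c"
      by (auto simp: P_def comps_def)
    show "\<Phi> (\<lambda>i. (a(l := Suc (a l))) i + (b(l := b l - 1)) i) = \<Phi> (\<lambda>i. a i + b i)"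
      by (rule arg_cong[where f = \<Phi>]) (use b in \<open>auto simp: P_def\<close>)
  next
    fix b assume b: "b \<in> comps (Suc l) c"
    have "(\<Sum>i<l. (b(l := Suc (b l))) i) = (\<Sum>i<l. b i)" by (intro sum.cong) auto
    with b show "b(l := Suc (b l)) \<in> P"
      by (auto simp: P_def comps_def)
  qed auto
  moreover have "finite P" by (simp add: P_def)
  ultimately show ?thesis
    unfolding hsum_def split(1) by (subst sum.union_disjoint) (use split(2) in auto)
qed

definition supp_below :: "nat \<Rightarrow> (nat \<Rightarrow> nat) \<Rightarrow> bool" where
  "supp_below l a \<longleftrightarrow> (\<forall>i\<ge>l. a i = 0)"

definition zeros :: "nat \<Rightarrow> (nat \<Rightarrow> nat) \<Rightarrow> nat" where
  "zeros l a = card {i. i < l \<and> a i = 0}"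

lemma zeros_transpose:
  assumes "i < l" "j < l"
  shows "zeros l (a \<circ> transpose i j) = zeros l a"
proof -
  have "bij_betw (transpose i j) {k. k < l \<and> (a \<circ> transpose i j) k = 0} {k. k < l \<and> a k = 0}"
    by (rule bij_betw_byWitness[where f' = "transpose i j"])
      (use assms in \<open>auto simp: transpose_def\<close>)
  then show ?thesis unfolding zeros_def by (rule bij_betw_same_card)
qed

lemma comps_transpose:
  assumes "i < l" "j < l" "b \<in> comps l c"
  shows "b \<circ> transpose i j \<in> comps l c"
proof -
  have "bij_betw (transpose i j) {..<l} {..<l}"
    by (rule bij_betw_byWitness[where f' = "transpose i j"])
      (use assms in \<open>auto simp: transpose_def\<close>)
  then have "(\<Sum>k<l. b (transpose i j k)) = (\<Sum>k<l. b k)"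
    by (rule sum.reindex_bij_betw)
  with assms show ?thesis
    by (auto simp: comps_def transpose_def)
qed

locale rational_module = module scale
  for scale :: "'r::comm_ring_1 \<Rightarrow> 'a::ab_group_add \<Rightarrow> 'a" (infixr "*s" 75) +
  assumes of_nat_unit: "k > 0 \<Longrightarrow> \<exists>i. i * of_nat k = (1::'r)"
begin

definition ninv :: "nat \<Rightarrow> 'r" where
  "ninv k = (SOME i. i * of_nat k = 1)"

lemma ninv: "k > 0 \<Longrightarrow> ninv k * of_nat k = 1"
  unfolding ninv_def by (rule someI_ex) (rule of_nat_unit)

lemma ninv': "k > 0 \<Longrightarrow> of_nat k * ninv k = 1"
  using ninv by (simp add: mult.commute)

lemma scale_of_nat_cancel:
  assumes "subspace Q" "k > 0" "of_nat k *s v \<in> Q"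
  shows "v \<in> Q"
  using subspace_scale[OF assms(1,3), of "ninv k"] by (simp add: ninv[OF assms(2)])

text \<open>Induction on m.  Multiplying by the product of all variables shifts the relations for m to those for
  m + 1, which settles the arguments without zero entry.  Modulo these, a zero entry is dropped by passing
  to one variable less; dividing by the number of zero entries makes the relations match.\<close>
lemma box_span:
  assumes "subspace Q"
    and "\<And>i j a. i < l \<Longrightarrow> j < l \<Longrightarrow> \<Phi> (a \<circ> transpose i j) = \<Phi> a"
    and "\<And>a c. supp_below l a \<Longrightarrow> c + l > m \<Longrightarrow> hsum \<Phi> l c a \<in> Q"
    and "supp_below l a"
  shows "\<Phi> a \<in> span (Q \<union> {\<Phi> a' | a'. supp_below l a' \<and> (\<forall>i<l. a' i + l \<le> m)})"
  using assms
proof (induction m arbitrary: l \<Phi> Q a)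
  case (0 l \<Phi> Q a)
  show ?case
  proof (cases "l = 0")
    case True
    then show ?thesis using "0.prems"(4) by (auto intro!: span_base)
  next
    case False
    then have "hsum \<Phi> l 0 a \<in> Q" using "0.prems"(4) by (intro "0.prems"(3)) auto
    then show ?thesis by (simp add: span_base)
  qed
next
  case (Suc m l \<Phi> Q a)
  note Q = Suc.prems(1) and sym = Suc.prems(2) and rel = Suc.prems(3)
  define B where "B = span (Q \<union> {\<Phi> a' | a'. supp_below l a' \<and> (\<forall>i<l. a' i + l \<le> Suc m)})"
  have QB: "Q \<subseteq> B" and sB: "subspace B"
    by (auto simp: B_def intro: span_base)
  consider "l = 0" | "l > Suc m" | "0 < l" "l \<le> Suc m" by linarith
  then have "\<Phi> a \<in> B"
  proof cases
    case 1
    then show ?thesis using Suc.prems(4) by (auto simp: B_def intro!: span_base)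
  next
    case 2
    then have "hsum \<Phi> l 0 a \<in> Q" using rel[of a 0] Suc.prems(4) by auto
    then show ?thesis using QB by auto
  next
    case 3
    \<comment> \<open>Relations pass to fewer variables with the same bound on \<open>c + j\<close>:
      by \<open>hsum_Suc\<close> the value for \<open>j\<close> variables is a difference of two
      values for \<open>j + 1\<close>.\<close>
    have low: "hsum \<Phi> j c a \<in> Q" if "j \<le> l" "c + j > Suc m" "supp_below l a" for j c a
      using that
    proof (induction j arbitrary: c a rule: inc_induct)
      case base
      then show ?case using rel by simp
    next
      case (step j)
      show ?case
      proof (cases c)
        case 0
        then show ?thesis using step 3 by simp
      next
        case (Suc c')
        have "hsum \<Phi> (Suc j) (Suc c') a \<in> Q" using step Suc by auto
        moreover have "hsum \<Phi> (Suc j) c' (a(j := Suc (a j))) \<in> Q"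
          using step Suc by (intro step.IH) (auto simp: supp_below_def)
        ultimately have "hsum \<Phi> (Suc j) (Suc c') a - hsum \<Phi> (Suc j) c' (a(j := Suc (a j))) \<in> Q"
          by (rule subspace_diff[OF Q])
        then show ?thesis by (simp only: hsum_Suc add_diff_cancel_left' Suc)
      qed
    qed
    \<comment> \<open>Multiplication by the first \<open>j\<close> variables improves the bound by
      one, from \<open>c + j > Suc m\<close> to \<open>c + j \<ge> Suc m\<close>. Here
      \<open>hsum_Suc\<close> is solved for the term carrying the factor x_j.\<close>
    have up: "hsum \<Phi> j c (\<lambda>i. if i < j then Suc (a i) else a i) \<in> Q"
      if "j \<le> l" "c + j \<ge> Suc m" "j > 0 \<or> c > 0" "supp_below l a" for j c a
      using that
    proof (induction j arbitrary: c a)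
      case 0
      then show ?case by (simp add: hsum_0_left subspace_0[OF Q])
    next
      case (Suc j)
      let ?a = "\<lambda>i. if i < j then Suc (a i) else a i"
      have "hsum \<Phi> (Suc j) (Suc c) ?a \<in> Q"
        using Suc by (intro low) (auto simp: supp_below_def)
      moreover have "hsum \<Phi> j (Suc c) ?a \<in> Q"
        using Suc by (intro Suc.IH) auto
      ultimately have "hsum \<Phi> (Suc j) (Suc c) ?a - hsum \<Phi> j (Suc c) ?a \<in> Q"
        by (rule subspace_diff[OF Q])
      then have "hsum \<Phi> (Suc j) c (?a(j := Suc (?a j))) \<in> Q"
        by (simp only: hsum_Suc add_diff_cancel_right')
      moreover have "?a(j := Suc (?a j)) = (\<lambda>i. if i < Suc j then Suc (a i) else a i)"
        by (auto simp: fun_eq_iff less_Suc_eq)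
      ultimately show ?case by simp
    qed
    have pos: "\<Phi> a \<in> B" if a: "supp_below l a" "\<forall>i<l. a i > 0" for a
    proof -
      define \<Psi> where "\<Psi> a = \<Phi> (\<lambda>i. if i < l then Suc (a i) else a i)" for a
      define a0 where "a0 i = a i - 1" for i
      have "\<Psi> a0 \<in> span (Q \<union> {\<Psi> a' | a'. supp_below l a' \<and> (\<forall>i<l. a' i + l \<le> m)})"
      proof (rule Suc.IH[OF Q])
        fix i j a assume ij: "i < l" "j < l"
        have "\<Psi> (a \<circ> transpose i j) = \<Phi> ((\<lambda>i. if i < l then Suc (a i) else a i) \<circ> transpose i j)"
          unfolding \<Psi>_def by (rule arg_cong[where f = \<Phi>]) (use ij in \<open>auto simp: transpose_def fun_eq_iff\<close>)
        also have "\<dots> = \<Psi> a" unfolding \<Psi>_def by (rule sym[OF ij])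
        finally show "\<Psi> (a \<circ> transpose i j) = \<Psi> a" .
      next
        fix a c assume a: "supp_below l a" "c + l > m"
        have "hsum \<Psi> l c a = hsum \<Phi> l c (\<lambda>i. if i < l then Suc (a i) else a i)"
          unfolding hsum_def \<Psi>_def
          by (intro sum.cong refl arg_cong[where f = \<Phi>]) (auto simp: fun_eq_iff)
        then show "hsum \<Psi> l c a \<in> Q" using up[of l c a] a 3 by auto
      next
        show "supp_below l a0" using a by (auto simp: supp_below_def a0_def)
      qed
      also have "\<dots> \<subseteq> B"
      proof (rule span_minimal[OF _ sB], rule subsetI)
        fix x assume "x \<in> Q \<union> {\<Psi> a' |a'. supp_below l a' \<and> (\<forall>i<l. a' i + l \<le> m)}"
        then show "x \<in> B"
        proof
          assume "x \<in> {\<Psi> a' |a'. supp_below l a' \<and> (\<forall>i<l. a' i + l \<le> m)}"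
          then obtain a' where a': "x = \<Psi> a'" "supp_below l a'" "\<forall>i<l. a' i + l \<le> m" by auto
          show "x \<in> B" unfolding a'(1) \<Psi>_def B_def
            by (rule span_base) (use a' in \<open>auto simp: supp_below_def intro!: exI[of _ "\<lambda>i. if i < l then Suc (a' i) else a' i"]\<close>)
        qed (use QB in auto)
      qed
      also have "\<Psi> a0 = \<Phi> a"
        unfolding \<Psi>_def by (rule arg_cong[where f = \<Phi>]) (use a in \<open>auto simp: a0_def supp_below_def\<close>)
      finally show ?thesis .
    qed
    obtain k where k: "l = Suc k" using 3 by (cases l) auto
    define \<Psi> where "\<Psi> a = ninv (zeros l a) *s \<Phi> a" for a
    have zk: "zeros l a > 0" if "a k = 0" for a :: "nat \<Rightarrow> nat"
      using that k by (auto simp: zeros_def card_gt_0_iff)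
    have last: "\<Phi> a \<in> B" if a: "supp_below k a" for a
    proof -
      have "\<Psi> a \<in> span (B \<union> {\<Psi> a' | a'. supp_below k a' \<and> (\<forall>i<k. a' i + k \<le> m)})"
      proof (rule Suc.IH[OF sB])
        show "\<Psi> (a \<circ> transpose i j) = \<Psi> a" if "i < k" "j < k" for i j a
          using that sym[of i j a] zeros_transpose[of i l j a] k by (simp add: \<Psi>_def comp_def)
        show "supp_below k a" by fact
        fix a c assume a: "supp_below k a" "c + k > m"
        have al: "supp_below l a" using a k by (auto simp: supp_below_def)
        define Z where "Z = {i. i < l \<and> a i = 0}"
        \<comment> \<open>Vectors without zero entry are cut off: \<open>pos\<close> has already
          placed their \<open>\<Phi>\<close>-values in \<open>B\<close>, and \<open>\<Psi>\<close>
          would divide by zero on them.\<close>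
        define \<Theta> where "\<Theta> b = (if zeros l b > 0 then \<Psi> b else 0)" for b
        have kZ: "k \<in> Z" "finite Z" using a k by (auto simp: Z_def supp_below_def)
        have cz: "card Z > 0" using kZ by (auto simp: card_gt_0_iff)
        \<comment> \<open>Exchanging \<open>i\<close> with the last position \<open>k\<close>, which
          is also a zero of \<open>a\<close>, identifies the vectors vanishing at \<open>i\<close>
          with those in \<open>k\<close> variables.\<close>
        have part: "(\<Sum>b\<in>{b \<in> comps l c. b i = 0}. \<Theta> (\<lambda>i. a i + b i)) = hsum \<Psi> k c a" if i: "i \<in> Z" for i
        proof -
          have "(\<Sum>b\<in>{b \<in> comps l c. b i = 0}. \<Theta> (\<lambda>i. a i + b i)) =
                (\<Sum>b\<in>comps k c. \<Psi> (\<lambda>i. a i + b i))"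
          proof (rule sum.reindex_bij_witness[where i = "\<lambda>b. b \<circ> transpose i k" and j = "\<lambda>b. b \<circ> transpose i k"])
            fix b assume b: "b \<in> {b \<in> comps l c. b i = 0}"
            then have "b \<circ> transpose i k \<in> comps l c" using i k by (intro comps_transpose) (auto simp: Z_def)
            moreover have "(b \<circ> transpose i k) k = 0" using b by simp
            ultimately show "b \<circ> transpose i k \<in> comps k c"
              using comps_Suc_iff k by blast
            have eq: "(\<lambda>j. a j + (b \<circ> transpose i k) j) = (\<lambda>j. a j + b j) \<circ> transpose i k"
              using i a by (auto simp: fun_eq_iff transpose_def Z_def supp_below_def)
            have "\<Psi> (\<lambda>j. a j + (b \<circ> transpose i k) j) = \<Psi> (\<lambda>j. a j + b j)"
              unfolding eq \<Psi>_def using i k by (simp add: sym zeros_transpose Z_def)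
            moreover have "zeros l (\<lambda>j. a j + b j) > 0"
              using i b by (auto simp: zeros_def card_gt_0_iff Z_def)
            ultimately show "\<Psi> (\<lambda>j. a j + (b \<circ> transpose i k) j) = \<Theta> (\<lambda>j. a j + b j)"
              by (simp add: \<Theta>_def)
          next
            fix b assume b: "b \<in> comps k c"
            then have "b \<in> comps l c" "b k = 0" by (auto simp: comps_def k)
            moreover from this have "b \<circ> transpose i k \<in> comps l c"
              using i k by (intro comps_transpose) (auto simp: Z_def)
            ultimately show "b \<circ> transpose i k \<in> {b \<in> comps l c. b i = 0}"
              by simp
          qed (auto simp: o_assoc[symmetric])
          then show ?thesis by (simp add: hsum_def)
        qed
        \<comment> \<open>Pairs of a zero position \<open>i\<close> of \<open>a\<close> and a vector
          \<open>b\<close> with \<open>b i = 0\<close> are counted in two ways. For fixed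
          \<open>b\<close> there are as many as a + b has zero entries; this cancels the denominator
          in \<open>\<Psi>\<close> and leaves the relation for \<open>l\<close> variables, up to
          vectors without zero entry.\<close>
        have "of_nat (card Z) *s hsum \<Psi> k c a =
              (\<Sum>i\<in>Z. \<Sum>b\<in>{b \<in> comps l c. b i = 0}. \<Theta> (\<lambda>i. a i + b i))"
          using part by (simp add: sum_constant_scale)
        also have "\<dots> = (\<Sum>i\<in>Z. \<Sum>b\<in>comps l c. if b i = 0 then \<Theta> (\<lambda>i. a i + b i) else 0)"
          by (intro sum.cong refl sum.mono_neutral_cong_left) auto
        also have "\<dots> = (\<Sum>b\<in>comps l c. \<Sum>i\<in>Z. if b i = 0 then \<Theta> (\<lambda>i. a i + b i) else 0)"
          by (rule sum.swap)
        also have "\<dots> = (\<Sum>b\<in>comps l c. of_nat (zeros l (\<lambda>i. a i + b i)) *s \<Theta> (\<lambda>i. a i + b i))"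
        proof (intro sum.cong refl)
          fix b
          have "(\<Sum>i\<in>Z. if b i = 0 then \<Theta> (\<lambda>i. a i + b i) else 0) = (\<Sum>i\<in>{i\<in>Z. b i = 0}. \<Theta> (\<lambda>i. a i + b i))"
            using kZ by (intro sum.mono_neutral_cong_right) auto
          also have "{i\<in>Z. b i = 0} = {i. i < l \<and> a i + b i = 0}" by (auto simp: Z_def)
          finally show "(\<Sum>i\<in>Z. if b i = 0 then \<Theta> (\<lambda>i. a i + b i) else 0) =
             of_nat (zeros l (\<lambda>i. a i + b i)) *s \<Theta> (\<lambda>i. a i + b i)"
            by (simp add: sum_constant_scale zeros_def)
        qed
        also have "\<dots> = (\<Sum>b\<in>comps l c. \<Phi> (\<lambda>i. a i + b i) - (if zeros l (\<lambda>i. a i + b i) > 0 then 0 else \<Phi> (\<lambda>i. a i + b i)))"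
          by (intro sum.cong refl) (auto simp: \<Theta>_def \<Psi>_def ninv')
        also have "\<dots> = hsum \<Phi> l c a - (\<Sum>b\<in>comps l c. if zeros l (\<lambda>i. a i + b i) > 0 then 0 else \<Phi> (\<lambda>i. a i + b i))"
          by (simp add: sum_subtractf hsum_def)
        also have "\<dots> \<in> B"
        proof (intro subspace_diff[OF sB] subspace_sum[OF sB])
          show "hsum \<Phi> l c a \<in> B" using rel[OF al, of c] a QB k by auto
          fix b assume b: "b \<in> comps l c"
          show "(if zeros l (\<lambda>i. a i + b i) > 0 then 0 else \<Phi> (\<lambda>i. a i + b i)) \<in> B"
            using al b by (auto simp: subspace_0[OF sB] zeros_def supp_below_def comps_def intro!: pos)
        qed
        finally show "hsum \<Psi> k c a \<in> B" by (rule scale_of_nat_cancel[OF sB cz])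
      qed
      also have "\<dots> \<subseteq> B"
      proof (rule span_minimal[OF _ sB], rule subsetI)
        fix x assume "x \<in> B \<union> {\<Psi> a' |a'. supp_below k a' \<and> (\<forall>i<k. a' i + k \<le> m)}"
        then show "x \<in> B"
        proof
          assume "x \<in> {\<Psi> a' |a'. supp_below k a' \<and> (\<forall>i<k. a' i + k \<le> m)}"
          then obtain a' where a': "x = \<Psi> a'" "supp_below k a'" "\<forall>i<k. a' i + k \<le> m" by auto
          have "\<Phi> a' \<in> B" unfolding B_def
            by (rule span_base) (use a' 3 in \<open>auto simp: supp_below_def k less_Suc_eq intro!: exI[of _ a']\<close>)
          then show "x \<in> B" unfolding a'(1) \<Psi>_def by (rule subspace_scale[OF sB])
        qed auto
      qed
      finally have "\<Psi> a \<in> B" .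
      then have "of_nat (zeros l a) *s \<Psi> a \<in> B" by (rule subspace_scale[OF sB])
      then show ?thesis using ninv'[OF zk, of a] a by (simp add: \<Psi>_def supp_below_def)
    qed
    show ?thesis
    proof (cases "\<forall>i<l. a i > 0")
      case True
      then show ?thesis using pos Suc.prems by auto
    next
      case False
      then obtain i where i: "i < l" "a i = 0" by auto
      have "supp_below k (a \<circ> transpose i k)"
        using i Suc.prems(4) k by (auto simp: supp_below_def transpose_def)
      then have "\<Phi> (a \<circ> transpose i k) \<in> B" by (rule last)
      then show ?thesis using sym[of i k a] i k by simp
    qed
  qed
  then show ?case by (simp add: B_def)
qed

end

section \<open>Garland identities for the even current algebra\<close>

lemma of_nat_left_commute: "u * (of_nat n * v) = of_nat n * (u * v)" for u v :: "'a::semiring_1"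
  by (simp only: mult.assoc[symmetric] mult_of_nat_commute[symmetric])

lemma commute_left: "u * v = v * u \<Longrightarrow> u * (v * t) = v * (u * t)" for u v t :: "'a::semigroup_mult"
  by (simp only: mult.assoc[symmetric])

lemma fps_mult_commute_coeffs:
  fixes f g :: "'a::semiring_0 fps"
  assumes "\<And>i j. fps_nth f i * fps_nth g j = fps_nth g j * fps_nth f i"
  shows "f * g = g * f"
proof (rule fps_ext)
  fix n
  have "fps_nth (f * g) n = (\<Sum>i=0..n. fps_nth g (n - i) * fps_nth f i)"
    by (simp add: fps_mult_nth assms)
  also have "\<dots> = (\<Sum>i=0..n. fps_nth g i * fps_nth f (n - i))"
    by (rule sum.reindex_bij_witness[where i = "\<lambda>i. n - i" and j = "\<lambda>i. n - i"]) auto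
  finally show "fps_nth (f * g) n = fps_nth (g * f) n" by (simp add: fps_mult_nth)
qed

lemma prod_list_commute_mset:
  fixes y :: "'b \<Rightarrow> 'a::monoid_mult"
  assumes "\<And>i j. y i * y j = y j * y i" "mset xs = mset ys"
  shows "prod_list (map y xs) = prod_list (map y ys)"
  using assms(2)
proof (induction xs arbitrary: ys)
  case (Cons k xs)
  then have "k \<in> set ys" by (metis list.set_intros(1) set_mset_mset)
  then obtain us vs where ys: "ys = us @ k # vs" by (auto simp: in_set_conv_decomp)
  have comm: "y k * prod_list (map y us) = prod_list (map y us) * y k"
    by (induction us) (simp_all add: mult.assoc commute_left[OF assms(1)])
  have "mset xs = mset (us @ vs)" using Cons.prems ys by simp
  then have "prod_list (map y (k # xs)) = y k * (prod_list (map y us) * prod_list (map y vs))"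
    using Cons.IH[OF \<open>mset xs = mset (us @ vs)\<close>] by simp
  also have "\<dots> = prod_list (map y us) * y k * prod_list (map y vs)"
    by (simp add: comm flip: mult.assoc)
  finally show ?case by (simp add: ys mult.assoc)
qed simp

lemma mset_map_transpose:
  assumes "i < l" "j < l"
  shows "mset (map (a \<circ> transpose i j) [0..<l]) = mset (map a [0..<l])"
proof -
  have inj: "inj_on (transpose i j) {0..<l}" and im: "transpose i j ` {0..<l} = {0..<l}"
    using assms by (auto simp: image_iff transpose_def inj_on_def)
  have "mset (map (a \<circ> transpose i j) [0..<l]) = image_mset a (image_mset (transpose i j) (mset_set {0..<l}))"
    by (simp add: multiset.map_comp)
  then show ?thesis by (simp add: image_mset_mset_set[OF inj] im)
qed

lemma sum_comps_Suc:
  "(\<Sum>b\<in>comps (Suc l) c. f b) = (\<Sum>k\<le>c. \<Sum>b\<in>comps l (c - k). f (b(l := k)))"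
proof -
  have "(\<Sum>k\<le>c. \<Sum>b\<in>comps l (c - k). f (b(l := k))) =
        (\<Sum>(k, b)\<in>Sigma {..c} (\<lambda>k. comps l (c - k)). f (b(l := k)))"
    by (subst sum.Sigma) auto
  also have "\<dots> = (\<Sum>b\<in>comps (Suc l) c. f b)"
  proof (rule sum.reindex_bij_witness[where i = "\<lambda>b. (b l, b(l := 0))" and j = "\<lambda>(k, b). b(l := k)"])
    fix kb assume "kb \<in> Sigma {..c} (\<lambda>k. comps l (c - k))"
    then obtain k b where kb: "kb = (k, b)" "k \<le> c" "b \<in> comps l (c - k)" by auto
    have "(\<Sum>i<l. (b(l := k)) i) = (\<Sum>i<l. b i)" by (intro sum.cong) auto
    then show "(case kb of (k, b) \<Rightarrow> b(l := k)) \<in> comps (Suc l) c"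
      using kb by (auto simp: comps_def)
    show "((case kb of (k, b) \<Rightarrow> b(l := k)) l, (case kb of (k, b) \<Rightarrow> b(l := k))(l := 0)) = kb"
      using kb by (auto simp: comps_def)
  next
    fix b assume b: "b \<in> comps (Suc l) c"
    have "(\<Sum>i<l. (b(l := 0)) i) = (\<Sum>i<l. b i)" by (intro sum.cong) auto
    with b show "(b l, b(l := 0)) \<in> Sigma {..c} (\<lambda>k. comps l (c - k))"
      by (auto simp: comps_def)
  qed auto
  finally show ?thesis by simp
qed

locale rational_algebra = rational_module scale
  for scale :: "'r::comm_ring_1 \<Rightarrow> 'a::ring_1 \<Rightarrow> 'a" (infixr "*s" 75) +
  assumes scale_mult_left: "(c *s u) * v = c *s (u * v)"
    and scale_mult_right: "u * (c *s v) = c *s (u * v)"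
begin

lemma of_nat_scale: "of_nat k *s v = of_nat k * v"
  by (induction k) (simp_all add: scale_left_distrib algebra_simps)

lemma of_nat_cancel: "subspace Q \<Longrightarrow> k > 0 \<Longrightarrow> of_nat k * v \<in> Q \<Longrightarrow> v \<in> Q"
  using scale_of_nat_cancel by (simp add: of_nat_scale)

lemma subspace_of_nat: "subspace Q \<Longrightarrow> v \<in> Q \<Longrightarrow> of_nat k * v \<in> Q"
  using subspace_scale[of Q v "of_nat k"] by (simp add: of_nat_scale)

lemma span_left_mult:
  assumes "v \<in> span S" "subspace T" "\<And>u. u \<in> S \<Longrightarrow> e * u \<in> T"
  shows "e * v \<in> T"
  using assms(1)
proof (induction v rule: span_induct_alt)
  case base
  then show ?case by (simp add: subspace_0[OF assms(2)])
next
  case (step c u v)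
  then show ?case
    by (simp add: distrib_left scale_mult_right subspace_add subspace_scale assms)
qed

end

locale sl2_current = rational_algebra scale
  for scale :: "'r::comm_ring_1 \<Rightarrow> 'a::ring_1 \<Rightarrow> 'a" (infixr "*s" 75) +
  fixes x y h :: "nat \<Rightarrow> 'a"
  assumes xy: "x i * y j = y j * x i + h (i + j)"
    and hy: "h i * y j = y j * h i - 2 * y (i + j)"
    and yy: "y i * y j = y j * y i"
    and hh: "h i * h j = h j * h i"
begin

definition ymon :: "nat list \<Rightarrow> 'a" where "ymon ks = prod_list (map y ks)"

lemma ymon_Nil [simp]: "ymon [] = 1" and ymon_Cons [simp]: "ymon (k # ks) = y k * ymon ks"
  by (simp_all add: ymon_def)

lemma ymon_mset: "mset ks = mset ks' \<Longrightarrow> ymon ks = ymon ks'"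
  unfolding ymon_def by (rule prod_list_commute_mset) (rule yy)

definition Y :: "nat \<Rightarrow> 'a fps" where "Y a = Abs_fps (\<lambda>k. y (a + k))"
definition H :: "'a fps" where "H = Abs_fps (\<lambda>k. h (Suc k))"

text \<open>Newton's recursion for the coefficients of exp(- sum_{p>0} h_p u^p / p). It is Lam' = -
  H Lam with constant term 1, read coefficientwise; the inverse of \<open>Suc c\<close> is where
  rational scalars enter.\<close>

fun lam :: "nat \<Rightarrow> 'a" where
  "lam 0 = 1"
| "lam (Suc c) = - (ninv (Suc c) *s (\<Sum>k\<le>c. h (Suc k) * lam (c - k)))"

declare lam.simps(2) [simp del]

definition Lam :: "'a fps" where "Lam = Abs_fps lam"

lemma Lam_nth [simp]: "fps_nth Lam c = lam c" by (simp add: Lam_def)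

lemma of_nat_lam: "of_nat (Suc c) * lam (Suc c) = - (\<Sum>k\<le>c. h (Suc k) * lam (c - k))"
proof -
  have "of_nat (Suc c) * lam (Suc c) = of_nat (Suc c) *s lam (Suc c)"
    by (simp only: of_nat_scale)
  also have "\<dots> = - (\<Sum>k\<le>c. h (Suc k) * lam (c - k))"
    using ninv'[of "Suc c"] by (simp only: lam.simps(2) scale_minus_right scale_scale scale_one)
  finally show ?thesis .
qed

lemma deriv_Lam: "fps_deriv Lam = - (H * Lam)"
  by (rule fps_ext) (simp only: fps_deriv_nth Lam_nth Suc_eq_plus1[symmetric] of_nat_lam,
      simp add: fps_mult_nth H_def atLeast0AtMost)

lemma h_lam: "h p * lam c = lam c * h p"
proof (induction c rule: less_induct)
  case (less c)
  show ?case
  proof (cases c)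
    case (Suc c')
    have "h p * (h (Suc k) * lam (c' - k)) = h (Suc k) * lam (c' - k) * h p" for k
    proof -
      have "h p * (h (Suc k) * lam (c' - k)) = h (Suc k) * (h p * lam (c' - k))"
        by (rule commute_left) (rule hh)
      also have "h p * lam (c' - k) = lam (c' - k) * h p" using less Suc by simp
      finally show ?thesis by (simp add: mult.assoc)
    qed
    then show ?thesis
      by (simp add: Suc lam.simps(2) scale_mult_right scale_mult_left sum_distrib_left sum_distrib_right)
  qed simp
qed

lemma YY: "Y a * Y b = Y b * Y a"
  by (rule fps_mult_commute_coeffs) (simp add: Y_def yy)

lemma Y_deriv: "Y a * fps_deriv (Y b) = fps_deriv (Y b) * Y a"
  by (rule fps_mult_commute_coeffs) (simp add: Y_def of_nat_left_commute mult.assoc yy del: of_nat_Suc)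

text \<open>The index 1 is chosen so that [x_1, y_k] = h_{k+1} reproduces exactly the series
  \<open>H\<close>, the negative logarithmic derivative of \<open>Lam\<close>.\<close>

lemma XY: "fps_const (x 1) * Y 0 = Y 0 * fps_const (x 1) + H"
  by (rule fps_ext) (simp add: Y_def H_def xy)

text \<open>In the coefficient of u^n each of the n + 1 brackets contributes the same 2 y_{n+1},
  because the indices i + 1 and n - i add up to n + 1. This multiplicity makes the
  derivative.\<close>

lemma HY: "H * Y 0 = Y 0 * H - 2 * fps_deriv (Y 0)"
proof (rule fps_ext)
  fix n
  have "fps_nth (H * Y 0) n = (\<Sum>i=0..n. y (n - i) * h (Suc i) - 2 * y (Suc n))"
    by (auto simp: fps_mult_nth H_def Y_def hy intro!: sum.cong)
  also have "\<dots> = (\<Sum>i=0..n. y (n - i) * h (Suc i)) - of_nat (Suc n) * (2 * y (Suc n))"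
    by (simp add: sum_subtractf)
  also have "(\<Sum>i=0..n. y (n - i) * h (Suc i)) = (\<Sum>i=0..n. y i * h (Suc (n - i)))"
    by (rule sum.reindex_bij_witness[where i = "\<lambda>i. n - i" and j = "\<lambda>i. n - i"]) auto
  finally show "fps_nth (H * Y 0) n = fps_nth (Y 0 * H - 2 * fps_deriv (Y 0)) n"
    by (simp add: fps_mult_nth H_def Y_def mult_2 distrib_left
          del: of_nat_Suc)
qed

lemma deriv_Y_power: "fps_deriv (Y 0 ^ Suc l) = of_nat (Suc l) * (fps_deriv (Y 0) * Y 0 ^ l)"
proof (induction l)
  case (Suc l)
  have "fps_deriv (Y 0 ^ Suc (Suc l)) = Y 0 * fps_deriv (Y 0 ^ Suc l) + fps_deriv (Y 0) * Y 0 ^ Suc l"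
    by (subst power_Suc) (simp only: fps_deriv_mult)
  also have "Y 0 * fps_deriv (Y 0 ^ Suc l) = of_nat (Suc l) * (fps_deriv (Y 0) * Y 0 ^ Suc l)"
    by (simp only: Suc of_nat_left_commute commute_left[OF Y_deriv]) (simp only: power_Suc)
  finally show ?case by (simp add: algebra_simps)
qed simp

lemma H_Y_power: "H * Y 0 ^ Suc l = Y 0 ^ Suc l * H - 2 * of_nat (Suc l) * (fps_deriv (Y 0) * Y 0 ^ l)"
proof (induction l)
  case 0
  then show ?case by (simp add: HY)
next
  case (Suc l)
  have "H * Y 0 ^ Suc (Suc l) = (Y 0 * H - 2 * fps_deriv (Y 0)) * Y 0 ^ Suc l"
    by (simp only: power_Suc[of _ "Suc l"] HY mult.assoc[symmetric])
  also have "\<dots> = Y 0 * (H * Y 0 ^ Suc l) - 2 * (fps_deriv (Y 0) * Y 0 ^ Suc l)"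
    by (simp only: left_diff_distrib mult.assoc)
  also have "\<dots> = Y 0 ^ Suc (Suc l) * H - Y 0 * (2 * of_nat (Suc l) * (fps_deriv (Y 0) * Y 0 ^ l))
     - 2 * (fps_deriv (Y 0) * Y 0 ^ Suc l)"
    by (simp only: Suc right_diff_distrib power_Suc[of _ "Suc l"] mult.assoc)
  also have "Y 0 * (2 * of_nat (Suc l) * (fps_deriv (Y 0) * Y 0 ^ l)) =
     2 * of_nat (Suc l) * (fps_deriv (Y 0) * Y 0 ^ Suc l)"
  proof -
    have "Y 0 * (of_nat (2 * Suc l) * (fps_deriv (Y 0) * Y 0 ^ l)) =
       of_nat (2 * Suc l) * (fps_deriv (Y 0) * Y 0 ^ Suc l)"
      by (simp only: of_nat_left_commute commute_left[OF Y_deriv] power_Suc)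
    then show ?thesis by (simp only: of_nat_mult of_nat_numeral)
  qed
  finally show ?case
    by (simp add: algebra_simps mult_2 of_nat_Suc[of "Suc l"] del: power_Suc of_nat_Suc)
qed

text \<open>\<open>H\<close> appears once for each factor that \<open>x 1\<close> meets. Moving it
  to the right costs derivatives, which add up to that of \<open>Y 0 ^ l\<close> taken
  \<open>Suc l\<close> times.\<close>

lemma X_Y_power:
  "fps_const (x 1) * Y 0 ^ Suc l =
     Y 0 ^ Suc l * fps_const (x 1) + of_nat (Suc l) * (Y 0 ^ l * H - fps_deriv (Y 0 ^ l))"
proof (induction l)
  case 0
  then show ?case using XY by simp
next
  case (Suc l)
  let ?X = "fps_const (x 1)"
  have "?X * Y 0 ^ Suc (Suc l) = (Y 0 * ?X + H) * Y 0 ^ Suc l"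
    by (simp only: power_Suc[of _ "Suc l"] XY mult.assoc[symmetric])
  also have "\<dots> = Y 0 * (?X * Y 0 ^ Suc l) + H * Y 0 ^ Suc l"
    by (simp only: distrib_right mult.assoc)
  also have "\<dots> = Y 0 ^ Suc (Suc l) * ?X + Y 0 * (of_nat (Suc l) * (Y 0 ^ l * H - fps_deriv (Y 0 ^ l)))
      + H * Y 0 ^ Suc l"
    by (simp only: Suc distrib_left power_Suc[of _ "Suc l"] mult.assoc)
  also have "Y 0 * (of_nat (Suc l) * (Y 0 ^ l * H - fps_deriv (Y 0 ^ l))) =
      of_nat (Suc l) * (Y 0 ^ Suc l * H - Y 0 * fps_deriv (Y 0 ^ l))"
    by (simp only: of_nat_left_commute power_Suc right_diff_distrib mult.assoc)
  also have "Y 0 * fps_deriv (Y 0 ^ l) = fps_deriv (Y 0 ^ Suc l) - fps_deriv (Y 0) * Y 0 ^ l"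
    by (simp only: power_Suc fps_deriv_mult) simp
  also have "H * Y 0 ^ Suc l = Y 0 ^ Suc l * H - 2 * fps_deriv (Y 0 ^ Suc l)"
    by (simp only: H_Y_power deriv_Y_power mult.assoc)
  finally show ?case
    by (simp add: deriv_Y_power algebra_simps mult_2 of_nat_Suc[of "Suc l"] del: power_Suc of_nat_Suc)
qed

text \<open>With \<open>Lam\<close> attached, the term in \<open>H\<close> and the derivative
  combine by Lam' = - H Lam into one total derivative. On coefficients this trades one factor
  \<open>Y 0\<close> for one more power of u.\<close>

lemma X_Y_power_Lam:
  "fps_const (x 1) * (Y 0 ^ Suc l * Lam) =
     Y 0 ^ Suc l * (fps_const (x 1) * Lam) - of_nat (Suc l) * fps_deriv (Y 0 ^ l * Lam)"
proof -
  have "fps_const (x 1) * (Y 0 ^ Suc l * Lam) = (fps_const (x 1) * Y 0 ^ Suc l) * Lam"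
    by (simp only: mult.assoc)
  also have "\<dots> =
     Y 0 ^ Suc l * (fps_const (x 1) * Lam) + of_nat (Suc l) * (Y 0 ^ l * (H * Lam) - fps_deriv (Y 0 ^ l) * Lam)"
    by (simp only: X_Y_power) (simp only: distrib_right left_diff_distrib mult.assoc)
  finally have "fps_const (x 1) * (Y 0 ^ Suc l * Lam) =
     Y 0 ^ Suc l * (fps_const (x 1) * Lam) + of_nat (Suc l) * (Y 0 ^ l * (H * Lam) - fps_deriv (Y 0 ^ l) * Lam)" .
  moreover have "fps_deriv (Y 0 ^ l * Lam) = - (Y 0 ^ l * (H * Lam)) + fps_deriv (Y 0 ^ l) * Lam"
    by (simp only: fps_deriv_mult deriv_Lam mult_minus_right)
  then have "Y 0 ^ l * (H * Lam) - fps_deriv (Y 0 ^ l) * Lam = - fps_deriv (Y 0 ^ l * Lam)"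
    by simp
  ultimately show ?thesis by (simp only: mult_minus_right diff_conv_add_uminus)
qed

definition Yl :: "nat list \<Rightarrow> 'a fps" where "Yl as = prod_list (map Y as)"

lemma Yl_Nil [simp]: "Yl [] = 1" and Yl_Cons [simp]: "Yl (a # as) = Y a * Yl as"
  by (simp_all add: Yl_def)

lemma h_Y: "fps_const (h p) * Y a = Y a * fps_const (h p) - 2 * Y (a + p)"
  by (rule fps_ext) (simp add: Y_def hy numeral_fps_const ac_simps)

lemma h_Y_power:
  "fps_const (h p) * Y 0 ^ Suc l = Y 0 ^ Suc l * fps_const (h p) - 2 * of_nat (Suc l) * (Y p * Y 0 ^ l)"
proof (induction l)
  case 0
  then show ?case by (simp add: h_Y)
next
  case (Suc l)
  let ?h = "fps_const (h p)"
  have "?h * Y 0 ^ Suc (Suc l) = (Y 0 * ?h - 2 * Y p) * Y 0 ^ Suc l"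
    using h_Y[of p 0] by (simp only: power_Suc[of _ "Suc l"] mult.assoc[symmetric]) simp
  also have "\<dots> = Y 0 * (?h * Y 0 ^ Suc l) - 2 * (Y p * Y 0 ^ Suc l)"
    by (simp only: left_diff_distrib mult.assoc)
  also have "\<dots> = Y 0 ^ Suc (Suc l) * ?h - Y 0 * (2 * of_nat (Suc l) * (Y p * Y 0 ^ l))
     - 2 * (Y p * Y 0 ^ Suc l)"
    by (simp only: Suc right_diff_distrib power_Suc[of _ "Suc l"] mult.assoc)
  also have "Y 0 * (2 * of_nat (Suc l) * (Y p * Y 0 ^ l)) = 2 * of_nat (Suc l) * (Y p * Y 0 ^ Suc l)"
  proof -
    have "Y 0 * (of_nat (2 * Suc l) * (Y p * Y 0 ^ l)) = of_nat (2 * Suc l) * (Y p * Y 0 ^ Suc l)"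
      by (simp only: of_nat_left_commute commute_left[OF YY[of 0 p]] power_Suc)
    then show ?thesis by (simp only: of_nat_mult of_nat_numeral)
  qed
  finally show ?case
    by (simp add: algebra_simps mult_2 of_nat_Suc[of "Suc l"] del: power_Suc of_nat_Suc)
qed

lemma h_Yl:
  "fps_const (h p) * Yl as = Yl as * fps_const (h p) - 2 * (\<Sum>j<length as. Yl (as[j := as ! j + p]))"
proof (induction as)
  case (Cons a as)
  let ?h = "fps_const (h p)"
  have "?h * Yl (a # as) = (Y a * ?h - 2 * Y (a + p)) * Yl as"
    by (simp only: Yl_Cons h_Y mult.assoc[symmetric])
  also have "\<dots> = Y a * (?h * Yl as) - 2 * (Y (a + p) * Yl as)"
    by (simp only: left_diff_distrib mult.assoc)
  also have "\<dots> = Yl (a # as) * ?h - Y a * (2 * (\<Sum>j<length as. Yl (as[j := as ! j + p]))) - 2 * (Y (a + p) * Yl as)"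
    by (simp only: Cons right_diff_distrib Yl_Cons mult.assoc)
  also have "Y a * (2 * (\<Sum>j<length as. Yl (as[j := as ! j + p]))) = 2 * (\<Sum>j<length as. Y a * Yl (as[j := as ! j + p]))"
    by (simp only: mult_2 distrib_left sum_distrib_left)
  finally show ?case
    by (simp del: sum.lessThan_Suc add: sum.lessThan_Suc_shift algebra_simps)
qed simp

lemma h_Lam: "fps_const (h p) * Lam = Lam * fps_const (h p)"
  by (rule fps_ext) (simp add: h_lam)

lemma Y_Yl: "Y p * Yl as = Yl as * Y p"
  by (induction as) (simp_all add: mult.assoc commute_left[OF YY[of p]])

text \<open>The polarisation step. Bracketing with \<open>h p\<close> shifts one factor at a time;
  on the equal factors \<open>Y 0\<close> it yields \<open>Suc l\<close> copies of one product
  containing a single \<open>Y p\<close>, which can therefore be solved for.\<close>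

lemma h_Yl_Lam:
  "fps_const (h p) * (Yl as * Y 0 ^ Suc l * Lam) =
     Yl as * Y 0 ^ Suc l * Lam * fps_const (h p)
     - 2 * (\<Sum>j<length as. Yl (as[j := as ! j + p]) * Y 0 ^ Suc l * Lam)
     - 2 * of_nat (Suc l) * (Yl (p # as) * Y 0 ^ l * Lam)"
proof -
  let ?h = "fps_const (h p)" and ?S = "\<Sum>j<length as. Yl (as[j := as ! j + p])"
  have "?h * (Yl as * Y 0 ^ Suc l * Lam) = (Yl as * ?h - 2 * ?S) * (Y 0 ^ Suc l * Lam)"
    by (simp only: h_Yl mult.assoc[symmetric])
  also have "\<dots> = Yl as * (?h * Y 0 ^ Suc l) * Lam - 2 * (?S * Y 0 ^ Suc l * Lam)"
    by (simp only: left_diff_distrib mult.assoc)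
  also have "\<dots> = Yl as * Y 0 ^ Suc l * (?h * Lam)
      - Yl as * (2 * of_nat (Suc l) * (Y p * Y 0 ^ l)) * Lam - 2 * (?S * Y 0 ^ Suc l * Lam)"
    by (simp only: h_Y_power left_diff_distrib right_diff_distrib mult.assoc)
  also have "Yl as * (2 * of_nat (Suc l) * (Y p * Y 0 ^ l)) = 2 * of_nat (Suc l) * (Yl (p # as) * Y 0 ^ l)"
  proof -
    have "Yl as * (of_nat (2 * Suc l) * (Y p * Y 0 ^ l)) = of_nat (2 * Suc l) * (Yl (p # as) * Y 0 ^ l)"
      by (simp only: of_nat_left_commute commute_left[OF Y_Yl[symmetric]] Yl_Cons mult.assoc)
    then show ?thesis by (simp only: of_nat_mult of_nat_numeral)
  qed
  also have "?S * Y 0 ^ Suc l * Lam = (\<Sum>j<length as. Yl (as[j := as ! j + p]) * Y 0 ^ Suc l * Lam)"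
    by (simp only: sum_distrib_right)
  finally show ?thesis by (simp only: h_Lam mult.assoc diff_diff_eq add.commute)
qed

text \<open>Expanding the product of the series sum_k y_{a_i + k} u^k distributes \<open>c\<close>
  over the \<open>l\<close> factors. This is how complete homogeneous polynomials arise, with x^a
  sent to a monomial in the y.\<close>

lemma Yl_nth:
  "fps_nth (Yl (map a [0..<l])) c = hsum (\<lambda>a. ymon (map a [0..<l])) l c a"
proof (induction l arbitrary: c)
  case 0
  then show ?case by (simp add: hsum_0_left)
next
  case (Suc l)
  have Yl_snoc: "Yl (as @ [k]) = Yl as * Y k" and ymon_snoc: "ymon (as @ [k]) = ymon as * y k" for as k
    by (simp_all add: Yl_def ymon_def)
  have "fps_nth (Yl (map a [0..<Suc l])) c =
      (\<Sum>i=0..c. hsum (\<lambda>a. ymon (map a [0..<l])) l i a * y (a l + (c - i)))"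
    by (simp add: Yl_snoc fps_mult_nth Suc Y_def)
  also have "\<dots> = (\<Sum>k\<le>c. hsum (\<lambda>a. ymon (map a [0..<l])) l (c - k) a * y (a l + k))"
    by (rule sum.reindex_bij_witness[where i = "\<lambda>i. c - i" and j = "\<lambda>i. c - i"]) auto
  also have "\<dots> = hsum (\<lambda>a. ymon (map a [0..<Suc l])) (Suc l) c a"
    unfolding hsum_def sum_comps_Suc
    by (intro sum.cong refl) (auto simp: ymon_snoc sum_distrib_right intro!: sum.cong arg_cong[where f = ymon] arg_cong2[where f = "(*)"])
  finally show ?case .
qed

end

text \<open>\<open>N\<close> models vectors that are of highest weight \<open>d\<close> modulo the
  submodule \<open>Q\<close>. Both are subspaces of the ambient ring, so no quotient has to be
  formed. The weight is an integer because n - s is negative once the number s of odd factors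
  exceeds n.\<close>

locale sl2_highest = sl2_current scale x y h
  for scale :: "'r::comm_ring_1 \<Rightarrow> 'a::ring_1 \<Rightarrow> 'a" (infixr "*s" 75) and x y h :: "nat \<Rightarrow> 'a" +
  fixes Q N :: "'a set" and d :: int
  assumes sQ: "subspace Q" and sN: "subspace N"
    and xQ: "v \<in> Q \<Longrightarrow> x k * v \<in> Q"
    and yQ: "v \<in> Q \<Longrightarrow> y k * v \<in> Q"
    and hQ: "v \<in> Q \<Longrightarrow> h k * v \<in> Q"
    and xN: "v \<in> N \<Longrightarrow> x k * v \<in> Q"
    and hN: "v \<in> N \<Longrightarrow> h k * v \<in> N"
    and h0: "v \<in> N \<Longrightarrow> h 0 * v = of_int d * v"
    and nilp: "v \<in> N \<Longrightarrow> \<exists>K. y 0 ^ K * v \<in> Q"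
begin

lemma h0_y0_power: "h 0 * y 0 ^ j = y 0 ^ j * h 0 - 2 * of_nat j * y 0 ^ j"
proof (induction j)
  case (Suc j)
  have "h 0 * y 0 ^ Suc j = (y 0 * h 0 - 2 * y 0) * y 0 ^ j"
    by (simp only: power_Suc mult.assoc[symmetric] hy) simp
  also have "\<dots> = y 0 * (h 0 * y 0 ^ j) - 2 * y 0 ^ Suc j"
    by (simp add: left_diff_distrib mult.assoc)
  also have "y 0 * (h 0 * y 0 ^ j) = y 0 ^ Suc j * h 0 - 2 * of_nat j * y 0 ^ Suc j"
    using of_nat_left_commute[of "y 0" "2 * j" "y 0 ^ j"]
    by (simp add: Suc right_diff_distrib mult.assoc)
  finally show ?case by (simp add: algebra_simps mult_2)
qed simp

lemma x0_y0_power: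
  "x 0 * y 0 ^ Suc j = y 0 ^ Suc j * x 0 + of_nat (Suc j) * (y 0 ^ j * h 0 - of_nat j * y 0 ^ j)"
proof (induction j)
  case 0
  then show ?case by (simp add: xy)
next
  case (Suc j)
  have "x 0 * y 0 ^ Suc (Suc j) = (y 0 * x 0 + h 0) * y 0 ^ Suc j"
    by (simp only: power_Suc[of _ "Suc j"] mult.assoc[symmetric] xy) simp
  also have "\<dots> = y 0 * (x 0 * y 0 ^ Suc j) + h 0 * y 0 ^ Suc j"
    by (simp only: distrib_right mult.assoc)
  also have "y 0 * (x 0 * y 0 ^ Suc j) =
      y 0 ^ Suc (Suc j) * x 0 + of_nat (Suc j) * (y 0 ^ Suc j * h 0 - of_nat j * y 0 ^ Suc j)"
    by (simp only: Suc) (simp only: distrib_left right_diff_distrib of_nat_left_commute[of "y 0"] power_Suc mult.assoc)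
  finally have "x 0 * y 0 ^ Suc (Suc j) = y 0 ^ Suc (Suc j) * x 0
      + (of_nat (Suc j) * (y 0 ^ Suc j * h 0 - of_nat j * y 0 ^ Suc j)
         + (y 0 ^ Suc j * h 0 - 2 * of_nat (Suc j) * y 0 ^ Suc j))"
    by (simp only: h0_y0_power add.assoc)
  moreover have "of_nat (Suc j) * (P - of_nat j * q) + (P - 2 * of_nat (Suc j) * q) =
      of_nat (Suc (Suc j)) * (P - of_nat (Suc j) * q)" for P q :: 'a
    by (simp only: of_nat_Suc) (simp only: algebra_simps mult_2 mult_1_left mult_1_right)
  ultimately show ?case by (simp only:)
qed

text \<open>The classical sl(2) argument: modulo \<open>Q\<close>, x_0 y_0^{j+1} v equals (j+1)(d-j)
  y_0^j v, and for j > d the factor is invertible. So membership descends from the exponent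
  \<open>K\<close> supplied by nilpotence to every exponent above \<open>d\<close>.\<close>

lemma y0_power_in_Q:
  assumes v: "v \<in> N" and j: "int j > d"
  shows "y 0 ^ j * v \<in> Q"
proof -
  obtain K where K: "y 0 ^ K * v \<in> Q" using nilp[OF v] by blast
  have down: "y 0 ^ j * v \<in> Q" if "y 0 ^ Suc j * v \<in> Q" "int j > d" for j
  proof -
    \<comment> \<open>The factor d - j is written as - e with e a positive natural number, since
      \<open>of_nat_cancel\<close> divides by positive naturals.\<close>
    define e where "e = nat (int j - d)"
    have d: "d = int j - int e" "e > 0" using that(2) by (simp_all add: e_def)
    have "y 0 ^ j * (h 0 * v) = of_int d * (y 0 ^ j * v)"
      by (simp only: h0[OF v] mult.assoc[symmetric] mult_of_int_commute[of d "y 0 ^ j", symmetric])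
    then have "x 0 * (y 0 ^ Suc j * v) =
        y 0 ^ Suc j * (x 0 * v) + of_nat (Suc j) * ((of_int d - of_nat j) * (y 0 ^ j * v))"
      by (simp only: mult.assoc[symmetric] x0_y0_power)
        (simp only: mult.assoc distrib_right left_diff_distrib)
    also have "(of_int d - of_nat j :: 'a) = - of_nat e" by (simp add: d)
    finally have "of_nat (Suc j * e) * (y 0 ^ j * v) = y 0 ^ Suc j * (x 0 * v) - x 0 * (y 0 ^ Suc j * v)"
      by (simp only: of_nat_mult mult_minus_left mult_minus_right mult.assoc) simp
    moreover have "y 0 ^ i * u \<in> Q" if "u \<in> Q" for i u
      using that by (induction i) (simp_all add: mult.assoc yQ)
    then have "y 0 ^ Suc j * (x 0 * v) \<in> Q" using xN[OF v] by blast
    ultimately have "of_nat (Suc j * e) * (y 0 ^ j * v) \<in> Q"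
      using xQ[OF that(1), of 0] by (simp only:) (rule subspace_diff[OF sQ])
    then show ?thesis by (rule of_nat_cancel[OF sQ, rotated]) (use d in simp)
  qed
  show ?thesis
  proof (cases "K \<le> j")
    case True
    then show ?thesis
      using K by (induction j rule: dec_induct) (simp_all add: mult.assoc yQ)
  next
    case False
    then have "j \<le> K" by simp
    then show ?thesis using j
    proof (induction j rule: inc_induct)
      case base
      then show ?case using K by simp
    next
      case (step j)
      show ?case by (rule down) (use step in simp_all)
    qed
  qed
qed

lemma lam_N: "v \<in> N \<Longrightarrow> lam c * v \<in> N"
proof (induction c arbitrary: v rule: less_induct)
  case (less c)
  show ?case
  proof (cases c)
    case 0
    then show ?thesis using less by simp
  next
    case (Suc c')
    have "(\<Sum>k\<le>c'. h (Suc k) * lam (c' - k) * v) \<in> N"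
      using less Suc by (intro subspace_sum[OF sN]) (simp add: mult.assoc hN)
    then show ?thesis
      by (simp add: Suc lam.simps(2) scale_mult_left sum_distrib_right subspace_neg[OF sN] subspace_scale[OF sN])
  qed
qed

definition preserves_Q :: "'a fps \<Rightarrow> bool" where
  "preserves_Q f \<longleftrightarrow> (\<forall>i. \<forall>v\<in>Q. fps_nth f i * v \<in> Q)"

lemma preserves_Q_mult: "preserves_Q f \<Longrightarrow> preserves_Q g \<Longrightarrow> preserves_Q (f * g)"
  by (auto simp: preserves_Q_def fps_mult_nth sum_distrib_right mult.assoc intro!: subspace_sum[OF sQ])

lemma preserves_Q_Y: "preserves_Q (Y a)"
  by (simp add: preserves_Q_def Y_def yQ)

lemma preserves_Q_one: "preserves_Q 1"
  by (simp add: preserves_Q_def subspace_0[OF sQ])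

lemma preserves_Q_Y_power: "preserves_Q (Y 0 ^ l)"
  by (induction l) (simp_all add: preserves_Q_one preserves_Q_mult preserves_Q_Y)

text \<open>Up to an invertible integer, coefficient \<open>c + 1\<close> with \<open>l\<close>
  factors comes from applying \<open>x 1\<close> to coefficient \<open>c\<close> with
  \<open>l + 1\<close> factors, and the sum of the two numbers is the same. The base case is
  nilpotence of \<open>y 0\<close> beyond the weight.\<close>

lemma garland:
  assumes "v \<in> N" "int (l + c) > d"
  shows "fps_nth (Y 0 ^ l * Lam) c * v \<in> Q"
  using assms(2)
proof (induction c arbitrary: l)
  case 0
  have "fps_nth (Y 0 ^ l * Lam) 0 = y 0 ^ l"
    by (simp add: fps_power_zeroth Y_def)
  then show ?case using y0_power_in_Q[OF assms(1), of l] 0 by simp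
next
  case (Suc c)
  let ?D = "fps_nth (Y 0 ^ l * Lam) (Suc c) * v"
  have "x 1 * (fps_nth (Y 0 ^ Suc l * Lam) c * v) =
     fps_nth (fps_const (x 1) * (Y 0 ^ Suc l * Lam)) c * v"
    by (simp add: mult.assoc)
  also have "\<dots> = fps_nth (Y 0 ^ Suc l * (fps_const (x 1) * Lam)) c * v - of_nat (Suc l * Suc c) * ?D"
    by (simp only: X_Y_power_Lam fps_of_nat[symmetric] fps_sub_nth left_diff_distrib fps_mult_left_const_nth
          fps_deriv_nth of_nat_mult mult.assoc Suc_eq_plus1[symmetric])
  finally have "of_nat (Suc l * Suc c) * ?D =
     fps_nth (Y 0 ^ Suc l * (fps_const (x 1) * Lam)) c * v - x 1 * (fps_nth (Y 0 ^ Suc l * Lam) c * v)"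
    by simp
  also have "\<dots> \<in> Q"
  proof (intro subspace_diff[OF sQ] xQ Suc.IH)
    have "fps_nth (Y 0 ^ Suc l * (fps_const (x 1) * Lam)) c * v =
        (\<Sum>i=0..c. fps_nth (Y 0 ^ Suc l) i * (x 1 * (lam (c - i) * v)))"
      by (simp add: fps_mult_nth[of "Y 0 ^ Suc l"] sum_distrib_right mult.assoc del: power_Suc)
    also have "\<dots> \<in> Q"
      using preserves_Q_Y_power[of "Suc l"] unfolding preserves_Q_def
      by (intro subspace_sum[OF sQ]) (simp add: xN lam_N assms(1))
    finally show "fps_nth (Y 0 ^ Suc l * (fps_const (x 1) * Lam)) c * v \<in> Q" .
  qed (use Suc.prems in simp)
  finally show ?case by (rule of_nat_cancel[OF sQ, rotated]) simp
qed

lemma lam_in_Q: "v \<in> N \<Longrightarrow> int c > d \<Longrightarrow> lam c * v \<in> Q"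
  using garland[of v 0 c] by simp

text \<open>Induction on the number of shifted factors. Apply \<open>h p\<close> to the product in
  which \<open>Y p\<close> is replaced by a further \<open>Y 0\<close>: all terms but one are
  covered by the induction hypothesis, and that one has the invertible coefficient 2(l + 1). The
  vector varies because \<open>h p\<close> also reaches \<open>v\<close>.\<close>

lemma garland_polarised:
  assumes "v \<in> N" "int (length as + l + c) > d"
  shows "fps_nth (Yl as * Y 0 ^ l * Lam) c * v \<in> Q"
  using assms
proof (induction k \<equiv> "length as" arbitrary: as l v c)
  case 0
  then show ?case using garland[of v l c] by simp
next
  case (Suc k)
  then obtain p as' where as: "as = p # as'" by (cases as) auto
  define U where "U as = Yl as * Y 0 ^ Suc l * Lam" for as
  have UQ: "fps_nth (U bs) c * u \<in> Q" if "length bs = k" "u \<in> N" for bs u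
    unfolding U_def using that Suc.prems as Suc.hyps(2) by (intro Suc.hyps(1)) auto
  let ?V = "fps_nth (Yl as * Y 0 ^ l * Lam) c * v"
  have "h p * (fps_nth (U as') c * v) = fps_nth (fps_const (h p) * U as') c * v"
    by (simp add: mult.assoc)
  also have "\<dots> = fps_nth (U as') c * (h p * v)
     - of_nat 2 * (\<Sum>j<length as'. fps_nth (U (as'[j := as' ! j + p])) c * v)
     - of_nat (2 * Suc l) * ?V"
  proof -
    define S where "S = (\<Sum>j<length as'. U (as'[j := as' ! j + p]))"
    define W where "W = Yl as * Y 0 ^ l * Lam"
    have "2 * S = fps_const (of_nat 2) * S"
      by (simp add: numeral_fps_const)
    moreover have "2 * of_nat (Suc l) * W = fps_const (of_nat (2 * Suc l)) * W"
      by (simp only: fps_of_nat) (simp only: of_nat_mult of_nat_numeral)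
    ultimately have "fps_const (h p) * U as' =
        U as' * fps_const (h p) - fps_const (of_nat 2) * S - fps_const (of_nat (2 * Suc l)) * W"
      using h_Yl_Lam[of p as' l, folded U_def as, folded S_def W_def] by (simp only:)
    then show ?thesis
      by (simp only: S_def W_def left_diff_distrib fps_sub_nth fps_mult_left_const_nth
          fps_mult_right_const_nth fps_sum_nth sum_distrib_right mult.assoc)
  qed
  finally have "of_nat (2 * Suc l) * ?V = fps_nth (U as') c * (h p * v)
     - of_nat 2 * (\<Sum>j<length as'. fps_nth (U (as'[j := as' ! j + p])) c * v)
     - h p * (fps_nth (U as') c * v)"
    by simp
  also have "\<dots> \<in> Q"
    using Suc.hyps(2) as Suc.prems(1)
    by (intro subspace_diff[OF sQ] subspace_of_nat[OF sQ] subspace_sum[OF sQ] UQ hQ) (auto simp: hN)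
  finally show ?case by (rule of_nat_cancel[OF sQ, rotated]) simp
qed

definition boxmon :: "nat \<Rightarrow> nat \<Rightarrow> 'a set" where
  "boxmon m l = {ymon ks * v | ks v. v \<in> N \<and> length ks = l \<and> l \<le> m \<and> (\<forall>k\<in>set ks. k + l \<le> m)}"

text \<open>Induction on the total degree of the exponents. A coefficient of the series with
  \<open>Lam\<close> is the complete homogeneous relation plus terms in which some
  \<open>lam (c - i)\<close> with i < c acts on \<open>v\<close>. There \<open>v\<close> is replaced
  by another vector of \<open>N\<close> and the monomial has smaller degree.\<close>

lemma ymon_box_span_fun:
  assumes "d = int m" "v \<in> N" "supp_below l a"
  shows "ymon (map a [0..<l]) * v \<in> span (Q \<union> boxmon m l)"
  using assms(2,3)
proof (induction D \<equiv> "\<Sum>i<l. a i" arbitrary: a v rule: less_induct)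
  case (less a v)
  define D where "D = (\<Sum>i<l. a i)"
  define T where "T = span (Q \<union> boxmon m l)"
  have sT: "subspace T" and QT: "Q \<subseteq> T" by (auto simp: T_def intro: span_base)
  define F where "F a = ymon (map a [0..<l])" for a
  \<comment> \<open>The map is cut down to degree \<open>D\<close>: in that degree the lower terms
    fall under the induction hypothesis, in every other degree the relations demanded by
    \<open>box_span\<close> hold trivially.\<close>
  define \<Phi> where "\<Phi> a = (if (\<Sum>i<l. a i) = D then F a * v else 0)" for a
  have Yl_F: "fps_nth (Yl (map a [0..<l])) c = hsum F l c a" for a c
    by (simp add: Yl_nth hsum_def F_def)
  have IH: "F b * u \<in> T" if "(\<Sum>i<l. b i) < D" "u \<in> N" "supp_below l b" for b u
    using less.hyps[of b u] that by (simp add: D_def F_def T_def)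
  have "\<Phi> a \<in> span (T \<union> {\<Phi> a' | a'. supp_below l a' \<and> (\<forall>i<l. a' i + l \<le> m)})"
  proof (rule box_span[OF sT])
    show "supp_below l a" by fact
    fix i j and a :: "nat \<Rightarrow> nat" assume ij: "i < l" "j < l"
    have ms: "mset (map (a \<circ> transpose i j) [0..<l]) = mset (map a [0..<l])"
      using ij by (rule mset_map_transpose)
    have "F (a \<circ> transpose i j) = F a"
      unfolding F_def by (rule ymon_mset) (rule ms)
    moreover have "(\<Sum>k<l. (a \<circ> transpose i j) k) = (\<Sum>k<l. a k)"
      using arg_cong[OF ms, of sum_mset]
      by (simp only: sum_mset_sum_list interv_sum_list_conv_sum_set_nat atLeast0LessThan set_upt)
    ultimately show "\<Phi> (a \<circ> transpose i j) = \<Phi> a" by (simp only: \<Phi>_def)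
  next
    fix a c assume a: "supp_below l a" "c + l > m"
    have deg: "(\<Sum>i<l. a i + b i) = (\<Sum>i<l. a i) + c" if "b \<in> comps l c" for b c
      using that by (simp add: comps_def sum.distrib)
    show "hsum \<Phi> l c a \<in> T"
    proof (cases "(\<Sum>i<l. a i) + c = D")
      case False
      then have "hsum \<Phi> l c a = 0"
        unfolding hsum_def by (intro sum.neutral) (simp add: \<Phi>_def deg)
      then show ?thesis by (simp add: subspace_0[OF sT])
    next
      case True
      have "hsum \<Phi> l c a = hsum F l c a * v"
        unfolding hsum_def sum_distrib_right by (intro sum.cong) (simp_all add: \<Phi>_def deg True)
      also have "\<dots> = fps_nth (Yl (map a [0..<l])) c * v" by (simp add: Yl_F)
      also have "\<dots> = fps_nth (Yl (map a [0..<l]) * Y 0 ^ 0 * Lam) c * v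
          - (\<Sum>i<c. hsum F l i a * (lam (c - i) * v))"
        by (simp add: fps_mult_nth atLeast0AtMost lessThan_Suc_atMost[symmetric] sum_distrib_right
            distrib_right Yl_F mult.assoc)
      also have "\<dots> \<in> T"
      proof (intro subspace_diff[OF sT] subspace_sum[OF sT])
        show "fps_nth (Yl (map a [0..<l]) * Y 0 ^ 0 * Lam) c * v \<in> T"
          using garland_polarised[OF less.prems(1), of "map a [0..<l]" 0 c] a(2) assms(1) QT by auto
        fix i assume "i \<in> {..<c}"
        then have "F (\<lambda>k. a k + b k) * (lam (c - i) * v) \<in> T" if "b \<in> comps l i" for b
          using that a(1) True less.prems(1)
          by (intro IH lam_N) (auto simp: deg, auto simp: supp_below_def comps_def)
        then show "hsum F l i a * (lam (c - i) * v) \<in> T"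
          unfolding hsum_def sum_distrib_right by (intro subspace_sum[OF sT]) auto
      qed
      finally show ?thesis .
    qed
  qed
  also have "\<dots> \<subseteq> T"
  proof (rule span_minimal[OF _ sT], rule subsetI)
    fix u assume "u \<in> T \<union> {\<Phi> a' | a'. supp_below l a' \<and> (\<forall>i<l. a' i + l \<le> m)}"
    then show "u \<in> T"
    proof
      assume "u \<in> {\<Phi> a' | a'. supp_below l a' \<and> (\<forall>i<l. a' i + l \<le> m)}"
      then obtain a' where a': "u = \<Phi> a'" "supp_below l a'" "\<forall>i<l. a' i + l \<le> m" by blast
      have lm: "l \<le> m \<or> F a' * v \<in> Q"
        using garland_polarised[OF less.prems(1), of "map a' [0..<l]" 0 0] assms(1)
        by (cases "l \<le> m") (auto simp: Yl_F)
      show "u \<in> T"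
      proof (cases "(\<Sum>i<l. a' i) = D \<and> F a' * v \<notin> Q")
        case True
        then have "F a' * v \<in> boxmon m l"
          unfolding boxmon_def F_def using a' lm less.prems(1)
          by (auto intro!: exI[of _ "map a' [0..<l]"] exI[of _ v])
        then show ?thesis using True a' by (auto simp: \<Phi>_def T_def intro: span_base)
      next
        case False
        then show ?thesis using a' QT by (auto simp: \<Phi>_def subspace_0[OF sT])
      qed
    qed
  qed
  finally show ?case by (simp add: \<Phi>_def D_def F_def T_def)
qed

lemma ymon_box_span:
  assumes "d = int m" "v \<in> N"
  shows "ymon ks * v \<in> span (Q \<union> boxmon m (length ks))"
proof -
  define a where "a i = (if i < length ks then ks ! i else 0)" for i
  have "map a [0..<length ks] = ks"
    by (rule nth_equalityI) (simp_all add: a_def)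
  moreover have "supp_below (length ks) a" by (simp add: supp_below_def a_def)
  ultimately show ?thesis using ymon_box_span_fun[OF assms] by metis
qed

end

section \<open>Spanning\<close>

lemma of_int_left_commute: "u * (of_int z * v) = of_int z * (u * v)" for u v :: "'a::ring_1"
  by (simp only: mult.assoc[symmetric] mult_of_int_commute[of z u])

section \<open>Sorting products of anticommuting elements\<close>

lemma anticommuting_prod_insort:
  fixes e :: "nat \<Rightarrow> 'a::ring_1"
  assumes "\<And>i j. e i * e j = - (e j * e i)"
  shows "prod_list (map e (insort a xs)) = e a * prod_list (map e xs) \<or>
    prod_list (map e (insort a xs)) = - (e a * prod_list (map e xs))"
proof (induction xs)
  case (Cons x xs)
  have "e x * (e a * v) = - (e a * (e x * v))" for v
    by (simp add: assms[of x a] flip: mult.assoc)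
  then show ?case using Cons by auto
qed simp

lemma anticommuting_prod_repeat:
  fixes e :: "nat \<Rightarrow> 'a::ring_1"
  assumes "\<And>i j. e i * e j = - (e j * e i)" "\<And>i. e i * e i = 0" "a \<in> set xs"
  shows "e a * prod_list (map e xs) = 0"
  using assms(3)
proof (induction xs)
  case (Cons x xs)
  have "e a * (e x * v) = - (e x * (e a * v))" for v
    by (simp add: assms(1)[of a x] flip: mult.assoc)
  moreover have "e a * (e a * v) = 0" for v
    by (simp add: assms(2) flip: mult.assoc)
  ultimately show ?case using Cons by auto
qed simp

lemma anticommuting_prod_sort:
  fixes e :: "nat \<Rightarrow> 'a::ring_1"
  assumes "\<And>i j. e i * e j = - (e j * e i)" "\<And>i. e i * e i = 0"
  defines "P \<equiv> \<lambda>xs. prod_list (map e xs)"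
  shows "P xs = 0 \<or> distinct xs \<and> (P xs = P (sorted_list_of_set (set xs)) \<or> P xs = - P (sorted_list_of_set (set xs)))"
proof (induction xs)
  case (Cons a xs)
  have rep: "e a * P ys = 0" if "a \<in> set ys" for ys
    unfolding P_def by (rule anticommuting_prod_repeat[OF assms(1,2) that])
  show ?case
  proof (cases "a \<in> set xs")
    case True
    then have "P (a # xs) = 0" using rep[of xs] by (simp add: P_def)
    then show ?thesis by simp
  next
    case False
    have "P (sorted_list_of_set (set (a # xs))) = P (insort a (sorted_list_of_set (set xs)))"
      using False by (simp add: sorted_list_of_set_insert)
    then show ?thesis
      using anticommuting_prod_insort[of e a "sorted_list_of_set (set xs)", OF assms(1)] Cons False
      unfolding P_def by auto
  qed
qed (simp add: P_def)

lemma anticommuting_prod_move: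
  fixes e :: "nat \<Rightarrow> 'a::ring_1"
  assumes "\<And>i j. e i * e j = - (e j * e i)"
  shows "e a * (prod_list (map e xs) * v) = prod_list (map e xs) * (e a * v) \<or>
    e a * (prod_list (map e xs) * v) = - (prod_list (map e xs) * (e a * v))"
proof (induction xs)
  case (Cons x xs)
  have "e a * (e x * v) = - (e x * (e a * v))" for v
    by (simp add: assms[of a x] flip: mult.assoc)
  then show ?case using Cons by (auto simp: mult.assoc)
qed simp

lemma sum_triangle:
  "(\<Sum>k\<le>n. \<Sum>i\<le>n - k. f k i) = (\<Sum>(k, i)\<in>{(k, i). k + i \<le> n}. f k i)" for n :: nat
proof -
  have "Sigma {..n} (\<lambda>k. {..n - k}) = {(k, i). k + i \<le> n}" by auto
  then show ?thesis by (simp add: sum.Sigma)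
qed

lemma sum_triangle_swap:
  "(\<Sum>k\<le>n. \<Sum>i\<le>n - k. f k i) = (\<Sum>i\<le>n. \<Sum>k\<le>n - i. f k i)" for n :: nat
  unfolding sum_triangle
  by (rule sum.reindex_bij_witness[where i = prod.swap and j = prod.swap]) auto

text \<open>The module consists of left multiples of the ring element \<open>w\<close>, so the
  action is multiplication. The brackets are those of sl(1|2) in current form, and the scalars stay
  abstract so that polynomials in the deformation parameter can be inserted.\<close>

locale weyl_spanning = rational_algebra scale
  for scale :: "'r::comm_ring_1 \<Rightarrow> 'a::ring_1 \<Rightarrow> 'a" (infixr "*s" 75) +
  fixes g :: "gen \<Rightarrow> nat \<Rightarrow> 'a" and w :: 'a and psi :: "gen \<Rightarrow> nat \<Rightarrow> 'r" and n :: nat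
  assumes X2Y2: "g X2 i * g Y2 j = g Y2 j * g X2 i + g H2 (i + j)"
    and H2Y2: "g H2 i * g Y2 j = g Y2 j * g H2 i - 2 * g Y2 (i + j)"
    and Y2Y2: "g Y2 i * g Y2 j = g Y2 j * g Y2 i"
    and H2H2: "g H2 i * g H2 j = g H2 j * g H2 i"
    and X1X1: "g X1 i * g X1 j = - (g X1 j * g X1 i)"
    and Y3Y3: "g Y3 i * g Y3 j = - (g Y3 j * g Y3 i)"
    and Y3X1: "g Y3 i * g X1 j = - (g X1 j * g Y3 i) + g Y2 (i + j)"
    and Y2X1: "g Y2 i * g X1 j = g X1 j * g Y2 i"
    and Y2Y3: "g Y2 i * g Y3 j = g Y3 j * g Y2 i"
    and X2X1: "g X2 i * g X1 j = g X1 j * g X2 i - g X3 (i + j)"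
    and X2Y3: "g X2 i * g Y3 j = g Y3 j * g X2 i + g Y1 (i + j)"
    and X3X1: "g X3 i * g X1 j = - (g X1 j * g X3 i)"
    and X3Y3: "g X3 i * g Y3 j = - (g Y3 j * g X3 i) + g H1 (i + j) - g H2 (i + j)"
    and X3Y2: "g X3 i * g Y2 j = g Y2 j * g X3 i + g X1 (i + j)"
    and Y1X1: "g Y1 i * g X1 j = - (g X1 j * g Y1 i) + g H1 (i + j)"
    and Y1Y3: "g Y1 i * g Y3 j = - (g Y3 j * g Y1 i)"
    and Y1Y2: "g Y1 i * g Y2 j = g Y2 j * g Y1 i - g Y3 (i + j)"
    and H2X1: "g H2 i * g X1 j = g X1 j * g H2 i - g X1 (i + j)"
    and H2Y3: "g H2 i * g Y3 j = g Y3 j * g H2 i - g Y3 (i + j)"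
    and H1X1: "g H1 i * g X1 j = g X1 j * g H1 i"
    and H1Y3: "g H1 i * g Y3 j = g Y3 j * g H1 i - g Y3 (i + j)"
    and H1Y2: "g H1 i * g Y2 j = g Y2 j * g H1 i - g Y2 (i + j)"
    and nplus_w: "a \<in> nplus \<Longrightarrow> g a i * w = 0"
    and hgens_w: "a \<in> hgens \<Longrightarrow> g a i * w = psi a i *s w"
    and Y2_w: "g Y2 0 ^ Suc n * w = 0"
    and psi_H2: "psi H2 0 = of_nat n"
begin

sublocale sl2_current scale "g X2" "g Y2" "g H2"
  by unfold_locales (fact X2Y2 H2Y2 Y2Y2 H2H2)+

definition wact :: "word \<Rightarrow> 'a" where "wact u = prod_list (map (\<lambda>(a, r). g a r) u)"

lemma wact_Nil [simp]: "wact [] = 1"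
  and wact_Cons [simp]: "wact (l # u) = g (fst l) (snd l) * wact u"
  and wact_append [simp]: "wact (u @ v) = wact u * wact v"
  by (simp_all add: wact_def split_beta)

lemma wact_Pair: "wact (map (Pair a) ks) = prod_list (map (g a) ks)"
  by (induction ks) simp_all

lemma ymon_wact: "ymon ks = wact (map (Pair Y2) ks)"
  by (simp add: wact_Pair ymon_def)

section \<open>Filtration by the number of odd factors\<close>

definition odd_word :: "word \<Rightarrow> bool" where "odd_word L \<longleftrightarrow> fst ` set L \<subseteq> {X1, Y3}"

lemma odd_word_Nil [simp]: "odd_word []"
  and odd_word_Cons [simp]: "odd_word (l # L) \<longleftrightarrow> fst l \<in> {X1, Y3} \<and> odd_word L"
  and odd_word_append [simp]: "odd_word (L @ L') \<longleftrightarrow> odd_word L \<and> odd_word L'"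
  and odd_word_map [simp]: "a \<in> {X1, Y3} \<Longrightarrow> odd_word (map (Pair a) ks)"
  by (auto simp: odd_word_def)

definition odd_span :: "nat \<Rightarrow> 'a set" where
  "odd_span s = span {wact L * w | L. odd_word L \<and> length L = s}"

text \<open>The strict bound makes \<open>filt s\<close> the part below \<open>odd_span s\<close>;
  in particular \<open>filt 0\<close> is zero.\<close>

definition filt :: "nat \<Rightarrow> 'a set" where
  "filt s = span {ymon ks * (wact L * w) | ks L. odd_word L \<and> length L < s}"

lemma subspace_odd_span [simp]: "subspace (odd_span s)" by (simp add: odd_span_def)
lemma subspace_filt [simp]: "subspace (filt s)" by (simp add: filt_def)

lemma filt_base: "odd_word L \<Longrightarrow> length L < s \<Longrightarrow> ymon ks * (wact L * w) \<in> filt s"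
  unfolding filt_def by (rule span_base) blast

lemma filt_base': "odd_word L \<Longrightarrow> length L < s \<Longrightarrow> wact L * w \<in> filt s"
  using filt_base[of L s "[]"] by simp

lemma odd_span_base: "odd_word L \<Longrightarrow> length L = s \<Longrightarrow> wact L * w \<in> odd_span s"
  unfolding odd_span_def by (rule span_base) blast

lemma filt_mono: "s \<le> s' \<Longrightarrow> v \<in> filt s \<Longrightarrow> v \<in> filt s'"
  unfolding filt_def by (erule subsetD[OF span_mono, rotated]) (use less_le_trans in blast)

lemma odd_span_filt: "s < s' \<Longrightarrow> v \<in> odd_span s \<Longrightarrow> v \<in> filt s'"
  unfolding odd_span_def
  by (rule subsetD[OF span_minimal]) (auto intro: filt_base')

lemma filt_left_mult:
  assumes "v \<in> filt s" "subspace T"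
    "\<And>ks L. odd_word L \<Longrightarrow> length L < s \<Longrightarrow> e * (ymon ks * (wact L * w)) \<in> T"
  shows "e * v \<in> T"
  by (rule span_left_mult[OF assms(1)[unfolded filt_def] assms(2)]) (use assms(3) in auto)

lemma odd_span_left_mult:
  assumes "v \<in> odd_span s" "subspace T"
    "\<And>L. odd_word L \<Longrightarrow> length L = s \<Longrightarrow> e * (wact L * w) \<in> T"
  shows "e * v \<in> T"
  by (rule span_left_mult[OF assms(1)[unfolded odd_span_def] assms(2)]) (use assms(3) in auto)

lemma Y2_filt: "v \<in> filt s \<Longrightarrow> g Y2 k * v \<in> filt s"
proof (erule filt_left_mult)
  fix ks L assume "odd_word L" "length L < s"
  then show "g Y2 k * (ymon ks * (wact L * w)) \<in> filt s"
    using filt_base[of L s "k # ks"] by (simp add: mult.assoc)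
qed simp

lemma ymon_filt: "v \<in> filt s \<Longrightarrow> ymon ks * v \<in> filt s"
  by (induction ks) (simp_all add: mult.assoc Y2_filt)

lemma Y2_odd: "a \<in> {X1, Y3} \<Longrightarrow> g a k * g Y2 j = g Y2 j * g a k"
  using Y2X1 Y2Y3 by auto

lemma odd_ymon: "a \<in> {X1, Y3} \<Longrightarrow> g a k * (ymon ks * v) = ymon ks * (g a k * v)"
  by (induction ks) (simp_all add: mult.assoc commute_left[OF Y2_odd])

lemma odd_filt: "v \<in> filt s \<Longrightarrow> a \<in> {X1, Y3} \<Longrightarrow> g a k * v \<in> filt (Suc s)"
proof (erule filt_left_mult)
  fix ks L assume "odd_word L" "length L < s" "a \<in> {X1, Y3}"
  then show "g a k * (ymon ks * (wact L * w)) \<in> filt (Suc s)"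
    using filt_base[of "(a, k) # L" "Suc s" ks] by (simp add: odd_ymon mult.assoc)
qed simp

lemma odd_odd_span: "v \<in> odd_span s \<Longrightarrow> a \<in> {X1, Y3} \<Longrightarrow> g a k * v \<in> odd_span (Suc s)"
proof (erule odd_span_left_mult)
  fix L assume "odd_word L" "length L = s" "a \<in> {X1, Y3}"
  then show "g a k * (wact L * w) \<in> odd_span (Suc s)"
    using odd_span_base[of "(a, k) # L" "Suc s"] by (simp add: mult.assoc)
qed simp

lemma wact_filt: "v \<in> filt s \<Longrightarrow> odd_word L \<Longrightarrow> wact L * v \<in> filt (length L + s)"
  by (induction L) (auto simp: mult.assoc odd_filt)

lemma hgens_odd:
  assumes "a \<in> hgens" "b \<in> {X1, Y3}"
  shows "\<exists>c. \<forall>i j. g a i * g b j = g b j * g a i + c *s g b (i + j)"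
  using assms
proof (cases "a = H1 \<and> b = X1")
  case True
  then show ?thesis by (intro exI[of _ 0]) (simp add: H1X1)
next
  case False
  then show ?thesis using assms
    by (intro exI[of _ "-1"]) (auto simp: hgens_def H2X1 H2Y3 H1Y3)
qed

lemma hgens_odd_word: "a \<in> hgens \<Longrightarrow> odd_word L \<Longrightarrow> g a k * (wact L * w) \<in> odd_span (length L)"
proof (induction L)
  case Nil
  then show ?case
    using odd_span_base[of "[]" 0] by (simp add: hgens_w subspace_scale)
next
  case (Cons l L)
  obtain b r where l: "l = (b, r)" by (cases l)
  obtain c where c: "\<And>i j. g a i * g b j = g b j * g a i + c *s g b (i + j)"
    using hgens_odd[of a b] Cons.prems l by auto
  have "g a k * (wact (l # L) * w) = g b r * (g a k * (wact L * w)) + c *s (wact ((b, k + r) # L) * w)"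
    by (simp add: l c distrib_right scale_mult_left flip: mult.assoc)
  also have "\<dots> \<in> odd_span (length (l # L))"
  proof (intro subspace_add subspace_scale subspace_odd_span)
    show "g b r * (g a k * (wact L * w)) \<in> odd_span (length (l # L))"
      using Cons l by (auto intro!: odd_odd_span)
    show "wact ((b, k + r) # L) * w \<in> odd_span (length (l # L))"
      using Cons.prems l by (intro odd_span_base) auto
  qed
  finally show ?case .
qed

lemma hgens_odd_span: "v \<in> odd_span s \<Longrightarrow> a \<in> hgens \<Longrightarrow> g a k * v \<in> odd_span s"
  by (erule odd_span_left_mult) (auto intro: hgens_odd_word)

lemma hgens_filt:
  assumes "v \<in> filt s" "a \<in> hgens"
  shows "g a k * v \<in> filt s"
proof (rule filt_left_mult[OF assms(1)])
  fix ks L assume L: "odd_word L" "length L < s"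
  obtain c where c: "\<And>i j. g a i * g Y2 j = g Y2 j * g a i + c *s g Y2 (i + j)"
  proof (cases "a = H1")
    case True
    then show thesis by (intro that[of "-1"]) (simp add: H1Y2)
  next
    case False
    have "2 *s v = 2 * v" for v using of_nat_scale[of 2 v] by simp
    then show thesis using False assms(2) by (intro that[of "-2"]) (auto simp: H2Y2 hgens_def)
  qed
  show "g a k * (ymon ks * (wact L * w)) \<in> filt s"
  proof (induction ks)
    case Nil
    then show ?case using odd_span_filt[OF L(2) hgens_odd_word[OF assms(2) L(1)]] by simp
  next
    case (Cons j ks)
    have "g a k * (ymon (j # ks) * (wact L * w)) =
        g Y2 j * (g a k * (ymon ks * (wact L * w))) + c *s (g Y2 (k + j) * (ymon ks * (wact L * w)))"
      by (simp add: c distrib_right scale_mult_left flip: mult.assoc)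
    also have "\<dots> \<in> filt s"
      by (intro subspace_add subspace_scale subspace_filt Y2_filt Cons filt_base L)
    finally show ?case .
  qed
qed simp

text \<open>The bracket of x3 or y1 with x1 or y3 is zero or lies in the Cartan part, which
  preserves the number of odd factors. So the generator applied and one odd factor of the word
  disappear together.\<close>

lemma X3_Y1_odd_word: "a \<in> {X3, Y1} \<Longrightarrow> odd_word L \<Longrightarrow> g a k * (wact L * w) \<in> filt (length L)"
proof (induction L)
  case Nil
  then show ?case by (auto simp: nplus_w nplus_def subspace_0)
next
  case (Cons l L)
  obtain b r where l: "l = (b, r)" by (cases l)
  have b: "b \<in> {X1, Y3}" and L: "odd_word L" using Cons.prems l by auto
  have IH: "g b r * (g a k * (wact L * w)) \<in> filt (Suc (length L))"
    using Cons.IH Cons.prems b L by (intro odd_filt) auto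
  have H: "g c k * (wact L * w) \<in> filt (Suc (length L))" if "c \<in> hgens" for c k
    using odd_span_filt[OF _ hgens_odd_word[OF that L]] by auto
  have "\<exists>u. g a k * (g b r * (wact L * w)) = - (g b r * (g a k * (wact L * w))) + u \<and> u \<in> filt (Suc (length L))"
    using Cons.prems(1) b
  proof (safe, goal_cases)
    case 1
    show ?case
      by (intro exI[of _ 0]) (simp add: X3X1 subspace_0 flip: mult.assoc)
  next
    case 2
    show ?case
      using H[of H1 "k + r"] H[of H2 "k + r"]
      by (intro exI[of _ "g H1 (k + r) * (wact L * w) - g H2 (k + r) * (wact L * w)"])
        (simp add: X3Y3 distrib_right left_diff_distrib subspace_diff hgens_def flip: mult.assoc)
  next
    case 3
    show ?case
      using H[of H1 "k + r"]
      by (intro exI[of _ "g H1 (k + r) * (wact L * w)"])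
        (simp add: Y1X1 distrib_right left_diff_distrib hgens_def flip: mult.assoc)
  next
    case 4
    show ?case
      by (intro exI[of _ 0]) (simp add: Y1Y3 subspace_0 flip: mult.assoc)
  qed
  then show ?case
    using IH l by (auto simp: mult.assoc intro!: subspace_diff)
qed

text \<open>Passing an odd factor turns x2 into - x3 or y1, which \<open>X3_Y1_odd_word\<close>
  handles. Hence words in odd generators are highest weight vectors for the sl(2) currents modulo
  fewer odd factors.\<close>

lemma X2_odd_word: "odd_word L \<Longrightarrow> g X2 k * (wact L * w) \<in> filt (length L)"
proof (induction L)
  case Nil
  then show ?case by (simp add: nplus_w nplus_def subspace_0)
next
  case (Cons l L)
  obtain b r where l: "l = (b, r)" by (cases l)
  have b: "b \<in> {X1, Y3}" and L: "odd_word L" using Cons.prems l by auto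
  have IH: "g b r * (g X2 k * (wact L * w)) \<in> filt (Suc (length L))"
    using Cons.IH b L by (intro odd_filt) auto
  have A: "g a i * (wact L * w) \<in> filt (Suc (length L))" if "a \<in> {X3, Y1}" for a i
    using filt_mono[OF _ X3_Y1_odd_word[OF that L]] by simp
  have "g X2 k * (g b r * (wact L * w)) \<in> filt (Suc (length L))"
  proof (cases "b = X1")
    case True
    then have "g X2 k * (g b r * (wact L * w)) = g b r * (g X2 k * (wact L * w)) - g X3 (k + r) * (wact L * w)"
      by (simp add: X2X1 left_diff_distrib flip: mult.assoc)
    then show ?thesis using IH A[of X3] by (simp add: subspace_diff)
  next
    case False
    then have "g X2 k * (g b r * (wact L * w)) = g b r * (g X2 k * (wact L * w)) + g Y1 (k + r) * (wact L * w)"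
      using b by (simp add: X2Y3 distrib_right flip: mult.assoc)
    then show ?thesis using IH A[of Y1] by (simp add: subspace_add)
  qed
  then show ?case using l by (simp add: mult.assoc)
qed

lemma X2_filt:
  assumes "v \<in> filt s"
  shows "g X2 k * v \<in> filt s"
proof (rule filt_left_mult[OF assms])
  fix ks L assume L: "odd_word L" "length L < s"
  show "g X2 k * (ymon ks * (wact L * w)) \<in> filt s"
  proof (induction ks)
    case Nil
    then show ?case using filt_mono[OF _ X2_odd_word[OF L(1)]] L by simp
  next
    case (Cons j ks)
    have "g X2 k * (ymon (j # ks) * (wact L * w)) =
        g Y2 j * (g X2 k * (ymon ks * (wact L * w))) + g H2 (k + j) * (ymon ks * (wact L * w))"
      by (simp add: X2Y2 distrib_right flip: mult.assoc)
    also have "\<dots> \<in> filt s"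
      by (intro subspace_add subspace_filt Y2_filt Cons hgens_filt filt_base L) (simp add: hgens_def)
    finally show ?case .
  qed
qed simp

text \<open>The brackets of x3 and y1 with y2 are x1 and - y3, so in the presence of y2 the level
  may rise by one.\<close>

lemma X3_Y1_filt:
  assumes "v \<in> filt s" "a \<in> {X3, Y1}"
  shows "g a k * v \<in> filt (Suc s)"
proof (rule filt_left_mult[OF assms(1)])
  fix ks L assume L: "odd_word L" "length L < s"
  show "g a k * (ymon ks * (wact L * w)) \<in> filt (Suc s)"
  proof (induction ks)
    case Nil
    then show ?case using filt_mono[OF _ X3_Y1_odd_word[OF assms(2) L(1)]] L by simp
  next
    case (Cons j ks)
    have odd: "g b i * (ymon ks * (wact L * w)) \<in> filt (Suc s)" if "b \<in> {X1, Y3}" for b i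
      using that by (intro odd_filt filt_base L) auto
    have "g a k * (ymon (j # ks) * (wact L * w)) - g Y2 j * (g a k * (ymon ks * (wact L * w))) \<in> filt (Suc s)"
      using assms(2) odd[of X1 "k + j"] odd[of Y3 "k + j"]
      by (auto simp: X3Y2 Y1Y2 distrib_right left_diff_distrib subspace_neg simp flip: mult.assoc)
    from subspace_add[OF subspace_filt this Y2_filt[OF Cons, of j]] show ?case by simp
  qed
qed simp

lemma g_filt:
  assumes "v \<in> filt s"
  shows "g a k * v \<in> filt (Suc s)"
proof (cases "a \<in> {X1, Y3} \<or> a \<in> {X3, Y1}")
  case True
  then show ?thesis using odd_filt[OF assms] X3_Y1_filt[OF assms] by blast
next
  case False
  then have "g a k * v \<in> filt s"
    using X2_filt[OF assms] Y2_filt[OF assms] hgens_filt[OF assms, of a] by (cases a) (auto simp: hgens_def)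
  then show ?thesis by (rule filt_mono[rotated]) simp
qed

text \<open>Both odd generators x1 and y3 lower the h2-weight by one, starting from n on
  \<open>w\<close>.\<close>

lemma H2_0_odd_span:
  assumes "v \<in> odd_span s"
  shows "g H2 0 * v = of_int (int n - int s) * v"
proof -
  have gen: "g H2 0 * (wact L * w) = of_int (int n - int (length L)) * (wact L * w)" if "odd_word L" for L
    using that
  proof (induction L)
    case Nil
    have "psi H2 0 *s w = of_nat n * w" by (simp add: psi_H2 of_nat_scale)
    then show ?case using hgens_w[of H2 0] by (simp add: hgens_def)
  next
    case (Cons l L)
    obtain b r where l: "l = (b, r)" by (cases l)
    have "g H2 0 * g b r = g b r * g H2 0 - g b r"
      using Cons.prems l H2X1[of 0] H2Y3[of 0] by auto
    then have "g H2 0 * (wact (l # L) * w) = g b r * (g H2 0 * (wact L * w)) - wact (l # L) * w"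
      by (simp add: l left_diff_distrib flip: mult.assoc)
    also have "g H2 0 * (wact L * w) = of_int (int n - int (length L)) * (wact L * w)"
      using Cons by simp
    also have "g b r * \<dots> = of_int (int n - int (length L)) * (wact (l # L) * w)"
      by (simp only: of_int_left_commute l wact_Cons fst_conv snd_conv mult.assoc)
    finally show ?case by (simp add: algebra_simps)
  qed
  have "(g H2 0 - of_int (int n - int s)) * v \<in> {0}"
    by (rule odd_span_left_mult[OF assms subspace_single_0]) (use gen in \<open>auto simp: left_diff_distrib\<close>)
  then show ?thesis by (simp add: left_diff_distrib)
qed

text \<open>y2 commutes with x1 and with y3, so the power reaches \<open>w\<close>
  unchanged.\<close>

lemma Y2_power_odd_span:
  assumes "v \<in> odd_span s"
  shows "g Y2 0 ^ Suc n * v = 0"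
proof -
  have "g Y2 0 ^ Suc n * v \<in> {0}"
  proof (rule odd_span_left_mult[OF assms subspace_single_0])
    fix L assume "odd_word L"
    have comm: "g Y2 0 ^ m * g b r = g b r * g Y2 0 ^ m" if "b \<in> {X1, Y3}" for m b r
      by (induction m) (simp_all add: mult.assoc commute_left[OF Y2_odd[OF that, symmetric]])
    have "g Y2 0 ^ Suc n * (wact L * w) = wact L * (g Y2 0 ^ Suc n * w)"
      using \<open>odd_word L\<close>
      by (induction L) (simp_all add: mult.assoc commute_left[OF comm] del: power_Suc)
    then show "g Y2 0 ^ Suc n * (wact L * w) \<in> {0}" by (simp add: Y2_w del: power_Suc)
  qed
  then show ?thesis by simp
qed

lemma odd_span_highest:
  "sl2_highest scale (g X2) (g Y2) (g H2) (filt s) (odd_span s) (int n - int s)"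
proof unfold_locales
  show "g X2 k * v \<in> filt s" if "v \<in> odd_span s" for v k
    using that by (rule odd_span_left_mult) (use X2_odd_word in auto)
  show "\<exists>K. g Y2 0 ^ K * v \<in> filt s" if "v \<in> odd_span s" for v
    using Y2_power_odd_span[OF that] by (metis subspace_0 subspace_filt)
qed (auto simp: X2_filt Y2_filt hgens_filt hgens_odd_span H2_0_odd_span hgens_def simp del: of_int_diff)

lemma lam_odd_span: "v \<in> odd_span s \<Longrightarrow> n < c + s \<Longrightarrow> lam c * v \<in> filt s"
  using sl2_highest.lam_in_Q[OF odd_span_highest] by simp

text \<open>On x1 and y3 bracketing with \<open>g H2 p\<close> is minus the shift by p. Conjugation
  by Lam(u) therefore multiplies by exp(sum_{p>0} t^p u^p / p) = 1/(1 - t u), whose geometric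
  expansion gives the shifts. The proof checks this through Newton's recursion.\<close>

lemma lam_odd:
  assumes "a \<in> {X1, Y3}"
  shows "lam c * g a r = (\<Sum>i\<le>c. g a (r + i) * lam (c - i))"
proof (induction c rule: less_induct)
  case (less c)
  have Ha: "g H2 i * g a j = g a j * g H2 i - g a (i + j)" for i j
    using assms H2X1 H2Y3 by auto
  show ?case
  proof (cases c)
    case (Suc c')
    have pt: "g H2 (Suc k) * (g a (r + i) * lam (c' - k - i)) =
        g a (r + i) * (g H2 (Suc k) * lam (c' - i - k)) - g a (r + Suc (k + i)) * lam (c' - (k + i))" for k i
    proof -
      have "g H2 (Suc k) * (g a (r + i) * v) = g a (r + i) * (g H2 (Suc k) * v) - g a (r + Suc (k + i)) * v" for v
        using arg_cong[OF Ha[of "Suc k" "r + i"], of "\<lambda>u. u * v"]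
        by (simp add: left_diff_distrib mult.assoc ac_simps)
      moreover have "c' - k - i = c' - (k + i)" "c' - i - k = c' - (k + i)" by simp_all
      ultimately show ?thesis by metis
    qed
    have "of_nat (Suc c') * (lam (Suc c') * g a r) = - (\<Sum>k\<le>c'. g H2 (Suc k) * (lam (c' - k) * g a r))"
      by (simp only: mult.assoc[symmetric] of_nat_lam mult_minus_left sum_distrib_right)
    also have "\<dots> = - (\<Sum>k\<le>c'. \<Sum>i\<le>c' - k. g H2 (Suc k) * (g a (r + i) * lam (c' - k - i)))"
      using less.IH Suc by (simp add: sum_distrib_left)
    also have "\<dots> = - (\<Sum>k\<le>c'. \<Sum>i\<le>c' - k. g a (r + i) * (g H2 (Suc k) * lam (c' - i - k)))
        + (\<Sum>k\<le>c'. \<Sum>i\<le>c' - k. g a (r + Suc (k + i)) * lam (c' - (k + i)))"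
      by (simp only: pt sum_subtractf) simp
    also have "(\<Sum>k\<le>c'. \<Sum>i\<le>c' - k. g a (r + i) * (g H2 (Suc k) * lam (c' - i - k))) =
        (\<Sum>i\<le>c'. g a (r + i) * (\<Sum>k\<le>c' - i. g H2 (Suc k) * lam (c' - i - k)))"
      unfolding sum_distrib_left by (rule sum_triangle_swap)
    also have "\<dots> = (\<Sum>i\<le>c'. - (of_nat (Suc c' - i) * (g a (r + i) * lam (Suc c' - i))))"
    proof (intro sum.cong refl)
      fix i assume "i \<in> {..c'}"
      then have "Suc c' - i = Suc (c' - i)" by auto
      then have "(\<Sum>k\<le>c' - i. g H2 (Suc k) * lam (c' - i - k)) = - (of_nat (Suc c' - i) * lam (Suc c' - i))"
        by (simp only: of_nat_lam minus_minus)
      then show "g a (r + i) * (\<Sum>k\<le>c' - i. g H2 (Suc k) * lam (c' - i - k)) =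
          - (of_nat (Suc c' - i) * (g a (r + i) * lam (Suc c' - i)))"
        by (simp only: mult_minus_right of_nat_left_commute)
    qed
    also have "- \<dots> = (\<Sum>i\<le>Suc c'. of_nat (Suc c' - i) * (g a (r + i) * lam (Suc c' - i)))"
      by (simp add: sum_negf del: of_nat_Suc of_nat_diff)
    \<comment> \<open>Grouped by j = k + i, each value occurs j + 1 times. Added to the weights
      \<open>Suc c' - i\<close> above, this gives every term of the claim the same factor
      \<open>Suc c'\<close>.\<close>
    also have "(\<Sum>k\<le>c'. \<Sum>i\<le>c' - k. g a (r + Suc (k + i)) * lam (c' - (k + i))) =
        (\<Sum>j\<le>c'. \<Sum>i\<le>j. g a (r + Suc j) * lam (c' - j))"
      unfolding sum_triangle sum.triangle_reindex_eq by (intro sum.cong) auto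
    also have "\<dots> = (\<Sum>j\<le>Suc c'. of_nat j * (g a (r + j) * lam (Suc c' - j)))"
      by (simp add: sum.atMost_Suc_shift del: sum.atMost_Suc of_nat_Suc)
    finally have "of_nat (Suc c') * (lam (Suc c') * g a r) =
        (\<Sum>i\<le>Suc c'. (of_nat (Suc c' - i) + of_nat i) * (g a (r + i) * lam (Suc c' - i)))"
      by (simp only: sum.distrib[symmetric] distrib_right)
    also have "\<dots> = of_nat (Suc c') * (\<Sum>i\<le>Suc c'. g a (r + i) * lam (Suc c' - i))"
      unfolding sum_distrib_left by (intro sum.cong refl) (simp only: of_nat_add[symmetric], simp)
    finally have "of_nat (Suc c') * (lam (Suc c') * g a r) =
        of_nat (Suc c') * (\<Sum>i\<le>Suc c'. g a (r + i) * lam (Suc c' - i))" .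
    then have "lam (Suc c') * g a r - (\<Sum>i\<le>Suc c'. g a (r + i) * lam (Suc c' - i)) \<in> {0}"
      using of_nat_cancel[OF subspace_single_0, of "Suc c'"
          "lam (Suc c') * g a r - (\<Sum>i\<le>Suc c'. g a (r + i) * lam (Suc c' - i))"]
      by (simp only: right_diff_distrib zero_less_Suc diff_self singleton_iff)
    then show ?thesis using Suc by (simp only: singleton_iff right_minus_eq)
  qed simp
qed

lemma lam_w: "\<exists>l. lam c * w = l *s w"
proof (induction c rule: less_induct)
  case (less c)
  show ?case
  proof (cases c)
    case 0
    then show ?thesis by (intro exI[of _ 1]) simp
  next
    case (Suc c')
    have "g H2 (Suc k) * (lam (c' - k) * w) \<in> span {w}" for k
    proof -
      obtain l where "lam (c' - k) * w = l *s w" using less[of "c' - k"] Suc by (auto simp: less_Suc_eq_le)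
      then show ?thesis
        using hgens_w[of H2 "Suc k"] by (simp add: scale_mult_right hgens_def span_base subspace_scale)
    qed
    then have "lam c * w \<in> span {w}"
      by (simp add: Suc lam.simps(2) scale_mult_left sum_distrib_right mult.assoc subspace_sum subspace_scale subspace_neg)
    then show ?thesis by (auto simp: span_singleton)
  qed
qed

section \<open>Bounding the exponents of x1 and y3\<close>

abbreviation x1w :: "nat list \<Rightarrow> 'a" where "x1w ks \<equiv> wact (map (Pair X1) ks)"
abbreviation y3w :: "nat list \<Rightarrow> 'a" where "y3w ks \<equiv> wact (map (Pair Y3) ks)"

definition y3_span :: "nat \<Rightarrow> 'a set" where
  "y3_span k = span {y3w bs * w | bs. length bs = k}"

lemma y3_span_base: "length bs = k \<Longrightarrow> y3w bs * w \<in> y3_span k"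
  unfolding y3_span_def by (rule span_base) blast

lemma subspace_y3_span [simp]: "subspace (y3_span k)" by (simp add: y3_span_def)

lemma y3_span_odd_span: "v \<in> y3_span k \<Longrightarrow> v \<in> odd_span k"
  unfolding y3_span_def
  by (erule subsetD[OF span_minimal, rotated 2]) (auto intro!: odd_span_base)

lemma Y3_y3_span: "v \<in> y3_span k \<Longrightarrow> g Y3 b * v \<in> y3_span (Suc k)"
  unfolding y3_span_def
proof (erule span_left_mult)
  fix u assume "u \<in> {y3w bs * w | bs. length bs = k}"
  then obtain bs where "u = y3w bs * w" "length bs = k" by blast
  then have "g Y3 b * u = y3w (b # bs) * w" "length (b # bs) = Suc k" by (simp_all add: mult.assoc)
  then show "g Y3 b * u \<in> span {y3w bs * w | bs. length bs = Suc k}"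
    by (intro span_base) blast
qed simp

lemma lam_y3_span:
  assumes "v \<in> y3_span k"
  shows "lam c * v \<in> y3_span k"
proof (rule span_left_mult[OF assms[unfolded y3_span_def]])
  fix u assume "u \<in> {y3w bs * w | bs. length bs = k}"
  then obtain bs where u: "u = y3w bs * w" "length bs = k" by blast
  have "lam c * (y3w bs * w) \<in> y3_span (length bs)"
  proof (induction bs arbitrary: c)
    case Nil
    obtain l where "lam c * w = l *s w" using lam_w by blast
    then show ?case using y3_span_base[of "[]" 0] by (simp add: subspace_scale)
  next
    case (Cons b bs)
    have "lam c * (y3w (b # bs) * w) = (\<Sum>i\<le>c. g Y3 (b + i) * (lam (c - i) * (y3w bs * w)))"
      using arg_cong[OF lam_odd[of Y3 c b], of "\<lambda>u. u * (y3w bs * w)"]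
      by (simp add: sum_distrib_right mult.assoc)
    also have "\<dots> \<in> y3_span (length (b # bs))"
      using Cons by (intro subspace_sum) (auto intro!: Y3_y3_span)
    finally show ?case .
  qed
  then show "lam c * u \<in> y3_span k" using u by simp
qed simp

lemma y3_span_0: "v \<in> y3_span 0 \<Longrightarrow> \<exists>l. v = l *s w"
proof -
  have "{y3w bs * w | bs. length bs = 0} = {w}" by auto
  then show "v \<in> y3_span 0 \<Longrightarrow> \<exists>l. v = l *s w" by (auto simp: y3_span_def span_singleton)
qed

text \<open>\<open>g a 0 * u\<close> has k + 1 odd factors, hence h2-weight n - k - 1, and from c =
  n - k on \<open>lam c\<close> maps it into the lower filtration. Expanding by
  \<open>lam_odd\<close> isolates \<open>g a c * u\<close>, the term with the largest shift.\<close>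

lemma odd_reduce_step:
  assumes a: "a \<in> {X1, Y3}" and u: "u \<in> y3_span k" and "n - k \<le> c"
  shows "g a c * u \<in> span ({g a j * u' | j u'. j < c \<and> u' \<in> y3_span k} \<union> filt (Suc k))"
    (is "_ \<in> ?T")
proof -
  have "lam c * (g a 0 * u) = (\<Sum>i\<le>c. g a i * (lam (c - i) * u))"
    using arg_cong[OF lam_odd[OF a, of c 0], of "\<lambda>v. v * u"]
    by (simp add: sum_distrib_right mult.assoc)
  also have "\<dots> = g a c * u + (\<Sum>i<c. g a i * (lam (c - i) * u))"
    by (simp add: lessThan_Suc_atMost[symmetric] add.commute)
  finally have "g a c * u = lam c * (g a 0 * u) - (\<Sum>i<c. g a i * (lam (c - i) * u))"
    by simp
  also have "\<dots> \<in> ?T"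
  proof (intro subspace_diff subspace_sum subspace_span)
    have "g a 0 * u \<in> odd_span (Suc k)"
      using u a by (intro odd_odd_span y3_span_odd_span)
    then have "lam c * (g a 0 * u) \<in> filt (Suc k)"
      using assms(3) by (intro lam_odd_span) auto
    then show "lam c * (g a 0 * u) \<in> ?T" by (intro span_base) blast
    fix i assume "i \<in> {..<c}"
    then show "g a i * (lam (c - i) * u) \<in> ?T"
      using lam_y3_span[OF u] by (intro span_base) blast
  qed
  finally show ?thesis .
qed

lemma odd_reduce:
  assumes a: "a \<in> {X1, Y3}"
  shows "u \<in> y3_span k \<Longrightarrow>
    g a c * u \<in> span ({g a j * u' | j u'. j < n - k \<and> u' \<in> y3_span k} \<union> filt (Suc k))"
proof (induction c arbitrary: u rule: less_induct)
  case (less c)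
  show ?case
  proof (cases "c < n - k")
    case True
    then show ?thesis using less.prems by (intro span_base) blast
  next
    case False
    then have "g a c * u \<in> span ({g a j * u' | j u'. j < c \<and> u' \<in> y3_span k} \<union> filt (Suc k))"
      using less.prems by (intro odd_reduce_step[OF a]) auto
    then show ?thesis
      by (rule subsetD[OF span_minimal, rotated 2]) (use less.IH in \<open>auto intro: span_base\<close>)
  qed
qed

lemma odd_odd: "a \<in> {X1, Y3} \<Longrightarrow> g a i * g a j = - (g a j * g a i)"
  using X1X1 Y3Y3 by auto

lemma odd_move:
  assumes "a \<in> {X1, Y3}"
  shows "g a r * (wact (map (Pair a) ks) * v) \<in>
    {wact (map (Pair a) ks) * (g a r * v), - (wact (map (Pair a) ks) * (g a r * v))}"
  using anticommuting_prod_move[of "g a", OF odd_odd[OF assms]] unfolding wact_Pair by simp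

text \<open>Each y3 is moved next to \<open>w\<close> up to sign, where \<open>odd_reduce\<close>
  with k = 0 bounds its exponent by n - 1.\<close>

lemma y3_span_bounded:
  "v \<in> y3_span k \<Longrightarrow> v \<in> span ({y3w bs * w | bs. length bs = k \<and> set bs \<subseteq> {..<n}} \<union> filt k)"
proof -
  have gen: "y3w bs * w \<in> span ({y3w cs * w | cs. length cs = length bs \<and> set cs \<subseteq> {..<n}} \<union> filt (length bs))" for bs
  proof (induction bs)
    case Nil
    then show ?case by (intro span_base) auto
  next
    case (Cons b bs)
    let ?T = "span ({y3w cs * w | cs. length cs = length (b # bs) \<and> set cs \<subseteq> {..<n}} \<union> filt (length (b # bs)))"
    have F: "v \<in> ?T" if "v \<in> filt (length (b # bs))" for v
      using that by (intro span_base) blast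
    have "g Y3 b * (y3w bs * w) \<in> ?T"
    proof (rule span_left_mult[OF Cons])
      fix u assume "u \<in> {y3w cs * w | cs. length cs = length bs \<and> set cs \<subseteq> {..<n}} \<union> filt (length bs)"
      then show "g Y3 b * u \<in> ?T"
      proof
        assume "u \<in> filt (length bs)"
        then have "g Y3 b * u \<in> filt (length (b # bs))" by (auto intro: odd_filt)
        then show ?thesis by (rule F)
      next
        assume "u \<in> {y3w cs * w | cs. length cs = length bs \<and> set cs \<subseteq> {..<n}}"
        then obtain cs where cs: "u = y3w cs * w" "length cs = length bs" "set cs \<subseteq> {..<n}" by blast
        \<comment> \<open>By \<open>odd_move\<close> it suffices to treat the product in which the
          new factor stands directly before \<open>w\<close>.\<close>
        have "y3w cs * (g Y3 b * w) \<in> ?T"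
        proof (rule span_left_mult[OF odd_reduce])
          show "w \<in> y3_span 0" using y3_span_base[of "[]" 0] by simp
          fix t assume "t \<in> {g Y3 j * u' | j u'. j < n - 0 \<and> u' \<in> y3_span 0} \<union> filt (Suc 0)"
          then show "y3w cs * t \<in> ?T"
          proof
            assume "t \<in> filt (Suc 0)"
            then have "y3w cs * t \<in> filt (length (b # bs))" using wact_filt[of t "Suc 0" "map (Pair Y3) cs"] cs by simp
            then show ?thesis by (rule F)
          next
            assume "t \<in> {g Y3 j * u' | j u'. j < n - 0 \<and> u' \<in> y3_span 0}"
            then obtain j l where "t = g Y3 j * (l *s w)" "j < n" using y3_span_0 by fastforce
            then have "y3w cs * t = l *s (y3w (cs @ [j]) * w)" "length (cs @ [j]) = length (b # bs)" "set (cs @ [j]) \<subseteq> {..<n}"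
              using cs by (auto simp: mult.assoc scale_mult_right)
            moreover from this have "y3w (cs @ [j]) * w \<in> ?T" by (intro span_base) blast
            ultimately show ?thesis by (simp only: span_scale)
          qed
        qed simp_all
        then show ?thesis using odd_move[of Y3 b cs w] cs(1) by (auto intro: span_neg)
      qed
    qed simp
    then show ?case by (simp add: mult.assoc)
  qed
  show "v \<in> y3_span k \<Longrightarrow> v \<in> span ({y3w bs * w | bs. length bs = k \<and> set bs \<subseteq> {..<n}} \<union> filt k)"
    unfolding y3_span_def by (erule subsetD[OF span_minimal, rotated 2]) (use gen in auto)
qed

text \<open>An x1 is moved next to the y3 part with its \<open>k\<close> factors, whence the bound n
  - k that appears in \<open>inS\<close>. The reduction alters the y3 part, so that part is only
  kept inside \<open>y3_span k\<close>; its exponents are bounded afterwards.\<close>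

lemma x1w_bounded:
  "u \<in> y3_span k \<Longrightarrow> x1w as * u \<in>
    span ({x1w cs * u' | cs u'. length cs = length as \<and> set cs \<subseteq> {..<n - k} \<and> u' \<in> y3_span k} \<union> filt (length as + k))"
proof (induction as)
  case Nil
  then show ?case by (intro span_base) auto
next
  case (Cons a as)
  let ?T = "span ({x1w cs * u' | cs u'. length cs = length (a # as) \<and> set cs \<subseteq> {..<n - k} \<and> u' \<in> y3_span k}
      \<union> filt (length (a # as) + k))"
  have F: "v \<in> ?T" if "v \<in> filt (length (a # as) + k)" for v
    using that by (intro span_base) blast
  have "g X1 a * (x1w as * u) \<in> ?T"
  proof (rule span_left_mult[OF Cons.IH[OF Cons.prems]])
    fix v assume "v \<in> {x1w cs * u' | cs u'. length cs = length as \<and> set cs \<subseteq> {..<n - k} \<and> u' \<in> y3_span k}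
      \<union> filt (length as + k)"
    then show "g X1 a * v \<in> ?T"
    proof
      assume "v \<in> filt (length as + k)"
      then have "g X1 a * v \<in> filt (length (a # as) + k)" by (auto intro: odd_filt)
      then show ?thesis by (rule F)
    next
      assume "v \<in> {x1w cs * u' | cs u'. length cs = length as \<and> set cs \<subseteq> {..<n - k} \<and> u' \<in> y3_span k}"
      then obtain cs u' where cs: "v = x1w cs * u'" "length cs = length as" "set cs \<subseteq> {..<n - k}" "u' \<in> y3_span k"
        by blast
      have "x1w cs * (g X1 a * u') \<in> ?T"
      proof (rule span_left_mult[OF odd_reduce[OF _ cs(4)]])
        fix t assume "t \<in> {g X1 j * u' | j u'. j < n - k \<and> u' \<in> y3_span k} \<union> filt (Suc k)"
        then show "x1w cs * t \<in> ?T"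
        proof
          assume "t \<in> filt (Suc k)"
          then have "x1w cs * t \<in> filt (length (a # as) + k)"
            using wact_filt[of t "Suc k" "map (Pair X1) cs"] cs by simp
          then show ?thesis by (rule F)
        next
          assume "t \<in> {g X1 j * u' | j u'. j < n - k \<and> u' \<in> y3_span k}"
          then obtain j u'' where "t = g X1 j * u''" "j < n - k" "u'' \<in> y3_span k" by blast
          then have "x1w cs * t = x1w (cs @ [j]) * u''" "length (cs @ [j]) = length (a # as)"
            "set (cs @ [j]) \<subseteq> {..<n - k}" "u'' \<in> y3_span k"
            using cs by (auto simp: mult.assoc)
          then show ?thesis by (intro span_base) blast
        qed
      qed simp_all
      then show ?thesis using odd_move[of X1 a cs u'] cs(1) by (auto intro: span_neg)
    qed
  qed simp
  then show ?case by (simp add: mult.assoc)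
qed

definition xy_span :: "nat \<Rightarrow> 'a set" where
  "xy_span s = span ({x1w as * (y3w bs * w) | as bs. length as + length bs = s} \<union> filt s)"

lemma X1_xy_span: "v \<in> xy_span s \<Longrightarrow> g X1 a * v \<in> xy_span (Suc s)"
  unfolding xy_span_def
proof (erule span_left_mult)
  fix u assume "u \<in> {x1w as * (y3w bs * w) | as bs. length as + length bs = s} \<union> filt s"
  then show "g X1 a * u \<in> span ({x1w as * (y3w bs * w) | as bs. length as + length bs = Suc s} \<union> filt (Suc s))"
  proof
    assume "u \<in> filt s"
    then show ?thesis by (intro span_base UnI2 odd_filt) auto
  next
    assume "u \<in> {x1w as * (y3w bs * w) | as bs. length as + length bs = s}"
    then obtain as bs where "u = x1w as * (y3w bs * w)" "length as + length bs = s" by blast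
    then have "g X1 a * u = x1w (a # as) * (y3w bs * w)" "length (a # as) + length bs = Suc s"
      by (simp_all add: mult.assoc)
    then show ?thesis by (intro span_base UnI1) blast
  qed
qed simp

lemma filt_xy_span: "v \<in> filt s \<Longrightarrow> v \<in> xy_span s"
  unfolding xy_span_def by (rule span_base) blast

text \<open>Exchanging y3 and x1 produces a y2, which is even: the extra term has two odd factors
  fewer and belongs to the lower filtration.\<close>

lemma Y3_x1w: "g Y3 b * (x1w as * (y3w bs * w)) \<in> xy_span (Suc (length as + length bs))"
proof (induction as)
  case Nil
  have "y3w (b # bs) * w \<in> xy_span (length (b # bs))"
    unfolding xy_span_def by (intro span_base UnI1 CollectI exI[of _ "[]"] exI[of _ "b # bs"]) simp
  then show ?case by (simp add: mult.assoc)
next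
  case (Cons a as)
  let ?z = "x1w as * (y3w bs * w)"
  have "g Y3 b * (x1w (a # as) * (y3w bs * w)) = g Y2 (b + a) * ?z - g X1 a * (g Y3 b * ?z)"
    using arg_cong[OF Y3X1[of b a], of "\<lambda>u. u * ?z"]
    by (simp add: distrib_right left_diff_distrib mult.assoc)
  also have "\<dots> \<in> xy_span (Suc (length (a # as) + length bs))"
  proof (intro subspace_diff)
    have "wact (map (Pair X1) as @ map (Pair Y3) bs) * w \<in> filt (Suc (length (a # as) + length bs))"
      by (rule filt_base') auto
    then show "g Y2 (b + a) * ?z \<in> xy_span (Suc (length (a # as) + length bs))"
      by (intro filt_xy_span Y2_filt) (simp add: mult.assoc)
    show "g X1 a * (g Y3 b * ?z) \<in> xy_span (Suc (length (a # as) + length bs))"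
      using X1_xy_span[OF Cons] by simp
  qed (simp add: xy_span_def)
  finally show ?case .
qed

lemma odd_word_xy_span: "odd_word L \<Longrightarrow> wact L * w \<in> xy_span (length L)"
proof (induction L)
  case Nil
  show ?case unfolding xy_span_def
    by (intro span_base UnI1 CollectI exI[of _ "[]"]) simp
next
  case (Cons l L)
  obtain a r where l: "l = (a, r)" by (cases l)
  have IH: "wact L * w \<in> xy_span (length L)" using Cons by simp
  have "g a r * (wact L * w) \<in> xy_span (Suc (length L))"
  proof (cases "a = X1")
    case True
    then show ?thesis using X1_xy_span[OF IH] by simp
  next
    case False
    then have a: "a = Y3" using Cons.prems l by simp
    show ?thesis unfolding a
    proof (rule span_left_mult[OF IH[unfolded xy_span_def]])
      fix u assume "u \<in> {x1w as * (y3w bs * w) | as bs. length as + length bs = length L} \<union> filt (length L)"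
      then show "g Y3 r * u \<in> xy_span (Suc (length L))"
      proof
        assume "u \<in> filt (length L)"
        then show ?thesis by (intro filt_xy_span odd_filt) auto
      next
        assume "u \<in> {x1w as * (y3w bs * w) | as bs. length as + length bs = length L}"
        then obtain as bs where "u = x1w as * (y3w bs * w)" "length as + length bs = length L" by blast
        then show ?thesis using Y3_x1w[of r as bs] by simp
      qed
    qed (simp add: xy_span_def)
  qed
  then show ?case using l by (simp add: mult.assoc)
qed

text \<open>Anticommutation with itself gives 2 g^2 = 0, and 2 is invertible. So repeated exponents
  annihilate a product, and the others can be sorted up to sign.\<close>

lemma odd_sort:
  assumes a: "a \<in> {X1, Y3}"
  defines "W \<equiv> \<lambda>ks. wact (map (Pair a) ks)"
  shows "W ks = 0 \<or> distinct ks \<and> W ks \<in> {W (sorted_list_of_set (set ks)), - W (sorted_list_of_set (set ks))}"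
proof -
  have "g a i * g a i = 0" for i
  proof -
    have "of_nat 2 * (g a i * g a i) \<in> {0}"
      using odd_odd[OF a, of i i] by (simp add: mult_2 eq_neg_iff_add_eq_0)
    then have "g a i * g a i \<in> {0}" by (rule of_nat_cancel[OF subspace_single_0, rotated]) simp
    then show ?thesis by simp
  qed
  then show ?thesis
    using anticommuting_prod_sort[of "g a" ks, OF odd_odd[OF a]] unfolding W_def wact_Pair by simp
qed

definition reduced_span :: "nat \<Rightarrow> 'a set" where
  "reduced_span s = span ({x1w (sorted_list_of_set S) * (y3w (sorted_list_of_set S') * w) | S S'.
     S' \<subseteq> {..<n} \<and> S \<subseteq> {..<n - card S'} \<and> card S + card S' = s} \<union> filt s)"

text \<open>Facts \<open>3\<close>, \<open>2\<close>, \<open>1\<close> carry out the reductions in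
  an order that does not undo itself: bounding x1 may spoil the exponents of y3, whereas bounding y3
  and sorting keep the bound on x1.\<close>

lemma odd_word_reduced: "odd_word L \<Longrightarrow> wact L * w \<in> reduced_span (length L)"
proof -
  have sR: "subspace (reduced_span s)" for s by (simp add: reduced_span_def)
  have F: "v \<in> reduced_span s" if "v \<in> filt s" for v s
    unfolding reduced_span_def using that by (intro span_base) blast
  have 1: "x1w as * (y3w bs * w) \<in> reduced_span (length as + length bs)"
    if as: "set as \<subseteq> {..<n - length bs}" and bs: "set bs \<subseteq> {..<n}" for as bs
  proof (cases "x1w as = 0 \<or> y3w bs = 0")
    case True
    then show ?thesis by (auto simp: subspace_0[OF sR])
  next
    case False
    then have d: "distinct as" "distinct bs" using odd_sort[of X1 as] odd_sort[of Y3 bs] by auto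
    have "x1w (sorted_list_of_set (set as)) * (y3w (sorted_list_of_set (set bs)) * w) \<in> reduced_span (length as + length bs)"
      unfolding reduced_span_def
      by (intro span_base UnI1 CollectI exI[of _ "set as"] exI[of _ "set bs"])
        (use as bs d in \<open>simp add: distinct_card\<close>)
    then show ?thesis using False odd_sort[of X1 as] odd_sort[of Y3 bs]
      by (auto intro: subspace_neg[OF sR])
  qed
  have 2: "x1w as * u \<in> reduced_span (length as + k)"
    if as: "set as \<subseteq> {..<n - k}" and u: "u \<in> y3_span k" for as u k
  proof (rule span_left_mult[OF y3_span_bounded[OF u] sR])
    fix v assume "v \<in> {y3w bs * w | bs. length bs = k \<and> set bs \<subseteq> {..<n}} \<union> filt k"
    then show "x1w as * v \<in> reduced_span (length as + k)"
      using 1[of as] as wact_filt[of v k "map (Pair X1) as"] by (auto intro: F)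
  qed
  have 3: "x1w as * u \<in> reduced_span (length as + k)" if u: "u \<in> y3_span k" for as u k
    by (rule subsetD[OF span_minimal[OF _ sR] x1w_bounded[OF u]]) (auto intro: F, metis 2)
  show "odd_word L \<Longrightarrow> wact L * w \<in> reduced_span (length L)"
    by (rule subsetD[OF span_minimal[OF _ sR] odd_word_xy_span[unfolded xy_span_def]])
      (auto intro: F, metis 3 y3_span_base)
qed

end

text \<open>\<open>S\<close> and \<open>S'\<close> collect the exponents of x1 and of y3. Columns
  are numbered from 1 and exponents from 0, hence the shift.\<close>

definition smat :: "nat set \<Rightarrow> nat set \<Rightarrow> nat \<Rightarrow> nat \<Rightarrow> nat" where
  "smat S S' i j = (if i = 1 \<and> 1 \<le> j \<and> j - 1 \<in> S \<or> i = 2 \<and> 1 \<le> j \<and> j - 1 \<in> S' then 1 else 0)"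

lemma sum_indicator_shift:
  fixes S :: "nat set"
  assumes "S \<subseteq> {..<n}"
  shows "(\<Sum>j\<in>{1..n}. if 1 \<le> j \<and> j - 1 \<in> S then 1 else 0 :: nat) = card S"
proof -
  have "(\<Sum>j\<in>{1..n}. if 1 \<le> j \<and> j - 1 \<in> S then 1 else 0 :: nat) = (\<Sum>i\<in>{..<n}. if i \<in> S then 1 else 0 :: nat)"
    using sum.atLeast1_atMost_eq[of "\<lambda>j. if 1 \<le> j \<and> j - 1 \<in> S then 1 else 0 :: nat" n]
    by simp
  also have "\<dots> = card ({..<n} \<inter> S)" by (simp add: sum.If_cases)
  finally show ?thesis using assms by (simp add: Int_absorb1)
qed

lemma sum_smat:
  assumes "S \<subseteq> {..<n}" "S' \<subseteq> {..<n}"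
  shows "(\<Sum>j\<in>{1..n}. smat S S' 1 j) = card S" "(\<Sum>j\<in>{1..n}. smat S S' 2 j) = card S'"
  using sum_indicator_shift[OF assms(1)] sum_indicator_shift[OF assms(2)] by (simp_all add: smat_def)

lemma sA_smat: "S \<subseteq> {..<n} \<Longrightarrow> S' \<subseteq> {..<n} \<Longrightarrow> sA n (smat S S') = card S + card S'"
  using sum_smat[of S n S'] by (simp add: sA_def)

lemma inS_smat:
  assumes "S' \<subseteq> {..<n}" "S \<subseteq> {..<n - card S'}"
  shows "inS n (smat S S')"
proof -
  have "S \<subseteq> {..<n}" using assms by force
  then show ?thesis using assms sum_smat[of S n S']
    by (auto simp: inS_def) (auto simp: smat_def subset_iff)
qed

lemma xA_word_smat:
  assumes "S \<subseteq> {..<n}" "S' \<subseteq> {..<n}"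
  shows "xA_word n (smat S S') = map (Pair X1) (sorted_list_of_set S) @ map (Pair Y3) (sorted_list_of_set S')"
proof -
  have concat_if: "concat (map (\<lambda>j. if P j then [f j] else []) xs) = map f (filter P xs)"
    for P and f :: "nat \<Rightarrow> 'b" and xs by (induction xs) auto
  have sl: "sorted_list_of_set T = filter (\<lambda>a. a \<in> T) [0..<n]" if "T \<subseteq> {..<n}" for T
  proof -
    have "T = set (filter (\<lambda>a. a \<in> T) [0..<n])" using that by auto
    then show ?thesis
      by (metis sorted_list_of_set.idem_if_sorted_distinct sorted_upt distinct_upt distinct_filter sorted_wrt_filter)
  qed
  have up: "[1..<n + 1] = map Suc [0..<n]" by (simp add: map_Suc_upt)
  show ?thesis
    unfolding xA_word_def concat_if up sl[OF assms(1)] sl[OF assms(2)]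
    by (simp add: filter_map comp_def smat_def)
qed

lemma count_concat_replicate:
  "count (mset (concat (map (\<lambda>k. replicate (f k) k) [0..<M]))) k = (if k < M then f k else 0)"
  by (induction M) (auto simp: less_Suc_eq)

text \<open>A list of l exponents, each at most N - l, is a partition in an l by (N - l) box and so
  a POP with middle entry N - l. Zero exponents are not parts and are recovered through
  \<open>pop_mult\<close>. As \<open>rho_word\<close> orders the factors increasingly, only
  multisets agree.\<close>

lemma box_list_POP:
  assumes "length ks \<le> N" "\<forall>k\<in>set ks. k + length ks \<le> N"
  shows "\<exists>m xs vs. isPOP N 0 m xs \<and> rho_word N 0 m xs = map (Pair Y2) vs \<and> mset vs = mset ks"
proof -
  define m where "m = N - length ks"
  define xs where "xs = rev (sort (filter (\<lambda>k. 0 < k) ks))"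
  define vs where "vs = concat (map (\<lambda>k. replicate (pop_mult N m xs k) k) [0..<m + 1])"
  have len: "length xs = length (filter (\<lambda>k. 0 < k) ks)" by (simp add: xs_def)
  have "length xs \<le> length ks" unfolding len by (rule length_filter_le)
  then have "isPOP N 0 m xs"
    using assms by (auto simp: isPOP_def m_def xs_def)
  moreover have "rho_word N 0 m xs = map (Pair Y2) vs"
    by (simp add: rho_word_def vs_def map_concat comp_def)
  moreover have "mset vs = mset ks"
  proof (rule multiset_eqI)
    fix k
    have "count (mset vs) k = (if k < m + 1 then pop_mult N m xs k else 0)"
      unfolding vs_def by (rule count_concat_replicate)
    also have "\<dots> = count (mset ks) k"
    proof (cases "k = 0")
      case True
      have "length ks = length (filter (\<lambda>k. 0 < k) ks) + count (mset ks) 0"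
        by (induction ks) auto
      then show ?thesis using True assms len by (simp add: pop_mult_def m_def)
    next
      case False
      have "count_list xs k = count (mset (filter (\<lambda>k. 0 < k) ks)) k"
        unfolding count_mset[symmetric] by (simp add: xs_def)
      also have "\<dots> = count (mset ks) k" using False by simp
      finally have "count_list xs k = count (mset ks) k" .
      moreover have "count (mset ks) k = 0" if "\<not> k < m + 1"
        using that assms by (auto simp: m_def count_eq_zero_iff)
      ultimately show ?thesis using False by (simp add: pop_mult_def)
    qed
    finally show "count (mset vs) k = count (mset ks) k" .
  qed
  ultimately show ?thesis by blast
qed

section \<open>The spanning theorem for super POP vectors\<close>

context weyl_spanning
begin

definition spop_span :: "'a set" where
  "spop_span = span {wact (spop_word n P) * w | P. P \<in> superPOPs n}"

lemma subspace_spop_span [simp]: "subspace spop_span" by (simp add: spop_span_def)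

lemma box_xA_spop:
  assumes "S' \<subseteq> {..<n}" "S \<subseteq> {..<n - card S'}" "card S + card S' = s"
    "length ks \<le> n - s" "\<forall>k\<in>set ks. k + length ks \<le> n - s"
  shows "ymon ks * (wact (map (Pair X1) (sorted_list_of_set S)) * (wact (map (Pair Y3) (sorted_list_of_set S')) * w)) \<in> spop_span"
proof -
  have S: "S \<subseteq> {..<n}" using assms(2) by force
  obtain m xs vs where P: "isPOP (n - s) 0 m xs" "rho_word (n - s) 0 m xs = map (Pair Y2) vs" "mset vs = mset ks"
    using box_list_POP[OF assms(4,5)] by blast
  have sA: "sA n (smat S S') = s" using sA_smat[OF S assms(1)] assms(3) by simp
  have "(smat S S', m, xs) \<in> superPOPs n"
    using P(1) inS_smat[OF assms(1,2)] by (simp add: superPOPs_def sA)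
  moreover have "wact (spop_word n (smat S S', m, xs)) = ymon ks * (wact (map (Pair X1) (sorted_list_of_set S)) * wact (map (Pair Y3) (sorted_list_of_set S')))"
    using ymon_mset[OF P(3)] by (simp add: spop_word_def sA P(2) xA_word_smat[OF S assms(1)] ymon_wact)
  ultimately show ?thesis
    unfolding spop_span_def by (metis (mono_tags, lifting) mem_Collect_eq mult.assoc span_base)
qed

text \<open>Induction on the number of odd factors. For words with exactly s of them,
  \<open>ymon_box_span\<close> with weight n - s brings the y2-monomial into the box and
  \<open>odd_word_reduced\<close> brings the odd part into the shape of \<open>inS\<close>; both
  errors lie in the lower filtration.\<close>

lemma filt_spop_span: "filt s \<subseteq> spop_span"
proof (induction s)
  case 0
  show ?case by (simp add: filt_def subspace_0)
next
  case (Suc s)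
  interpret hw: sl2_highest scale "g X2" "g Y2" "g H2" "filt s" "odd_span s" "int n - int s"
    by (rule odd_span_highest)
  have "ymon ks * (wact L * w) \<in> spop_span" if L: "odd_word L" "length L < Suc s" for ks L
  proof (cases "length L = s")
    case False
    then show ?thesis using filt_base[OF L(1), of s ks] L(2) Suc by auto
  next
    case True
    then have v: "wact L * w \<in> odd_span s" using L by (intro odd_span_base)
    show ?thesis
    proof (cases "s \<le> n")
      case False
      \<comment> \<open>The weight n - s is negative, so already \<open>lam 0\<close>, the identity,
        maps into the lower filtration: the word itself is lower.\<close>
      then have "lam 0 * (wact L * w) \<in> filt s" using v by (intro hw.lam_in_Q) auto
      then show ?thesis using ymon_filt[of _ s ks] Suc by auto
    next
      case le: True
      \<comment> \<open>The box reduction returns arbitrary vectors of \<open>odd_span s\<close>,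
        hence the claim for every such \<open>v\<close>.\<close>
      have "ymon ks' * v \<in> spop_span" if ks': "length ks' \<le> n - s" "\<forall>k\<in>set ks'. k + length ks' \<le> n - s"
        and v: "v \<in> odd_span s" for ks' v
      proof (rule odd_span_left_mult[OF v])
        fix L assume L: "odd_word L" "length L = s"
        show "ymon ks' * (wact L * w) \<in> spop_span"
        proof (rule span_left_mult[OF odd_word_reduced[OF L(1), unfolded reduced_span_def]])
          fix u assume "u \<in> {x1w (sorted_list_of_set S) * (y3w (sorted_list_of_set S') * w) | S S'.
             S' \<subseteq> {..<n} \<and> S \<subseteq> {..<n - card S'} \<and> card S + card S' = length L} \<union> filt (length L)"
          then show "ymon ks' * u \<in> spop_span"
          proof
            assume "u \<in> filt (length L)"
            then show ?thesis using ymon_filt Suc L by blast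
          qed (use L ks' in \<open>auto intro: box_xA_spop\<close>)
        qed simp
      qed simp
      then have "hw.boxmon (n - s) (length ks) \<subseteq> spop_span"
        by (auto simp: hw.boxmon_def)
      then show ?thesis
        using hw.ymon_box_span[OF _ v, of "n - s" ks] le Suc
        by (intro subsetD[OF span_minimal[OF _ subspace_spop_span]]) auto
    qed
  qed
  then show ?case
    unfolding filt_def by (intro span_minimal subspace_spop_span) blast
qed

theorem wact_spop_span: "wact u * w \<in> spop_span"
proof -
  have "\<exists>s. wact u * w \<in> filt s"
  proof (induction u)
    case Nil
    show ?case using filt_base'[of "[]" 1] by auto
  next
    case (Cons l u)
    then obtain s where "wact u * w \<in> filt s" by blast
    from g_filt[OF this] show ?case by (auto simp: mult.assoc)
  qed
  then show ?thesis using filt_spop_span by blast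
qed

end

section \<open>Counting super POPs\<close>

text \<open>Every element of \<open>X\<close> either belongs to \<open>S\<close> or receives one of
  \<open>a\<close> colours: the binomial theorem, summed over subsets.\<close>

lemma sum_power_Pow:
  "finite X \<Longrightarrow> (\<Sum>S\<in>Pow X. a ^ (card X - card S)) = (Suc a) ^ card X"
proof (induction X rule: finite_induct)
  case (insert x X)
  have "(\<Sum>S\<in>Pow (insert x X). a ^ (card (insert x X) - card S)) =
      (\<Sum>S\<in>Pow X. a ^ (card (insert x X) - card S)) + (\<Sum>S\<in>insert x ` Pow X. a ^ (card (insert x X) - card S))"
    unfolding Pow_insert using insert by (intro sum.union_disjoint) auto
  also have "(\<Sum>S\<in>insert x ` Pow X. a ^ (card (insert x X) - card S)) = (\<Sum>S\<in>Pow X. a ^ (card X - card S))"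
  proof (subst sum.reindex)
    show "inj_on (insert x) (Pow X)" using insert by (auto simp: inj_on_def)
    show "sum ((\<lambda>S. a ^ (card (insert x X) - card S)) \<circ> insert x) (Pow X) = (\<Sum>S\<in>Pow X. a ^ (card X - card S))"
    proof (rule sum.cong)
      fix S assume S: "S \<in> Pow X"
      then have "finite S" "x \<notin> S" using insert finite_subset by auto
      then show "((\<lambda>S. a ^ (card (insert x X) - card S)) \<circ> insert x) S = a ^ (card X - card S)"
        using insert by simp
    qed simp
  qed
  also have "(\<Sum>S\<in>Pow X. a ^ (card (insert x X) - card S)) = (\<Sum>S\<in>Pow X. a * a ^ (card X - card S))"
  proof (rule sum.cong)
    fix S assume "S \<in> Pow X"
    then have "card S \<le> card X" using insert card_mono by auto
    then show "a ^ (card (insert x X) - card S) = a * a ^ (card X - card S)"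
      using insert by (simp add: Suc_diff_le)
  qed simp
  finally show ?case using insert by (simp flip: sum_distrib_left)
qed simp

definition box_lists :: "nat \<Rightarrow> nat \<Rightarrow> nat list set" where
  "box_lists l b = {xs. sorted (rev xs) \<and> (\<forall>k\<in>set xs. 0 < k \<and> k \<le> b) \<and> length xs \<le> l}"

text \<open>Pascal's rule: a list either begins with the maximal value \<open>b\<close>, which can
  be removed, or fits into the box with bound \<open>b - 1\<close>.\<close>

lemma box_lists_card: "finite (box_lists l b) \<and> card (box_lists l b) \<le> (l + b) choose l"
proof (induction "l + b" arbitrary: l b)
  case 0
  then have "box_lists l b = {[]}" by (auto simp: box_lists_def)
  then show ?case using 0 by simp
next
  case (Suc t)
  show ?case
  proof (cases "l = 0 \<or> b = 0")
    case True
    have "xs = []" if "xs \<in> box_lists l b" for xs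
      using True that by (cases xs) (auto simp: box_lists_def)
    then have "box_lists l b = {[]}" by (auto simp: box_lists_def)
    then show ?thesis using True by (auto simp: Suc_leI)
  next
    case False
    then obtain l' b' where lb: "l = Suc l'" "b = Suc b'" by (metis not0_implies_Suc)
    have sub: "box_lists l b \<subseteq> box_lists l b' \<union> (#) b ` box_lists l' b"
    proof
      fix xs assume xs: "xs \<in> box_lists l b"
      show "xs \<in> box_lists l b' \<union> (#) b ` box_lists l' b"
      proof (cases xs)
        case Nil
        then show ?thesis by (simp add: box_lists_def)
      next
        case (Cons y ys)
        then have y: "\<forall>k\<in>set ys. k \<le> y" and ys: "sorted (rev ys)" using xs
          by (auto simp: box_lists_def sorted_append)
        show ?thesis
        proof (cases "y = b")
          case True
          then have "ys \<in> box_lists l' b" using xs Cons ys lb by (auto simp: box_lists_def)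
          then show ?thesis using True Cons by blast
        next
          case False
          then have "xs \<in> box_lists l b'" using xs Cons y lb by (fastforce simp: box_lists_def)
          then show ?thesis by blast
        qed
      qed
    qed
    have 1: "finite (box_lists l b') \<and> card (box_lists l b') \<le> (l + b') choose l"
      and 2: "finite (box_lists l' b) \<and> card (box_lists l' b) \<le> (l' + b) choose l'"
      using lb Suc.hyps(2) by (intro Suc.hyps(1); simp)+
    have "finite (box_lists l b)" using 1 2 by (intro finite_subset[OF sub]) auto
    moreover have "card (box_lists l b) \<le> card (box_lists l b') + card (box_lists l' b)"
      using 1 2 by (intro order_trans[OF card_mono[OF _ sub]] order_trans[OF card_Un_le]) (auto intro: card_image_le)
    moreover have "(l + b) choose l = ((l + b') choose l) + ((l' + b) choose l')"
      by (simp add: lb)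
    ultimately show ?thesis using 1 2 by simp
  qed
qed

definition POPs :: "nat \<Rightarrow> (nat \<times> nat list) set" where
  "POPs N = {(m, xs). isPOP N 0 m xs}"

text \<open>For fixed middle entry m the partitions lie in an (N - m) by m box, and the binomial
  coefficients sum to 2^N.\<close>

lemma POPs_card: "finite (POPs N) \<and> card (POPs N) \<le> 2 ^ N"
proof -
  have eq: "POPs N = Sigma {..N} (\<lambda>m. box_lists (N - m) m)"
    by (auto simp: POPs_def isPOP_def box_lists_def)
  have "card (POPs N) = (\<Sum>m\<le>N. card (box_lists (N - m) m))"
    unfolding eq using box_lists_card by (intro card_SigmaI) auto
  also have "\<dots> \<le> (\<Sum>m\<le>N. N choose m)"
  proof (rule sum_mono)
    fix m assume "m \<in> {..N}"
    then show "card (box_lists (N - m) m) \<le> N choose m"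
      using box_lists_card[of "N - m" m] binomial_symmetric[of m N] by simp
  qed
  also have "\<dots> = 2 ^ N" by (rule choose_row_sum)
  finally show ?thesis unfolding eq using box_lists_card by auto
qed

lemma inS_eq_smat:
  assumes "inS n A"
  obtains S S' where "S' \<subseteq> {..<n}" "S \<subseteq> {..<n - card S'}" "A = smat S S'"
proof -
  define S where "S = {a. A 1 (Suc a) = 1}"
  define S' where "S' = {a. A 2 (Suc a) = 1}"
  have A01: "A i j = 0 \<or> A i j = 1" for i j
  proof -
    have "A i j \<le> 1" using assms by (simp add: inS_def)
    then show ?thesis by linarith
  qed
  have A0: "A i j = 0" if "i \<notin> {1, 2} \<or> j \<notin> {1..n}" for i j
    using assms that by (simp add: inS_def)
  have A: "A = smat S S'"
  proof (intro ext)
    fix i j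
    show "A i j = smat S S' i j"
    proof (cases "i \<in> {1, 2} \<and> j \<in> {1..n}")
      case True
      then show ?thesis using A01[of i j] by (auto simp: smat_def S_def S'_def)
    next
      case False
      then have "A i j = 0" using A0 by blast
      then show ?thesis by (auto simp: smat_def S_def S'_def)
    qed
  qed
  have lt: "a < n" if "A i (Suc a) = 1" for i a
    using A0[of i "Suc a"] that by (cases "a < n") auto
  have S: "S \<subseteq> {..<n}" and S': "S' \<subseteq> {..<n}"
    using lt by (auto simp: S_def S'_def)
  have "(\<Sum>j\<in>{1..n}. A 2 j) = card S'"
    using sum_smat(2)[OF S S'] A by simp
  then have vanish: "A 1 k = 0" if "n - card S' < k" for k
    using assms that by (simp add: inS_def)
  have "S \<subseteq> {..<n - card S'}"
  proof
    fix a assume "a \<in> S"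
    then show "a \<in> {..<n - card S'}" using vanish[of "Suc a"] by (cases "a < n - card S'") (auto simp: S_def)
  qed
  then show thesis using that S' A by blast
qed

text \<open>There are at most 2^N POPs with top row N, 0. Summation over \<open>S\<close> inside n -
  |S'| columns raises the base to 3, and summation over \<open>S'\<close> raises it to 4. An upper
  bound suffices against the dimension 4^n of the tensor product.\<close>

lemma superPOPs_card: "finite (superPOPs n) \<and> card (superPOPs n) \<le> 4 ^ n"
proof -
  define I where "I = Sigma (Pow {..<n}) (\<lambda>S'. Sigma (Pow {..<n - card S'}) (\<lambda>S. POPs (n - card S' - card S)))"
  define f where "f = (\<lambda>(S' :: nat set, S, p :: nat \<times> nat list). (smat S S', p))"
  have "superPOPs n \<subseteq> f ` I"
  proof
    fix P assume "P \<in> superPOPs n"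
    then obtain A m xs where P: "P = (A, m, xs)" "inS n A" "isPOP (n - sA n A) 0 m xs"
      by (auto simp: superPOPs_def)
    obtain S S' where S: "S' \<subseteq> {..<n}" "S \<subseteq> {..<n - card S'}" "A = smat S S'"
      by (rule inS_eq_smat[OF P(2)])
    have "S \<subseteq> {..<n}" using S by force
    then have "sA n A = card S + card S'" using S sA_smat by simp
    then have "n - card S' - card S = n - sA n A" by simp
    then have "(S', S, m, xs) \<in> I" using P S by (simp add: I_def POPs_def)
    then show "P \<in> f ` I" using P S by (force simp: f_def)
  qed
  then have "finite I \<Longrightarrow> finite (superPOPs n) \<and> card (superPOPs n) \<le> card I"
    by (meson card_image_le card_mono finite_imageI finite_subset order_trans)
  moreover have finI: "finite I"
    unfolding I_def using POPs_card by auto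
  moreover have "card I \<le> 4 ^ n"
  proof -
    have "card I = (\<Sum>S'\<in>Pow {..<n}. \<Sum>S\<in>Pow {..<n - card S'}. card (POPs (n - card S' - card S)))"
      unfolding I_def using POPs_card by (simp add: card_SigmaI)
    also have "\<dots> \<le> (\<Sum>S'\<in>Pow {..<n}. \<Sum>S\<in>Pow {..<n - card S'}. 2 ^ (n - card S' - card S))"
      using POPs_card by (intro sum_mono) auto
    also have "\<dots> = (\<Sum>S'\<in>Pow {..<n}. 3 ^ (n - card S'))"
      using sum_power_Pow[of "{..<n - card _}" 2] by (intro sum.cong) auto
    also have "\<dots> = 4 ^ n"
      using sum_power_Pow[of "{..<n}" 3] by simp
    finally show ?thesis .
  qed
  ultimately show ?thesis by simp
qed

section \<open>Tensor products of four-dimensional evaluation modules\<close>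

datatype state = SW | S1 | S2 | S3

fun spar :: "state \<Rightarrow> nat" where
  "spar SW = 0" | "spar S1 = 1" | "spar S2 = 1" | "spar S3 = 0"

text \<open>The matrices of the generators in the basis w, x1 w, y3 w, y2 w of the highest weight module with
  h1 w = \<alpha> w and h2 w = w; the entry at (y, x) is the coefficient of y in the image of x.\<close>
fun stm :: "complex \<Rightarrow> gen \<Rightarrow> state \<Rightarrow> state \<Rightarrow> complex" where
  "stm \<alpha> X1 y x = (if y = S1 \<and> x = SW then 1 else if y = S3 \<and> x = S2 then 1 - \<alpha> else 0)"
| "stm \<alpha> X2 y x = (if y = SW \<and> x = S3 then 1 else 0)"
| "stm \<alpha> X3 y x = (if y = SW \<and> x = S2 then \<alpha> - 1 else if y = S1 \<and> x = S3 then 1 else 0)"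
| "stm \<alpha> Y1 y x = (if y = SW \<and> x = S1 then \<alpha> else if y = S2 \<and> x = S3 then -1 else 0)"
| "stm \<alpha> Y2 y x = (if y = S3 \<and> x = SW then 1 else 0)"
| "stm \<alpha> Y3 y x = (if y = S2 \<and> x = SW then 1 else if y = S3 \<and> x = S1 then \<alpha> else 0)"
| "stm \<alpha> H1 y x = (if y = x then if x = SW \<or> x = S1 then \<alpha> else \<alpha> - 1 else 0)"
| "stm \<alpha> H2 y x = (if y = x then if x = SW then 1 else if x = S3 then -1 else 0 else 0)"

definition ssum :: "(state \<Rightarrow> 'a::ab_group_add) \<Rightarrow> 'a" where
  "ssum f = f SW + f S1 + f S2 + f S3"

lemma mmul_expand: "mmul A B i j = A i 1 * B 1 j + A i 2 * B 2 j + A i 3 * B 3 j"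
proof -
  have "{1..3::nat} = {1, 2, 3}" by auto
  then show ?thesis by (simp add: mmul_def)
qed

lemmas bracket_eval = gens_def sbracket_def mmul_expand E_def

lemma stm_bracket:
  "ssum (\<lambda>x. stm \<alpha> a y x * stm \<alpha> b x x') - (-1) ^ (par a * par b) * ssum (\<lambda>x. stm \<alpha> b y x * stm \<alpha> a x x')
    = (\<Sum>c\<in>gens. coord (sbracket a b) c * stm \<alpha> c y x')"
  by (cases a; cases b; simp add: bracket_eval ssum_def; cases y; cases x'; simp add: algebra_simps)

lemma stm_parity: "stm \<alpha> a y x \<noteq> 0 \<Longrightarrow> even (par a + spar x + spar y)"
  by (cases a) (auto split: if_splits)

section \<open>The action on tensor products\<close>

type_synonym fock = "state list \<Rightarrow> complex"

text \<open>The operator sum_i c_i a_i, where a_i acts in factor i with the Koszul sign for passing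
  the factors before it. Taking c_i = z_i^r gives a \<otimes> t^r at the points z_i; general c_i
  allow a single factor to be addressed. A vector is its coefficient function on lists of basis
  states.\<close>

fun rho :: "complex list \<Rightarrow> (nat \<Rightarrow> complex) \<Rightarrow> gen \<Rightarrow> fock \<Rightarrow> fock" where
  "rho [] c a f xs = 0"
| "rho (\<alpha> # as) c a f [] = 0"
| "rho (\<alpha> # as) c a f (y # ys) =
     c 0 * ssum (\<lambda>x. stm \<alpha> a y x * f (x # ys))
     + (-1) ^ (par a * spar y) * rho as (\<lambda>i. c (Suc i)) a (\<lambda>zs. f (y # zs)) ys"

lemma rho_linear:
  "rho as c a (\<lambda>ys. k * f ys + h ys) xs = k * rho as c a f xs + rho as c a h xs"
proof (induction as arbitrary: c f h xs)
  case (Cons \<alpha> as)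
  then show ?case by (cases xs) (simp_all add: ssum_def algebra_simps)
qed simp

lemma rho_zero [simp]: "rho as c a (\<lambda>_. 0) xs = 0"
  using rho_linear[of as c a 1 "\<lambda>_. 0" "\<lambda>_. 0" xs] by simp

lemma rho_scale: "rho as c a (\<lambda>ys. k * f ys) xs = k * rho as c a f xs"
  using rho_linear[of as c a k f "\<lambda>_. 0" xs] by simp

lemma rho_add: "rho as c a (\<lambda>ys. f ys + h ys) xs = rho as c a f xs + rho as c a h xs"
  using rho_linear[of as c a 1 f h xs] by simp

lemma rho_sum: "rho as c a (\<lambda>ys. \<Sum>i\<in>I. f i ys) xs = (\<Sum>i\<in>I. rho as c a (f i) xs)"
  by (induction I rule: infinite_finite_induct) (simp_all add: rho_add)

lemma rho_coeff_linear:
  "rho as (\<lambda>i. k * c i + d i) a f xs = k * rho as c a f xs + rho as d a f xs"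
proof (induction as arbitrary: c d f xs)
  case (Cons \<alpha> as)
  then show ?case by (cases xs) (simp_all add: algebra_simps)
qed simp

lemma rho_coeff_zero [simp]: "rho as (\<lambda>_. 0) a f xs = 0"
  using rho_coeff_linear[of as 1 "\<lambda>_. 0" "\<lambda>_. 0" a f xs] by simp

lemma rho_coeff_sum:
  "rho as (\<lambda>i. \<Sum>r\<in>R. k r * c r i) a f xs = (\<Sum>r\<in>R. k r * rho as (c r) a f xs)"
  by (induction R rule: infinite_finite_induct) (simp_all add: rho_coeff_linear)

lemma rho_coeff_cong: "(\<And>i. i < length as \<Longrightarrow> c i = d i) \<Longrightarrow> rho as c a f xs = rho as d a f xs"
proof (induction as arbitrary: c d f xs)
  case (Cons \<alpha> as)
  then have "rho as (\<lambda>i. c (Suc i)) a f ys = rho as (\<lambda>i. d (Suc i)) a f ys" for f ys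
    by (intro Cons.IH) simp
  then show ?case using Cons.prems[of 0] by (cases xs) simp_all
qed simp

lemma rho_ssum:
  "rho as c a (\<lambda>zs. d * ssum (\<lambda>x. k x * f x zs)) xs = d * ssum (\<lambda>x. k x * rho as c a (f x) xs)"
  by (simp add: ssum_def rho_scale rho_add)

text \<open>A nonzero matrix entry of \<open>a\<close> forces |a| = |x| + |y| modulo 2, so passing
  \<open>b\<close> before or after \<open>a\<close> acts changes the sign by (-1)^{|a||b|}.\<close>

lemma par_sign_swap:
  "stm \<alpha> a y x * (-1) ^ (par b * spar x) = (-1) ^ (par a * par b) * (-1) ^ (par b * spar y) * stm \<alpha> a y x"
proof (cases "stm \<alpha> a y x = 0")
  case False
  then have "even (par a + spar x + spar y)" by (rule stm_parity)
  then have "even (par b * (par a + spar x + spar y))" by simp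
  then have "even (par b * spar x) \<longleftrightarrow> even (par a * par b + par b * spar y)"
    by (auto simp: algebra_simps)
  then show ?thesis by (simp add: minus_one_power_iff flip: power_add)
qed simp

lemma coord_parity: "coord (sbracket a b) e \<noteq> 0 \<Longrightarrow> even (par a + par b + par e)"
  by (cases a; cases b; simp add: bracket_eval; cases e; simp)

text \<open>Operators in different factors supercommute thanks to the Koszul signs, so only equal
  indices survive and the coefficients multiply pointwise. For powers of the points this is t^r t^s
  = t^{r+s}.\<close>

theorem rho_bracket:
  "rho as c a (rho as d b f) xs - (-1) ^ (par a * par b) * rho as d b (rho as c a f) xs
    = (\<Sum>e\<in>gens. coord (sbracket a b) e * rho as (\<lambda>i. c i * d i) e f xs)"
proof (induction as arbitrary: c d f xs)
  case (Cons \<alpha> as)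
  show ?case
  proof (cases xs)
    case (Cons y ys)
    define \<sigma> :: complex where "\<sigma> = (-1) ^ (par a * par b)"
    define c' d' where "c' = (\<lambda>i. c (Suc i))" and "d' = (\<lambda>i. d (Suc i))"
    define F where "F x = (\<lambda>zs. f (x # zs))" for x
    define sa sb :: "state \<Rightarrow> complex" where "sa x = (-1) ^ (par a * spar x)" and "sb x = (-1) ^ (par b * spar x)" for x
    define Ra Rb where "Ra x = rho as c' a (F x) ys" and "Rb x = rho as d' b (F x) ys" for x
    \<comment> \<open>Four contributions: both operators in the first factor, one in the first and
      one in the rest (two ways), both in the rest. The mixed ones have to cancel against those of
      the opposite order.\<close>
    have ab: "rho (\<alpha> # as) c a (rho (\<alpha> # as) d b f) (y # ys) =
        c 0 * d 0 * ssum (\<lambda>x'. ssum (\<lambda>x. stm \<alpha> a y x * stm \<alpha> b x x') * f (x' # ys))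
        + c 0 * ssum (\<lambda>x. stm \<alpha> a y x * sb x * Rb x)
        + sa y * d 0 * ssum (\<lambda>x. stm \<alpha> b y x * Ra x)
        + sa y * sb y * rho as c' a (rho as d' b (F y)) ys"
      by (simp add: rho_add rho_ssum rho_scale c'_def d'_def F_def sa_def sb_def Ra_def Rb_def)
        (simp add: ssum_def algebra_simps)
    have ba: "rho (\<alpha> # as) d b (rho (\<alpha> # as) c a f) (y # ys) =
        c 0 * d 0 * ssum (\<lambda>x'. ssum (\<lambda>x. stm \<alpha> b y x * stm \<alpha> a x x') * f (x' # ys))
        + d 0 * ssum (\<lambda>x. stm \<alpha> b y x * sa x * Ra x)
        + sb y * c 0 * ssum (\<lambda>x. stm \<alpha> a y x * Rb x)
        + sb y * sa y * rho as d' b (rho as c' a (F y)) ys"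
      by (simp add: rho_add rho_ssum rho_scale c'_def d'_def F_def sa_def sb_def Ra_def Rb_def)
        (simp add: ssum_def algebra_simps)
    have "stm \<alpha> a y x * sb x = \<sigma> * sb y * stm \<alpha> a y x" for x
      using par_sign_swap[of \<alpha> a y x b] by (simp add: \<sigma>_def sb_def)
    then have cross1: "ssum (\<lambda>x. stm \<alpha> a y x * sb x * Rb x) = \<sigma> * sb y * ssum (\<lambda>x. stm \<alpha> a y x * Rb x)"
      unfolding ssum_def by (simp only: distrib_left mult.assoc[symmetric])
    have "stm \<alpha> b y x * sa x = \<sigma> * sa y * stm \<alpha> b y x" for x
      using par_sign_swap[of \<alpha> b y x a] by (simp add: \<sigma>_def sa_def mult.commute)
    then have "ssum (\<lambda>x. stm \<alpha> b y x * sa x * Ra x) = \<sigma> * sa y * ssum (\<lambda>x. stm \<alpha> b y x * Ra x)"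
      unfolding ssum_def by (simp only: distrib_left mult.assoc[symmetric])
    moreover have "\<sigma> * \<sigma> = 1" by (simp add: \<sigma>_def flip: power_add)
    ultimately have cross2: "\<sigma> * ssum (\<lambda>x. stm \<alpha> b y x * sa x * Ra x) = sa y * ssum (\<lambda>x. stm \<alpha> b y x * Ra x)"
      by (simp only: mult.assoc[symmetric]) simp
    have diag: "ssum (\<lambda>x'. ssum (\<lambda>x. stm \<alpha> a y x * stm \<alpha> b x x') * f (x' # ys))
        - \<sigma> * ssum (\<lambda>x'. ssum (\<lambda>x. stm \<alpha> b y x * stm \<alpha> a x x') * f (x' # ys))
        = (\<Sum>e\<in>gens. coord (sbracket a b) e * ssum (\<lambda>x'. stm \<alpha> e y x' * f (x' # ys)))" (is "?A - \<sigma> * ?B = ?C")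
    proof -
      have "?A - \<sigma> * ?B = ssum (\<lambda>x'. (ssum (\<lambda>x. stm \<alpha> a y x * stm \<alpha> b x x')
          - \<sigma> * ssum (\<lambda>x. stm \<alpha> b y x * stm \<alpha> a x x')) * f (x' # ys))"
        unfolding ssum_def[of "\<lambda>x'. ssum (f' x') * g' x'" for f' g'] ssum_def[of "\<lambda>x'. (p x') * g' x'" for p g']
        by (simp only: algebra_simps)
      also have "\<dots> = ?C"
        unfolding \<sigma>_def stm_bracket
        by (simp add: ssum_def sum_distrib_right sum_distrib_left distrib_left sum.distrib mult.assoc)
      finally show ?thesis .
    qed
    have tail: "sa y * sb y * rho as c' a (rho as d' b (F y)) ys - \<sigma> * (sb y * sa y * rho as d' b (rho as c' a (F y)) ys)
        = (\<Sum>e\<in>gens. coord (sbracket a b) e * ((-1) ^ (par e * spar y) * rho as (\<lambda>i. c' i * d' i) e (F y) ys))"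
    proof -
      have par: "coord (sbracket a b) e * (-1) ^ (par e * spar y) = sa y * sb y * coord (sbracket a b) e" for e
      proof (cases "coord (sbracket a b) e = 0")
        case False
        then have "even (spar y * (par a + par b + par e))" using coord_parity by simp
        then have "even (par e * spar y) \<longleftrightarrow> even (par a * spar y + par b * spar y)"
          by (auto simp: algebra_simps)
        then show ?thesis by (simp add: sa_def sb_def minus_one_power_iff flip: power_add)
      qed simp
      have "sa y * sb y * rho as c' a (rho as d' b (F y)) ys - \<sigma> * (sb y * sa y * rho as d' b (rho as c' a (F y)) ys)
         = sa y * sb y * (rho as c' a (rho as d' b (F y)) ys - \<sigma> * rho as d' b (rho as c' a (F y)) ys)"
        by (simp add: algebra_simps)
      also have "\<dots> = (\<Sum>e\<in>gens. sa y * sb y * (coord (sbracket a b) e * rho as (\<lambda>i. c' i * d' i) e (F y) ys))"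
        unfolding \<sigma>_def Cons.IH by (rule sum_distrib_left)
      also have "\<dots> = (\<Sum>e\<in>gens. coord (sbracket a b) e * ((-1) ^ (par e * spar y) * rho as (\<lambda>i. c' i * d' i) e (F y) ys))"
        by (simp only: mult.assoc[symmetric] par)
      finally show ?thesis .
    qed
    have "rho (\<alpha> # as) c a (rho (\<alpha> # as) d b f) (y # ys) - \<sigma> * rho (\<alpha> # as) d b (rho (\<alpha> # as) c a f) (y # ys)
      = c 0 * d 0 * (ssum (\<lambda>x'. ssum (\<lambda>x. stm \<alpha> a y x * stm \<alpha> b x x') * f (x' # ys))
        - \<sigma> * ssum (\<lambda>x'. ssum (\<lambda>x. stm \<alpha> b y x * stm \<alpha> a x x') * f (x' # ys)))
       + (sa y * sb y * rho as c' a (rho as d' b (F y)) ys - \<sigma> * (sb y * sa y * rho as d' b (rho as c' a (F y)) ys))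
       + d 0 * (sa y * ssum (\<lambda>x. stm \<alpha> b y x * Ra x) - \<sigma> * ssum (\<lambda>x. stm \<alpha> b y x * sa x * Ra x))"
      unfolding ab ba cross1 by (simp add: algebra_simps)
    also have "\<dots> = c 0 * d 0 * (\<Sum>e\<in>gens. coord (sbracket a b) e * ssum (\<lambda>x'. stm \<alpha> e y x' * f (x' # ys)))
       + (\<Sum>e\<in>gens. coord (sbracket a b) e * ((-1) ^ (par e * spar y) * rho as (\<lambda>i. c' i * d' i) e (F y) ys))"
      unfolding diag tail cross2 by simp
    also have "\<dots> = (\<Sum>e\<in>gens. coord (sbracket a b) e * rho (\<alpha> # as) (\<lambda>i. c i * d i) e f (y # ys))"
      by (simp add: sum_distrib_left distrib_left sum.distrib c'_def d'_def F_def algebra_simps)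
    finally show ?thesis by (simp add: Cons \<sigma>_def)
  qed simp
qed simp

section \<open>Relations satisfied by the vacuum vector\<close>

definition delta :: "state list \<Rightarrow> fock" where "delta xs = (\<lambda>ys. if ys = xs then 1 else 0)"

lemma delta_Cons: "delta (x # xs) (y # ys) = (if y = x then delta xs ys else 0)"
  by (simp add: delta_def)

definition vac :: "nat \<Rightarrow> fock" where "vac n = delta (replicate n SW)"

lemma rho_length: "(\<And>ys. length ys \<noteq> length as \<Longrightarrow> f ys = 0) \<Longrightarrow> length xs \<noteq> length as \<Longrightarrow> rho as c a f xs = 0"
proof (induction as arbitrary: c f xs)
  case (Cons \<alpha> as)
  show ?case
  proof (cases xs)
    case (Cons y ys)
    have "rho as (\<lambda>i. c (Suc i)) a (\<lambda>zs. f (y # zs)) ys = 0"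
      using Cons.prems Cons by (intro Cons.IH) auto
    moreover have "f (x # ys) = 0" for x using Cons.prems Cons by simp
    ultimately show ?thesis using Cons by (simp add: ssum_def)
  qed simp
qed simp

lemma rho_vac_step:
  "rho (\<alpha> # as) c a (vac (Suc n)) (y # ys) =
     c 0 * (stm \<alpha> a y SW * vac n ys) + (if y = SW then rho as (\<lambda>i. c (Suc i)) a (vac n) ys else 0)"
  by (auto simp: vac_def delta_Cons ssum_def)

lemma rho_nplus_vac: "a \<in> nplus \<Longrightarrow> rho as c a (vac (length as)) xs = 0"
proof (induction as arbitrary: c xs)
  case (Cons \<alpha> as)
  then show ?case by (cases xs) (auto simp: rho_vac_step nplus_def simp del: rho.simps(3))
qed simp

lemma rho_hgens_vac:
  assumes "a \<in> hgens"
  shows "rho as c a (vac (length as)) xs = (\<Sum>i<length as. c i * (if a = H1 then as ! i else 1)) * vac (length as) xs"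
proof (induction as arbitrary: c xs)
  case (Cons \<alpha> as)
  show ?case
  proof (cases xs)
    case Nil
    then show ?thesis by (simp add: vac_def delta_def)
  next
    case (Cons y ys)
    then show ?thesis using assms
      by (auto simp: rho_vac_step Cons.IH sum.lessThan_Suc_shift hgens_def simp del: rho.simps(3) sum.lessThan_Suc)
        (auto simp: vac_def delta_Cons algebra_simps)
  qed
qed simp

text \<open>The states in front of position \<open>k\<close> are even, so no sign appears, and each
  of the three generators maps w to a basis vector with coefficient 1.\<close>

lemma rho_flip:
  assumes "(a, t) \<in> {(X1, S1), (Y3, S2), (Y2, S3)}" "length as = Suc (k + length ys)"
  shows "rho as (\<lambda>i. if i = k then 1 else 0) a (delta (replicate k SW @ SW # ys)) xs =
    delta (replicate k SW @ t # ys) xs"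
  using assms(2)
proof (induction k arbitrary: as xs)
  case 0
  then obtain \<alpha> bs where "as = \<alpha> # bs" by (cases as) auto
  then show ?case using assms(1)
    by (cases xs) (auto simp: delta_Cons ssum_def, auto simp: delta_def)
next
  case (Suc k)
  then obtain \<alpha> bs where \<alpha>: "as = \<alpha> # bs" by (cases as) auto
  show ?case
  proof (cases xs)
    case Nil
    then show ?thesis using \<alpha> by (simp add: delta_def)
  next
    case (Cons y zs)
    have "rho bs (\<lambda>i. if i = k then 1 else 0) a (delta (replicate k SW @ SW # ys)) zs = delta (replicate k SW @ t # ys) zs"
      using Suc \<alpha> by (intro Suc.IH) simp
    then show ?thesis using \<alpha> Cons by (cases "y = SW") (simp_all add: delta_Cons)
  qed
qed

text \<open>The only nonzero matrix entry of y2 sends w to y2 w, so each application creates exactly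
  one more \<open>S3\<close>. Since at most \<open>length as\<close> of them fit, nilpotence
  follows.\<close>

lemma rho_Y2_count:
  "(\<And>ys. f ys \<noteq> 0 \<Longrightarrow> count_list ys S3 = k) \<Longrightarrow> rho as c Y2 f xs \<noteq> 0 \<Longrightarrow> count_list xs S3 = Suc k"
proof (induction as arbitrary: c f k xs)
  case (Cons \<alpha> as)
  obtain y ys where xs: "xs = y # ys" using Cons.prems(2) by (cases xs) auto
  have "y = S3 \<and> f (SW # ys) \<noteq> 0 \<or> rho as (\<lambda>i. c (Suc i)) Y2 (\<lambda>zs. f (y # zs)) ys \<noteq> 0"
    using Cons.prems(2) by (auto simp: xs ssum_def split: if_splits)
  then show ?case
  proof
    assume "y = S3 \<and> f (SW # ys) \<noteq> 0"
    then show ?thesis using Cons.prems(1)[of "SW # ys"] by (simp add: xs)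
  next
    assume nz: "rho as (\<lambda>i. c (Suc i)) Y2 (\<lambda>zs. f (y # zs)) ys \<noteq> 0"
    define j where "j = (if y = S3 then 1 else 0 :: nat)"
    obtain zs where "f (y # zs) \<noteq> 0"
    proof (rule ccontr)
      assume "\<not> thesis"
      then have "(\<lambda>zs. f (y # zs)) = (\<lambda>_. 0)" using that by blast
      then show False using nz by simp
    qed
    then have j: "j \<le> k" using Cons.prems(1)[of "y # zs"] by (auto simp: j_def)
    have "count_list ys S3 = Suc (k - j)"
    proof (rule Cons.IH[OF _ nz])
      show "count_list zs S3 = k - j" if "f (y # zs) \<noteq> 0" for zs
        using Cons.prems(1)[OF that] by (auto simp: j_def)
    qed
    then show ?thesis using j by (auto simp: xs j_def split: if_splits)
  qed
qed simp

lemma rho_Y2_power_vac: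
  "((rho as c Y2) ^^ k) (vac (length as)) xs \<noteq> 0 \<Longrightarrow> length xs = length as \<and> count_list xs S3 = k"
proof (induction k arbitrary: xs)
  case 0
  have "count_list (replicate m SW) S3 = 0" for m by (induction m) auto
  then show ?case using 0 by (auto simp: vac_def delta_def split: if_splits)
next
  case (Suc k)
  let ?f = "((rho as c Y2) ^^ k) (vac (length as))"
  have "rho as c Y2 ?f xs \<noteq> 0" using Suc.prems by simp
  then show ?case
    using rho_length[of as ?f xs c Y2] rho_Y2_count[of ?f k as c xs] Suc.IH by blast
qed

lemma rho_Y2_nilpotent: "((rho as c Y2) ^^ Suc (length as)) (vac (length as)) xs = 0"
proof (rule ccontr)
  assume "\<not> ?thesis"
  then have "length xs = length as \<and> count_list xs S3 = Suc (length as)" by (rule rho_Y2_power_vac)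
  then show False using count_le_length[of xs S3] by simp
qed

fun wv :: "complex list \<Rightarrow> (nat \<Rightarrow> complex) \<Rightarrow> word \<Rightarrow> fock" where
  "wv as z [] = vac (length as)"
| "wv as z (l # u) = rho as (\<lambda>i. z i ^ snd l) (fst l) (wv as z u)"

lemma wv_bracket:
  "wv as z (u @ (a, r) # (b, s) # v) xs - (-1) ^ (par a * par b) * wv as z (u @ (b, s) # (a, r) # v) xs
    = (\<Sum>c\<in>gens. coord (sbracket a b) c * wv as z (u @ (c, r + s) # v) xs)"
proof (induction u arbitrary: xs)
  case Nil
  then show ?case using rho_bracket[of as _ a _ b "wv as z v" xs] by (simp add: power_add)
next
  case (Cons l u)
  have eq: "wv as z (u @ (a, r) # (b, s) # v) = (\<lambda>xs. (-1) ^ (par a * par b) * wv as z (u @ (b, s) # (a, r) # v) xs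
      + (\<Sum>c\<in>gens. coord (sbracket a b) c * wv as z (u @ (c, r + s) # v) xs))"
    using Cons by (simp add: fun_eq_iff algebra_simps)
  have "wv as z ((l # u) @ (a, r) # (b, s) # v) xs = rho as (\<lambda>i. z i ^ snd l) (fst l) (wv as z (u @ (a, r) # (b, s) # v)) xs"
    by simp
  also have "\<dots> = (-1) ^ (par a * par b) * wv as z ((l # u) @ (b, s) # (a, r) # v) xs
      + (\<Sum>c\<in>gens. coord (sbracket a b) c * wv as z ((l # u) @ (c, r + s) # v) xs)"
    unfolding eq by (simp only: rho_linear rho_sum rho_scale append_Cons wv.simps)
  finally show ?case by simp
qed

lemma wv_append_scale:
  assumes "\<And>xs. wv as z v xs = k * wv as z v' xs"
  shows "wv as z (u @ v) xs = k * wv as z (u @ v') xs"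
proof (induction u arbitrary: xs)
  case (Cons l u)
  then have "wv as z (u @ v) = (\<lambda>xs. k * wv as z (u @ v') xs)" by (simp add: fun_eq_iff)
  then show ?case by (simp add: rho_scale)
qed (simp add: assms)

lemma wv_nplus: "a \<in> nplus \<Longrightarrow> wv as z (u @ [(a, r)]) xs = 0"
  using wv_append_scale[of as z "[(a, r)]" 0 "[]" u xs] by (simp add: rho_nplus_vac)

lemma wv_hgens:
  "a \<in> hgens \<Longrightarrow> wv as z (u @ [(a, r)]) xs =
    (\<Sum>i<length as. z i ^ r * (if a = H1 then as ! i else 1)) * wv as z u xs"
  by (rule wv_append_scale[where v' = "[]", simplified]) (simp add: rho_hgens_vac)

lemma wv_Y2: "wv as z (u @ replicate (Suc (length as)) (Y2, 0)) xs = 0"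
proof -
  have pow: "wv as z (replicate k (Y2, 0)) = ((rho as (\<lambda>i. 1) Y2) ^^ k) (vac (length as))" for k
    by (induction k) simp_all
  have "wv as z (replicate (Suc (length as)) (Y2, 0)) xs = 0" for xs
    unfolding pow by (rule rho_Y2_nilpotent)
  then show ?thesis
    using wv_append_scale[of as z "replicate (Suc (length as)) (Y2, 0)" 0 "[]" u xs] by simp
qed

section \<open>Cyclicity at distinct points\<close>

lemma interpolation:
  fixes z c :: "nat \<Rightarrow> complex"
  assumes "inj_on z {..<n}"
  shows "\<exists>p. \<forall>i<n. poly p (z i) = c i"
  using assms
proof (induction n)
  case (Suc n)
  then have "inj_on z {..<n}" by (rule_tac inj_on_subset) auto
  then obtain p where p: "\<forall>i<n. poly p (z i) = c i" using Suc.IH by blast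
  define q where "q = (\<Prod>i<n. [:- z i, 1:])"
  have q: "poly q x = (\<Prod>i<n. x - z i)" for x by (simp add: q_def poly_prod)
  have "poly q (z n) \<noteq> 0"
    using inj_on_eq_iff[OF Suc.prems, of n] by (auto simp: q)
  moreover have "poly q (z i) = 0" if "i < n" for i
    using that by (auto simp: q intro!: prod_zero)
  ultimately have "\<forall>i<Suc n. poly (p + smult ((c n - poly p (z n)) / poly q (z n)) q) (z i) = c i"
    using p by (auto simp: less_Suc_eq)
  then show ?case by blast
qed simp

interpretation fock: vector_space "\<lambda>(c::complex) (f::fock) xs. c * f xs"
  by unfold_locales (auto simp: fun_eq_iff algebra_simps)

lemma fock_sum_apply: "(\<Sum>i\<in>I. (F i :: fock)) xs = (\<Sum>i\<in>I. F i xs)"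
  by (induction I rule: infinite_finite_induct) auto

text \<open>At distinct points the vectors with entries z_i^r span all coefficient vectors, by
  interpolation. Hence every \<open>rho as c a\<close>, including an action in a single factor, is a
  combination of actions of the a \<otimes> t^r.\<close>

lemma rho_cyclic_span:
  assumes "inj_on z {..<length as}" "f \<in> fock.span (range (wv as z))"
  shows "rho as c a f \<in> fock.span (range (wv as z))"
proof -
  obtain p where p: "\<forall>i<length as. poly p (z i) = c i" using interpolation[OF assms(1)] by blast
  have rho_c: "rho as c a f = (\<Sum>r\<le>degree p. (\<lambda>xs. coeff p r * rho as (\<lambda>i. z i ^ r) a f xs))"
  proof
    fix xs
    have "rho as c a f xs = rho as (\<lambda>i. \<Sum>r\<le>degree p. coeff p r * z i ^ r) a f xs"
      using p by (intro rho_coeff_cong) (simp add: poly_altdef)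
    then show "rho as c a f xs = (\<Sum>r\<le>degree p. (\<lambda>xs. coeff p r * rho as (\<lambda>i. z i ^ r) a f xs)) xs"
      by (simp add: rho_coeff_sum fock_sum_apply)
  qed
  have "rho as (\<lambda>i. z i ^ r) a f \<in> fock.span (range (wv as z))" for r
    using assms(2)
  proof (induction rule: fock.span_induct_alt)
    case base
    have "rho as (\<lambda>i. z i ^ r) a 0 = (0 :: fock)"
      using rho_zero by (simp add: fun_eq_iff zero_fun_def)
    then show ?case by (simp only: fock.span_zero)
  next
    case (step k g h)
    then obtain u where "g = wv as z u" by blast
    then have "rho as (\<lambda>i. z i ^ r) a g = wv as z ((a, r) # u)" by simp
    then have g: "rho as (\<lambda>i. z i ^ r) a g \<in> fock.span (range (wv as z))"
      by (metis fock.span_base rangeI)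
    have eq: "rho as (\<lambda>i. z i ^ r) a ((\<lambda>xs. k * g xs) + h) =
        (\<lambda>xs. k * rho as (\<lambda>i. z i ^ r) a g xs) + rho as (\<lambda>i. z i ^ r) a h"
      using rho_linear by (simp add: fun_eq_iff plus_fun_def)
    show ?case unfolding eq by (intro fock.span_add fock.span_scale g step.IH)
  qed
  then show ?thesis
    unfolding rho_c by (intro fock.span_sum fock.span_scale)
qed

text \<open>States are created from the last factor to the first, so all factors in front of the one
  being changed are still \<open>SW\<close>, as \<open>rho_flip\<close> demands.\<close>

lemma delta_in_cyclic_span:
  assumes "inj_on z {..<length as}" "length xs = length as"
  shows "delta xs \<in> fock.span (range (wv as z))"
proof -
  have "delta (replicate k SW @ ys) \<in> fock.span (range (wv as z))" if "k + length ys = length as" for k ys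
    using that
  proof (induction ys arbitrary: k)
    case Nil
    then have "delta (replicate k SW @ []) = wv as z []" by (simp add: vac_def)
    then show ?case by (metis fock.span_base rangeI)
  next
    case (Cons y ys)
    have W: "delta (replicate k SW @ SW # ys) \<in> fock.span (range (wv as z))"
      using Cons.IH[of "Suc k"] Cons.prems by (simp add: replicate_app_Cons_same)
    show ?case
    proof (cases "y = SW")
      case False
      then obtain a where a: "(a, y) \<in> {(X1, S1), (Y3, S2), (Y2, S3)}" by (cases y) auto
      have "rho as (\<lambda>i. if i = k then 1 else 0) a (delta (replicate k SW @ SW # ys)) = delta (replicate k SW @ y # ys)"
        using rho_flip[OF a] Cons.prems by (simp add: fun_eq_iff)
      then show ?thesis using rho_cyclic_span[OF assms(1) W] by metis
    qed (use W in simp)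
  qed
  from this[of 0 xs] assms(2) show ?thesis by simp
qed

lemma UNIV_state: "UNIV = {SW, S1, S2, S3}"
  using state.exhaust by blast

text \<open>The \<open>delta\<close> vectors are 4^n independent vectors, n being the number of
  factors, inside the span of at most 4^n vectors. So the latter can be neither repeated nor
  dependent.\<close>

lemma cyclic_independent:
  assumes "inj_on z {..<length as}" "finite I" "card I \<le> 4 ^ length as"
    and span: "\<And>u. wv as z u \<in> fock.span (v ` I)"
    and zero: "\<And>xs. (\<Sum>P\<in>I. c P * v P xs) = 0"
    and P: "P \<in> I"
  shows "c P = 0"
proof -
  define X where "X = {xs :: state list. length xs = length as}"
  have "X = {xs. set xs \<subseteq> {SW, S1, S2, S3} \<and> length xs = length as}"
    unfolding X_def UNIV_state[symmetric] by simp
  then have cX: "card X = 4 ^ length as" and fX: "finite X"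
    using card_lists_length_eq[of "{SW, S1, S2, S3}" "length as"]
      finite_lists_length_eq[of "{SW, S1, S2, S3}" "length as"] by (simp_all add: numeral_eq_Suc)
  have inj: "inj delta" by (auto simp: inj_def delta_def fun_eq_iff)
  have indep: "fock.independent (delta ` X)"
    unfolding fock.independent_explicit_module
  proof (intro allI impI)
    fix T u f assume T: "finite T" "T \<subseteq> delta ` X" "(\<Sum>f\<in>T. (\<lambda>xs. u f * f xs)) = 0" "f \<in> T"
    then obtain xs where xs: "f = delta xs" by blast
    have at: "g xs = (if g = f then 1 else 0)" if "g \<in> T" for g
    proof -
      obtain ys where ys: "g = delta ys" using T(2) \<open>g \<in> T\<close> by blast
      have "delta ys xs = (if ys = xs then 1 else 0)" by (auto simp: delta_def)
      then show ?thesis by (simp add: ys xs inj_eq[OF inj])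
    qed
    then have "(\<Sum>g\<in>T. u g * g xs) = (\<Sum>g\<in>T. if g = f then u g else 0)"
    proof (intro sum.cong refl)
      fix g assume "g \<in> T"
      then show "u g * g xs = (if g = f then u g else 0)" using at[of g] by simp
    qed
    moreover have "(\<Sum>g\<in>T. u g * g xs) = 0" using T(3) by (simp add: fun_eq_iff fock_sum_apply)
    ultimately show "u f = 0" using T(1,4) by simp
  qed
  have sub: "delta ` X \<subseteq> fock.span (v ` I)"
  proof -
    have "fock.span (range (wv as z)) \<subseteq> fock.span (v ` I)"
      using span by (intro fock.span_minimal) auto
    then show ?thesis using delta_in_cyclic_span[OF assms(1)] by (auto simp: X_def)
  qed
  have "4 ^ length as \<le> card (v ` I)"
    using fock.independent_span_bound[OF _ indep sub] \<open>finite I\<close> inj cX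
    by (simp add: card_image inj_on_subset[OF inj])
  then have injv: "inj_on v I" and cv: "card (v ` I) = 4 ^ length as"
    using assms(2,3) card_image_le[OF assms(2), of v] by (auto intro: eq_card_imp_inj_on)
  have indv: "fock.independent (v ` I)"
  proof (rule ccontr)
    assume "\<not> ?thesis"
    then obtain a where a: "a \<in> v ` I" "a \<in> fock.span (v ` I - {a})"
      by (auto simp: fock.dependent_def)
    have "g \<in> fock.span (v ` I - {a})" if "g \<in> v ` I" for g
      using that a(2) by (cases "g = a") (simp_all add: fock.span_base)
    then have "fock.span (v ` I) \<subseteq> fock.span (v ` I - {a})"
      by (intro fock.span_minimal) auto
    then have "delta ` X \<subseteq> fock.span (v ` I - {a})" by (rule subset_trans[OF sub])
    then have "card (delta ` X) \<le> card (v ` I - {a})"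
      using fock.independent_span_bound[OF finite_Diff[OF finite_imageI[OF assms(2)]] indep] by simp
    also have "\<dots> < card (v ` I)" using a(1) assms(2) by (intro card_Diff1_less) auto
    finally show False using cv cX by (simp add: card_image inj_on_subset[OF inj])
  qed
  have "(\<Sum>f\<in>v ` I. (\<lambda>xs. c (the_inv_into I v f) * f xs)) = 0"
  proof
    fix xs
    show "(\<Sum>f\<in>v ` I. (\<lambda>xs. c (the_inv_into I v f) * f xs)) xs = 0 xs"
      using zero[of xs] by (simp add: fock_sum_apply sum.reindex[OF injv] the_inv_into_f_f[OF injv])
  qed
  then have "c (the_inv_into I v (v P)) = 0"
    by (rule fock.independentD[OF indv finite_imageI[OF assms(2)] order_refl,
          where u = "\<lambda>f. c (the_inv_into I v f)"]) (use P in simp)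
  then show ?thesis by (simp add: the_inv_into_f_f[OF injv P])
qed

section \<open>Functionals on the tensor algebra that factor through W(psi)\<close>

lemma tmul_wmono_left:
  "tmul (wmono u) f w = (if length u \<le> length w \<and> take (length u) w = u then f (drop (length u) w) else 0)"
proof -
  have "tmul (wmono u) f w = (\<Sum>i\<in>{0..length w}. if i = length u then (if take (length u) w = u then f (drop (length u) w) else 0) else 0)"
    unfolding tmul_def by (intro sum.cong) (auto simp: wmono_def)
  then show ?thesis by simp
qed

lemma wmono_append: "tmul (wmono u) (wmono v) = wmono (u @ v)"
proof
  fix w
  have "w = u @ v \<longleftrightarrow> length u \<le> length w \<and> take (length u) w = u \<and> drop (length u) w = v"
    by (metis append_eq_conv_conj append_take_drop_id le_add1 length_append)
  then show "tmul (wmono u) (wmono v) w = wmono (u @ v) w"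
    unfolding tmul_wmono_left by (auto simp: wmono_def)
qed

lemma tmul_diff_left: "tmul (\<lambda>w. f w - g w) h = (\<lambda>w. tmul f h w - tmul g h w)"
  and tmul_diff_right: "tmul h (\<lambda>w. f w - g w) = (\<lambda>w. tmul h f w - tmul h g w)"
  and tmul_add_right: "tmul h (\<lambda>w. f w + g w) = (\<lambda>w. tmul h f w + tmul h g w)"
  and tmul_scale_left: "tmul (\<lambda>w. c * f w) h = (\<lambda>w. c * tmul f h w)"
  and tmul_scale_right: "tmul h (\<lambda>w. c * f w) = (\<lambda>w. c * tmul h f w)"
  by (simp_all add: tmul_def fun_eq_iff algebra_simps sum_subtractf sum.distrib sum_distrib_left)

lemma tmul_sum_left: "tmul (\<lambda>w. \<Sum>i\<in>I. f i w) h = (\<lambda>w. \<Sum>i\<in>I. tmul (f i) h w)"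
  and tmul_sum_right: "tmul h (\<lambda>w. \<Sum>i\<in>I. f i w) = (\<lambda>w. \<Sum>i\<in>I. tmul h (f i) w)"
  by (simp_all add: tmul_def fun_eq_iff sum_distrib_left sum_distrib_right sum.swap[of _ I])

lemma tmul_wmono_assoc: "tmul (wmono u) (tmul (wmono v) f) = tmul (wmono (u @ v)) f"
proof
  fix w
  have "length u \<le> length w \<and> take (length u) w = u \<and> length v \<le> length (drop (length u) w)
      \<and> take (length v) (drop (length u) w) = v
    \<longleftrightarrow> length (u @ v) \<le> length w \<and> take (length (u @ v)) w = u @ v"
    by (auto simp: take_add)
  then show "tmul (wmono u) (tmul (wmono v) f) w = tmul (wmono (u @ v)) f w"
    by (auto simp: tmul_wmono_left add.commute)
qed

lemma comm_element:
  "tmul (tmul (wmono u) (comm_rel a r b s)) (wmono v) =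
    (\<lambda>w. wmono (u @ (a, r) # (b, s) # v) w - (-1) ^ (par a * par b) * wmono (u @ (b, s) # (a, r) # v) w
      - (\<Sum>c\<in>gens. coord (sbracket a b) c * wmono (u @ (c, r + s) # v) w))"
  unfolding comm_rel_def
  by (simp only: tmul_diff_left tmul_diff_right tmul_scale_left tmul_scale_right tmul_sum_left tmul_sum_right
      wmono_append append_assoc append_Cons append_Nil)

lemma weight_element:
  "tmul (wmono u) (\<lambda>w. wmono [(a, r)] w - k * wmono [] w) = (\<lambda>w. wmono (u @ [(a, r)]) w - k * wmono u w)"
  by (simp only: tmul_diff_right tmul_scale_right wmono_append append_Nil2)

lemma Wker_left_ideal: "f \<in> Wker psi n \<Longrightarrow> tmul (wmono u) f \<in> Wker psi n"
proof (induction rule: Wker.induct)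
  case zero
  have "tmul (wmono u) (\<lambda>w. 0) = (\<lambda>w. 0)" by (simp add: tmul_def)
  then show ?case by (simp add: Wker.zero)
next
  case (add f g)
  then show ?case by (simp add: tmul_add_right Wker.add)
next
  case (smult f c)
  then show ?case by (simp add: tmul_scale_right Wker.smult)
next
  case (comm a b u' r s v)
  have "tmul (wmono u) (tmul (tmul (wmono u') (comm_rel a r b s)) (wmono v))
      = tmul (tmul (wmono (u @ u')) (comm_rel a r b s)) (wmono v)"
    unfolding comm_element
    by (simp only: tmul_diff_right tmul_scale_right tmul_sum_right wmono_append append_assoc)
  then show ?case using comm Wker.comm by simp
next
  case (left \<rho> u')
  then show ?case by (simp add: tmul_wmono_assoc Wker.left)
qed

definition fin_supp :: "tens set" where "fin_supp = {f. finite {u. f u \<noteq> 0}}"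

definition lin :: "(word \<Rightarrow> complex) \<Rightarrow> tens \<Rightarrow> complex" where
  "lin l f = (\<Sum>u | f u \<noteq> 0. f u * l u)"

lemma lin_superset: "finite S \<Longrightarrow> {u. f u \<noteq> 0} \<subseteq> S \<Longrightarrow> lin l f = (\<Sum>u\<in>S. f u * l u)"
  unfolding lin_def by (intro sum.mono_neutral_left) auto

lemma fin_supp_wmono [simp]: "wmono u \<in> fin_supp"
  by (simp add: fin_supp_def wmono_def)

lemma lin_wmono [simp]: "lin l (wmono u) = l u"
  by (subst lin_superset[of "{u}"]) (auto simp: wmono_def)

lemma fin_supp_zero [simp]: "(\<lambda>w. 0) \<in> fin_supp" and lin_zero [simp]: "lin l (\<lambda>w. 0) = 0"
  by (simp_all add: fin_supp_def lin_def)

lemma fin_supp_linear: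
  assumes "f \<in> fin_supp" "g \<in> fin_supp"
  shows "(\<lambda>w. k * f w + g w) \<in> fin_supp" "lin l (\<lambda>w. k * f w + g w) = k * lin l f + lin l g"
proof -
  let ?S = "{u. f u \<noteq> 0} \<union> {u. g u \<noteq> 0}"
  have S: "finite ?S" using assms by (simp add: fin_supp_def)
  show "(\<lambda>w. k * f w + g w) \<in> fin_supp"
    unfolding fin_supp_def by (simp, rule finite_subset[OF _ S]) auto
  have "lin l (\<lambda>w. k * f w + g w) = (\<Sum>u\<in>?S. (k * f u + g u) * l u)"
    by (rule lin_superset[OF S]) auto
  also have "\<dots> = k * (\<Sum>u\<in>?S. f u * l u) + (\<Sum>u\<in>?S. g u * l u)"
    by (simp add: sum_distrib_left sum.distrib algebra_simps)
  also have "\<dots> = k * lin l f + lin l g"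
    using lin_superset[OF S, of f l] lin_superset[OF S, of g l] by simp
  finally show "lin l (\<lambda>w. k * f w + g w) = k * lin l f + lin l g" .
qed

lemma fin_supp_scale:
  assumes "f \<in> fin_supp"
  shows "(\<lambda>w. k * f w) \<in> fin_supp" "lin l (\<lambda>w. k * f w) = k * lin l f"
  using fin_supp_linear(1)[OF assms fin_supp_zero, where k = k]
    fin_supp_linear(2)[OF assms fin_supp_zero, where k = k and l = l] by simp_all

lemma fin_supp_add:
  assumes "f \<in> fin_supp" "g \<in> fin_supp"
  shows "(\<lambda>w. f w + g w) \<in> fin_supp" "lin l (\<lambda>w. f w + g w) = lin l f + lin l g"
  using fin_supp_linear(1)[OF assms, where k = 1] fin_supp_linear(2)[OF assms, where k = 1 and l = l] by simp_all

lemma fin_supp_diff: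
  assumes "f \<in> fin_supp" "g \<in> fin_supp"
  shows "(\<lambda>w. f w - g w) \<in> fin_supp" "lin l (\<lambda>w. f w - g w) = lin l f - lin l g"
  using fin_supp_linear(1)[OF assms(2,1), where k = "-1"] fin_supp_linear(2)[OF assms(2,1), where k = "-1" and l = l]
  by (simp_all add: algebra_simps)

lemma fin_supp_sum:
  assumes "\<And>i. i \<in> I \<Longrightarrow> f i \<in> fin_supp"
  shows "(\<lambda>w. \<Sum>i\<in>I. f i w) \<in> fin_supp \<and> lin l (\<lambda>w. \<Sum>i\<in>I. f i w) = (\<Sum>i\<in>I. lin l (f i))"
  using assms by (induction I rule: infinite_finite_induct) (simp_all add: fin_supp_add)

text \<open>The universal property of W(psi) in terms of words: \<open>l\<close> prescribes a
  functional on words, and the relations are tested with every prefix, those for brackets also with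
  every suffix. With \<open>l\<close> zero it shows that \<open>Wker\<close> consists of finitely
  supported functions.\<close>

lemma Wker_lin:
  assumes comm: "\<And>u a r b s v. l (u @ (a, r) # (b, s) # v) - (-1) ^ (par a * par b) * l (u @ (b, s) # (a, r) # v)
      = (\<Sum>c\<in>gens. coord (sbracket a b) c * l (u @ (c, r + s) # v))"
    and nplus: "\<And>u a r. a \<in> nplus \<Longrightarrow> l (u @ [(a, r)]) = 0"
    and weight: "\<And>u a r. a \<in> hgens \<Longrightarrow> l (u @ [(a, r)]) = psi a r * l u"
    and nilp: "\<And>u. l (u @ replicate (Suc n) (Y2, 0)) = 0"
    and f: "f \<in> Wker psi n"
  shows "f \<in> fin_supp \<and> lin l f = 0"
  using f
proof (induction rule: Wker.induct)
  case (comm a b u r s v)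
  let ?A = "\<lambda>w. wmono (u @ (a, r) # (b, s) # v) w - (-1) ^ (par a * par b) * wmono (u @ (b, s) # (a, r) # v) w"
  let ?B = "\<lambda>w. \<Sum>c\<in>gens. coord (sbracket a b) c * wmono (u @ (c, r + s) # v) w"
  have A: "?A \<in> fin_supp" "lin l ?A = l (u @ (a, r) # (b, s) # v) - (-1) ^ (par a * par b) * l (u @ (b, s) # (a, r) # v)"
    by (simp_all add: fin_supp_diff fin_supp_scale)
  have "?B \<in> fin_supp \<and> lin l ?B = (\<Sum>c\<in>gens. lin l (\<lambda>w. coord (sbracket a b) c * wmono (u @ (c, r + s) # v) w))"
    by (rule fin_supp_sum) (simp add: fin_supp_scale)
  then have B: "?B \<in> fin_supp" "lin l ?B = (\<Sum>c\<in>gens. coord (sbracket a b) c * l (u @ (c, r + s) # v))"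
    by (simp_all add: fin_supp_scale)
  show ?case
    unfolding comm_element using fin_supp_diff[OF A(1) B(1)] A(2) B(2) assms(1)[of u a r b s v] by simp
next
  case (left \<rho> u)
  then consider a r where "\<rho> = wmono [(a, r)]" "a \<in> nplus"
    | a r where "\<rho> = (\<lambda>w. wmono [(a, r)] w - psi a r * wmono [] w)" "a \<in> hgens"
    | "\<rho> = wmono (replicate (Suc n) (Y2, 0))"
    by (auto simp: Wrels_def)
  then show ?case
  proof cases
    case 1
    then show ?thesis by (simp add: wmono_append nplus)
  next
    case 2
    then show ?thesis by (simp add: weight_element fin_supp_diff fin_supp_scale weight)
  next
    case 3
    then show ?thesis by (simp add: wmono_append nilp del: replicate.simps)
  qed
qed (simp_all add: fin_supp_add fin_supp_scale)

section \<open>The family of Weyl modules over the polynomial ring\<close>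

interpretation tens: vector_space "\<lambda>(c::complex) (f::tens) w. c * f w"
  by unfold_locales (auto simp: fun_eq_iff algebra_simps)

interpretation tens_pair: vector_space_pair "\<lambda>(c::complex) (f::tens) w. c * f w" "\<lambda>(c::complex) (f::tens) w. c * f w" ..

lemma subspace_fin_supp: "tens.subspace fin_supp"
  by (auto simp: tens.subspace_def fin_supp_scale plus_fun_def fin_supp_add zero_fun_def)

lemma subspace_Wker: "tens.subspace (Wker psi n)"
  by (auto simp: tens.subspace_def plus_fun_def zero_fun_def intro: Wker.intros)

lemma Wker_fin_supp: "Wker psi n \<subseteq> fin_supp"
proof
  fix f assume "f \<in> Wker psi n"
  then show "f \<in> fin_supp"
    using Wker_lin[where l = "\<lambda>_. 0" and psi = psi and n = n] by simp
qed

text \<open>Composing with such a projection turns the quotient by K into an operator on the whole space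
  of coefficient functions, so that relations modulo K become equations.\<close>
definition quotient_proj :: "tens set \<Rightarrow> (tens \<Rightarrow> tens) \<Rightarrow> bool" where
  "quotient_proj K p \<longleftrightarrow> (\<forall>c f g. p (\<lambda>w. c * f w + g w) = (\<lambda>w. c * p f w + p g w))
     \<and> (\<forall>f. p f \<in> fin_supp) \<and> (\<forall>f\<in>K. p f = (\<lambda>w. 0)) \<and> (\<forall>f\<in>fin_supp. (\<lambda>w. f w - p f w) \<in> K)"

text \<open>A basis \<open>B\<close> of \<open>K\<close> is extended to a basis \<open>C\<close> of
  the finitely supported functions; the map kills \<open>B\<close> and fixes the rest of
  \<open>C\<close>. \<open>construct\<close> extends it linearly to all coefficient functions
  without leaving the span of the image of \<open>C\<close>.\<close>

lemma quotient_proj_exists: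
  assumes K: "tens.subspace K" "K \<subseteq> fin_supp"
  shows "\<exists>p. quotient_proj K p"
proof -
  obtain B where B: "B \<subseteq> K" "tens.independent B" "K \<subseteq> tens.span B"
    by (rule tens.maximal_independent_subset)
  have "B \<subseteq> fin_supp" using B(1) K(2) by (rule subset_trans)
  then obtain C where C: "B \<subseteq> C" "C \<subseteq> fin_supp" "tens.independent C" "fin_supp \<subseteq> tens.span C"
    using B(2) by (rule tens.maximal_independent_subset_extend)
  define h where "h b = (if b \<in> C - B then b else 0)" for b :: tens
  define p where "p = tens_pair.construct C h"
  have lin: "module_hom (\<lambda>c f w. c * f w) (\<lambda>c f w. c * f w) p"
    unfolding p_def module_hom_iff_linear by (rule tens_pair.linear_construct[OF C(3)])
  have pb: "p b = h b" if "b \<in> C" for b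
    unfolding p_def using C(3) that by (rule tens_pair.construct_basis)
  have p0: "p f = 0" if "f \<in> K" for f
  proof (rule module_hom.eq_0_on_span[OF lin])
    show "f \<in> tens.span B" using B(3) that by blast
    show "p b = 0" if "b \<in> B" for b using pb[of b] C(1) that by (auto simp: h_def)
  qed
  have "tens.span (h ` C) \<subseteq> fin_supp"
    using C by (intro tens.span_minimal subspace_fin_supp) (auto simp: h_def zero_fun_def)
  then have pfin: "p f \<in> fin_supp" for f
    unfolding p_def using tens_pair.construct_in_span[OF C(3), of h f] by blast
  have diff: "f - p f \<in> K" if "f \<in> fin_supp" for f
  proof -
    have "f \<in> tens.span C" using that C(4) by blast
    then show ?thesis
    proof (induction rule: tens.span_induct_alt)
      case base
      show ?case by (simp only: module_hom.zero[OF lin] diff_zero tens.subspace_0[OF K(1)])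
    next
      case (step c b f)
      have "b - p b \<in> K"
        using pb[of b] step(1) B(1) tens.subspace_0[OF K(1)] by (auto simp: h_def)
      then have "(\<lambda>w. c * (b - p b) w) + (f - p f) \<in> K"
        using step tens.subspace_add[OF K(1)] tens.subspace_scale[OF K(1)] by blast
      moreover have "(\<lambda>w. c * (b - p b) w) + (f - p f) = ((\<lambda>w. c * b w) + f) - p ((\<lambda>w. c * b w) + f)"
        by (simp add: module_hom.add[OF lin] module_hom.scale[OF lin] fun_eq_iff algebra_simps)
      ultimately show ?case by (simp only:)
    qed
  qed
  have "p (\<lambda>w. c * f w + g w) = (\<lambda>w. c * p f w + p g w)" for c f g
    using module_hom.add[OF lin, of "\<lambda>w. c * f w" g] module_hom.scale[OF lin, of c f] by (simp add: plus_fun_def)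
  then have "quotient_proj K p"
    unfolding quotient_proj_def using p0 pfin diff by (simp add: zero_fun_def fun_diff_def)
  then show ?thesis by blast
qed

section \<open>The ring of operators on families over the parameter line\<close>

type_synonym family = "complex \<Rightarrow> tens"

text \<open>Linearity over arbitrary functions \<open>c\<close> of the parameter forces the
  operators to act fibre by fibre. Nothing ties different fibres together, so a projection can be
  chosen for each parameter separately, while polynomials act through their values.\<close>

typedef family_op = "{F :: family \<Rightarrow> family. \<forall>c x y. F (\<lambda>e w. c e * x e w + y e w) = (\<lambda>e w. c e * F x e w + F y e w)}"
  morphisms app Family_op
  by (rule exI[of _ "\<lambda>x. x"]) simp

lemma app_linear: "app F (\<lambda>e w. c e * x e w + y e w) e w = c e * app F x e w + app F y e w"
  using app[of F] by (simp add: fun_eq_iff)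

lemma app_eqI: "(\<And>x e w. app F x e w = app G x e w) \<Longrightarrow> F = G"
  by (simp add: app_inject[symmetric] fun_eq_iff)

lemma app_Family_op:
  assumes "\<And>c x y e w. F (\<lambda>e w. c e * x e w + y e w) e w = c e * F x e w + F y e w"
  shows "app (Family_op F) = F"
  by (rule Family_op_inverse) (simp add: fun_eq_iff assms)

lemma app_zero_arg: "app F (\<lambda>e w. 0) e w = 0"
  using app_linear[of F "\<lambda>_. 1" "\<lambda>e w. 0" "\<lambda>e w. 0" e w] by simp

lemma app_scale_arg: "app F (\<lambda>e w. c e * x e w) e w = c e * app F x e w"
  using app_linear[of F c x "\<lambda>e w. 0" e w] by (simp add: app_zero_arg)

lemma app_add_arg: "app F (\<lambda>e w. x e w + y e w) e w = app F x e w + app F y e w"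
  using app_linear[of F "\<lambda>_. 1" x y e w] by simp

instantiation family_op :: ring_1
begin

definition "0 = Family_op (\<lambda>x e w. 0)"
definition "1 = Family_op (\<lambda>x. x)"
definition "F + G = Family_op (\<lambda>x e w. app F x e w + app G x e w)"
definition "- F = Family_op (\<lambda>x e w. - app F x e w)"
definition "F - G = Family_op (\<lambda>x e w. app F x e w - app G x e w)"
definition "F * G = Family_op (\<lambda>x. app F (app G x))"

lemma app_zero [simp]: "app 0 x e w = 0"
  and app_one [simp]: "app 1 x = x"
  and app_plus [simp]: "app (F + G) x e w = app F x e w + app G x e w"
  and app_uminus [simp]: "app (- F) x e w = - app F x e w"
  and app_minus [simp]: "app (F - G) x e w = app F x e w - app G x e w"
  unfolding zero_family_op_def one_family_op_def plus_family_op_def uminus_family_op_def minus_family_op_def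
  by (subst app_Family_op; simp add: app_linear; simp add: algebra_simps)+

lemma app_times [simp]: "app (F * G) x = app F (app G x)"
proof -
  have G: "app G (\<lambda>e w. c e * x e w + y e w) = (\<lambda>e w. c e * app G x e w + app G y e w)" for c x y
    by (simp add: fun_eq_iff app_linear)
  show ?thesis
    unfolding times_family_op_def by (subst Family_op_inverse) (simp_all add: fun_eq_iff G app_linear)
qed

instance
proof
  fix F G H :: family_op
  show "(0 :: family_op) \<noteq> 1"
  proof
    assume "(0 :: family_op) = 1"
    then have "app 0 (\<lambda>e w. 1) 0 [] = app 1 (\<lambda>e w. 1) 0 []" by simp
    then show False by simp
  qed
  show "F * (G + H) = F * G + F * H"
  proof (rule app_eqI)
    fix x e w
    have "app (G + H) x = (\<lambda>e w. app G x e w + app H x e w)" by (simp add: fun_eq_iff)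
    then show "app (F * (G + H)) x e w = app (F * G + F * H) x e w" by (simp add: app_add_arg)
  qed
qed (rule app_eqI; simp)+

end

definition scale_op :: "complex poly \<Rightarrow> family_op \<Rightarrow> family_op" where
  "scale_op q F = Family_op (\<lambda>x e w. poly q e * app F x e w)"

lemma app_scale_op [simp]: "app (scale_op q F) x e w = poly q e * app F x e w"
  unfolding scale_op_def by (subst app_Family_op) (simp_all add: app_linear, simp add: algebra_simps)

interpretation ops: rational_algebra scale_op
proof unfold_locales
  fix q r :: "complex poly" and F G :: family_op and k :: nat
  show "scale_op q (F + G) = scale_op q F + scale_op q G"
    by (rule app_eqI) (simp add: algebra_simps)
  show "scale_op (q + r) F = scale_op q F + scale_op r F"
    by (rule app_eqI) (simp add: algebra_simps)
  show "scale_op q (scale_op r F) = scale_op (q * r) F"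
    by (rule app_eqI) simp
  show "scale_op 1 F = F"
    by (rule app_eqI) simp
  show "scale_op q F * G = scale_op q (F * G)"
    by (rule app_eqI) simp
  show "F * scale_op q G = scale_op q (F * G)"
  proof (rule app_eqI)
    fix x e w
    have "app (scale_op q G) x = (\<lambda>e w. poly q e * app G x e w)" by (simp add: fun_eq_iff)
    then show "app (F * scale_op q G) x e w = app (scale_op q (F * G)) x e w"
      by (simp add: app_scale_arg)
  qed
  show "\<exists>i. i * of_nat k = (1 :: complex poly)" if "k > 0"
    using that by (intro exI[of _ "[:1 / of_nat k:]"]) (simp add: of_nat_poly one_pCons)
qed

lemma Wker_sum:
  "(\<And>i. i \<in> I \<Longrightarrow> f i \<in> Wker psi n) \<Longrightarrow> (\<lambda>w. \<Sum>i\<in>I. f i w) \<in> Wker psi n"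
  by (induction I rule: infinite_finite_induct) (auto intro: Wker.intros)

lemma fin_supp_letter: "f \<in> fin_supp \<Longrightarrow> tmul (wmono [l]) f \<in> fin_supp"
proof -
  assume f: "f \<in> fin_supp"
  have "{u. tmul (wmono [l]) f u \<noteq> 0} \<subseteq> (#) l ` {u. f u \<noteq> 0}"
  proof
    fix u assume "u \<in> {u. tmul (wmono [l]) f u \<noteq> 0}"
    then have "length [l] \<le> length u" "take (length [l]) u = [l]" "f (drop (length [l]) u) \<noteq> 0"
      by (auto simp: tmul_wmono_left split: if_splits)
    then show "u \<in> (#) l ` {u. f u \<noteq> 0}" by (cases u) auto
  qed
  then show ?thesis using f finite_subset unfolding fin_supp_def by blast
qed

lemma fin_supp_expand: "f \<in> fin_supp \<Longrightarrow> f = (\<lambda>w. \<Sum>v | f v \<noteq> 0. f v * wmono v w)"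
proof
  fix w assume "f \<in> fin_supp"
  then have fin: "finite {v. f v \<noteq> 0}" by (simp add: fin_supp_def)
  have "(\<Sum>v | f v \<noteq> 0. f v * wmono v w) = (\<Sum>v | f v \<noteq> 0. if v = w then f v else 0)"
    by (intro sum.cong) (auto simp: wmono_def)
  then show "f w = (\<Sum>v | f v \<noteq> 0. f v * wmono v w)" using fin by simp
qed

lemma in_gens: "a \<in> gens"
  by (cases a) (simp_all add: gens_def)

section \<open>Realisation of a polynomial family of Weyl modules\<close>

locale quotient_family =
  fixes psi :: "gen \<Rightarrow> nat \<Rightarrow> complex poly" and n :: nat and p :: "complex \<Rightarrow> tens \<Rightarrow> tens"
  assumes proj: "quotient_proj (Wker (\<lambda>a r. poly (psi a r) e) n) (p e)"
    and psi_H2_0: "psi H2 0 = of_nat n"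
begin

abbreviation K :: "complex \<Rightarrow> tens set" where "K e \<equiv> Wker (\<lambda>a r. poly (psi a r) e) n"

lemma p_linear: "p e (\<lambda>w. c * f w + g w) w = c * p e f w + p e g w"
  and p_fin: "p e f \<in> fin_supp"
  and p_K: "f \<in> K e \<Longrightarrow> p e f = (\<lambda>w. 0)"
  and p_diff: "f \<in> fin_supp \<Longrightarrow> (\<lambda>w. f w - p e f w) \<in> K e"
  using proj[of e] by (simp_all add: quotient_proj_def)

lemma p_zero: "p e (\<lambda>w. 0) w = 0"
  by (simp add: p_K Wker.zero)

lemma p_scale: "p e (\<lambda>w. c * f w) w = c * p e f w"
  using p_linear[of e c f "\<lambda>w. 0" w] by (simp add: p_zero)

lemma p_add: "p e (\<lambda>w. f w + g w) w = p e f w + p e g w"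
  using p_linear[of e 1 f g w] by simp

lemma p_sub: "p e (\<lambda>w. f w - g w) w = p e f w - p e g w"
  using p_linear[of e "-1" g f w] by (simp add: algebra_simps)

lemma p_sum: "p e (\<lambda>w. \<Sum>i\<in>I. f i w) w = (\<Sum>i\<in>I. p e (f i) w)"
  by (induction I rule: infinite_finite_induct) (simp_all add: p_zero p_add)

lemma p_cong: "(\<lambda>w. f w - g w) \<in> K e \<Longrightarrow> p e f = p e g"
  using p_K[of "\<lambda>w. f w - g w" e] p_sub[of e f g] by (simp add: fun_eq_iff)

lemma p_letter: "f \<in> fin_supp \<Longrightarrow> p e (tmul (wmono [l]) (p e f)) = p e (tmul (wmono [l]) f)"
  by (rule p_cong[symmetric], subst tmul_diff_right[symmetric]) (intro Wker_left_ideal p_diff)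

lemma p_idem: "f \<in> fin_supp \<Longrightarrow> p e (p e f) = p e f"
  by (rule p_cong[OF p_diff, symmetric])

text \<open>The inner projection makes the argument finitely supported, as the relations require;
  the outer one turns congruences modulo \<open>K e\<close> into equalities.\<close>

definition G :: "gen \<Rightarrow> nat \<Rightarrow> family_op" where
  "G a r = Family_op (\<lambda>x e. p e (tmul (wmono [(a, r)]) (p e (x e))))"

lemma app_G: "app (G a r) x e = p e (tmul (wmono [(a, r)]) (p e (x e)))"
proof -
  have pl: "p e (\<lambda>w. c * f w + g w) = (\<lambda>w. c * p e f w + p e g w)" for e c f g
    by (simp add: fun_eq_iff p_linear)
  show ?thesis
    unfolding G_def by (subst app_Family_op) (simp_all add: pl tmul_add_right tmul_scale_right)
qed

text \<open>An operator of rank one onto the span of the generator, so that elements of the cyclic module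
  appear as multiples of this operator in the ring.\<close>
definition vac_op :: family_op where
  "vac_op = Family_op (\<lambda>x e w. x e [] * p e (wmono []) w)"

lemma app_vac_op: "app vac_op x e w = x e [] * p e (wmono []) w"
  unfolding vac_op_def by (subst app_Family_op) (simp_all add: algebra_simps)

lemma G_bracket:
  "app (G a r) (app (G b s) x) e w = (-1) ^ (par a * par b) * app (G b s) (app (G a r) x) e w
    + (\<Sum>c\<in>gens. coord (sbracket a b) c * app (G c (r + s)) x e w)"
proof -
  define h where "h = p e (x e)"
  have h: "h \<in> fin_supp" by (simp add: h_def p_fin)
  define f1 f2 where "f1 = tmul (wmono [(a, r), (b, s)]) h" and "f2 = tmul (wmono [(b, s), (a, r)]) h"
  define f3 where "f3 = (\<lambda>w. \<Sum>c\<in>gens. coord (sbracket a b) c * tmul (wmono [(c, r + s)]) h w)"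
  have GG: "app (G a r) (app (G b s) x) e = p e (tmul (wmono [(a, r), (b, s)]) h)" for a r b s
    by (simp add: app_G h_def[symmetric] p_idem p_letter h fin_supp_letter tmul_wmono_assoc)
  define S where "S = {v. h v \<noteq> 0}"
  define \<sigma> :: complex where "\<sigma> = (-1) ^ (par a * par b)"
  have hS: "h = (\<lambda>w. \<Sum>v\<in>S. h v * wmono v w)" unfolding S_def by (rule fin_supp_expand[OF h])
  have expand: "tmul (wmono u) h w = (\<Sum>v\<in>S. h v * wmono (u @ v) w)" for u w
    by (subst hS) (simp add: tmul_sum_right tmul_scale_right wmono_append)
  \<comment> \<open>A commutation relation in \<open>Wker\<close> ends in a word, so
    \<open>h\<close> is expanded into words and the relation is summed over them.\<close>
  have "(\<lambda>w. \<Sum>v\<in>S. h v * tmul (tmul (wmono []) (comm_rel a r b s)) (wmono v) w) \<in> K e"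
    by (intro Wker_sum Wker.smult Wker.comm in_gens)
  also have "(\<lambda>w. \<Sum>v\<in>S. h v * tmul (tmul (wmono []) (comm_rel a r b s)) (wmono v) w) = (\<lambda>w. f1 w - (\<sigma> * f2 w + f3 w))"
    unfolding comm_element f1_def f2_def f3_def expand \<sigma>_def[symmetric]
    by (simp add: fun_eq_iff sum_distrib_left sum_subtractf sum.distrib algebra_simps sum.swap[of _ gens S])
  finally have "p e f1 = p e (\<lambda>w. \<sigma> * f2 w + f3 w)" by (rule p_cong)
  then have "p e f1 w = \<sigma> * p e f2 w + (\<Sum>c\<in>gens. coord (sbracket a b) c * p e (tmul (wmono [(c, r + s)]) h) w)"
    by (simp add: p_linear f3_def p_sum p_scale)
  then show ?thesis unfolding GG by (simp add: f1_def f2_def \<sigma>_def app_G h_def)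
qed

lemma word_vac_op: "app (prod_list (map (\<lambda>(a, r). G a r) u) * vac_op) x e w = x e [] * p e (wmono u) w"
proof (induction u arbitrary: w)
  case Nil
  then show ?case by (simp add: app_vac_op)
next
  case (Cons l u)
  obtain a r where l: "l = (a, r)" by (cases l)
  have IH: "app (prod_list (map (\<lambda>(a, r). G a r) u) * vac_op) x e = (\<lambda>w. x e [] * p e (wmono u) w)"
    using Cons by (simp add: fun_eq_iff)
  have "app (prod_list (map (\<lambda>(a, r). G a r) (l # u)) * vac_op) x e =
      p e (tmul (wmono [(a, r)]) (p e (\<lambda>w. x e [] * p e (wmono u) w)))"
    using IH by (simp add: l mult.assoc app_G)
  also have "p e (\<lambda>w. x e [] * p e (wmono u) w) = (\<lambda>w. x e [] * p e (p e (wmono u)) w)"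
    by (simp add: fun_eq_iff p_scale)
  also have "p e (p e (wmono u)) = p e (wmono u)"
    by (simp add: p_idem)
  finally show ?case
    by (simp add: tmul_scale_right p_scale p_letter wmono_append l)
qed

lemma K_weight: "a \<in> hgens \<Longrightarrow> (\<lambda>w. wmono [(a, r)] w - poly (psi a r) e * wmono [] w) \<in> K e"
proof -
  assume a: "a \<in> hgens"
  have "tmul (wmono []) (\<lambda>w. wmono [(a, r)] w - poly (psi a r) e * wmono [] w) \<in> K e"
    by (rule Wker.left) (use a in \<open>auto simp: Wrels_def\<close>)
  then show ?thesis by (simp add: weight_element)
qed

lemma K_word: "u \<in> {[(a, r)] | a r. a \<in> nplus} \<union> {replicate (Suc n) (Y2, 0)} \<Longrightarrow> wmono u \<in> K e"
proof -
  assume "u \<in> {[(a, r)] | a r. a \<in> nplus} \<union> {replicate (Suc n) (Y2, 0)}"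
  then have "tmul (wmono []) (wmono u) \<in> K e"
    by (intro Wker.left) (auto simp: Wrels_def)
  then show ?thesis by (simp add: wmono_append)
qed

text \<open>Every bracket relation is an instance of \<open>G_bracket\<close>, with structure
  constants computed from the 3 by 3 matrices.\<close>

sublocale weyl_spanning scale_op G vac_op psi n
proof (unfold_locales,
    (rule app_eqI, simp only: app_times app_plus app_minus app_uminus mult_2, subst G_bracket, simp add: bracket_eval)+)
  fix a i
  show "G a i * vac_op = 0" if "a \<in> nplus"
    using word_vac_op[of "[(a, i)]"] p_K[OF K_word[of "[(a, i)]"]] that
    by (intro app_eqI) auto
  show "G a i * vac_op = scale_op (psi a i) vac_op" if "a \<in> hgens"
    using word_vac_op[of "[(a, i)]"] p_cong[OF K_weight[OF that]]
    by (intro app_eqI) (simp add: p_scale app_vac_op)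
  have "prod_list (map (\<lambda>(a, r). G a r) (replicate k (Y2, 0))) = G Y2 0 ^ k" for k
    by (induction k) simp_all
  then show "G Y2 0 ^ Suc n * vac_op = 0"
    using word_vac_op[of "replicate (Suc n) (Y2, 0)"] p_K[OF K_word[of "replicate (Suc n) (Y2, 0)"]]
    by (intro app_eqI) (simp del: power_Suc replicate.simps app_times)
  show "psi H2 0 = of_nat n" by (rule psi_H2_0)
qed

text \<open>The spanning theorem is used over the ring of polynomials, so one family
  \<open>d\<close> of polynomials serves all parameters at once.\<close>

lemma word_combination:
  "\<exists>d. \<forall>e. (\<lambda>w. wmono u w - (\<Sum>P\<in>superPOPs n. poly (d P) e * wmono (spop_word n P) w)) \<in> K e"
proof -
  let ?I = "superPOPs n"
  have fin: "finite ?I" using superPOPs_card by blast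
  have "\<exists>d. v = (\<Sum>P\<in>?I. scale_op (d P) (wact (spop_word n P) * vac_op))" if "v \<in> spop_span" for v
    using that unfolding spop_span_def
  proof (induction rule: ops.span_induct_alt)
    case base
    show ?case by (rule exI[of _ "\<lambda>_. 0"]) simp
  next
    case (step c b v)
    then obtain P d where P: "b = wact (spop_word n P) * vac_op" "P \<in> ?I"
      and d: "v = (\<Sum>P\<in>?I. scale_op (d P) (wact (spop_word n P) * vac_op))" by blast
    have "(\<Sum>Q\<in>?I. scale_op (if Q = P then c else 0) (wact (spop_word n Q) * vac_op))
        = (\<Sum>Q\<in>?I. if Q = P then scale_op c b else 0)"
      by (intro sum.cong) (auto simp: P)
    also have "\<dots> = scale_op c b" using fin P by simp
    finally have "scale_op c b + v = (\<Sum>Q\<in>?I. scale_op ((if Q = P then c else 0) + d Q) (wact (spop_word n Q) * vac_op))"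
      by (simp add: d ops.scale_left_distrib sum.distrib)
    then show ?case by (rule exI[of _ "\<lambda>Q. (if Q = P then c else 0) + d Q"])
  qed
  then obtain d where d: "wact u * vac_op = (\<Sum>P\<in>?I. scale_op (d P) (wact (spop_word n P) * vac_op))"
    using wact_spop_span by blast
  have app_sum: "app (\<Sum>i\<in>I. F i) x e w = (\<Sum>i\<in>I. app (F i) x e w)" for I :: "((nat \<Rightarrow> nat \<Rightarrow> nat) \<times> nat \<times> nat list) set" and F x e w
    by (induction I rule: infinite_finite_induct) simp_all
  have "(\<lambda>w. wmono u w - (\<Sum>P\<in>?I. poly (d P) e * wmono (spop_word n P) w)) \<in> K e" (is "?f \<in> _") for e
  proof -
    \<comment> \<open>The operator identity is evaluated at the constant family 1, on which the
      factor \<open>x e []\<close> of \<open>vac_op\<close> is 1.\<close>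
    have "p e (wmono u) w = (\<Sum>P\<in>?I. poly (d P) e * p e (wmono (spop_word n P)) w)" for w
      using arg_cong[OF d, of "\<lambda>F. app F (\<lambda>e w. 1) e w"]
      by (simp add: app_sum wact_def word_vac_op del: app_times)
    then have "p e ?f = (\<lambda>w. 0)" by (simp add: fun_eq_iff p_sub p_sum p_scale)
    moreover have "?f \<in> fin_supp"
      by (intro fin_supp_diff fin_supp_wmono fin_supp_sum[THEN conjunct1] fin_supp_scale)
    ultimately show ?thesis using p_diff[of ?f e] by simp
  qed
  then show ?thesis by blast
qed

end

lemma family_spanning:
  assumes "psi H2 0 = of_nat n"
  shows "\<exists>d. \<forall>e. (\<lambda>w. wmono u w - (\<Sum>P\<in>superPOPs n. poly (d P) e * wmono (spop_word n P) w))
    \<in> Wker (\<lambda>a r. poly (psi a r) e) n"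
proof -
  have "\<forall>e. \<exists>p. quotient_proj (Wker (\<lambda>a r. poly (psi a r) e) n) p"
    using quotient_proj_exists[OF subspace_Wker Wker_fin_supp] by blast
  then obtain p where "\<And>e. quotient_proj (Wker (\<lambda>a r. poly (psi a r) e) n) (p e)" by metis
  then interpret quotient_family psi n p
    using assms by unfold_locales
  show ?thesis by (rule word_combination)
qed

section \<open>The basis theorem\<close>

text \<open>A weight with value k > 0 on h2 is split into k copies of its point, each with h2-value
  1 and an equal share of the h1-value. For k = 0 membership in P^+ makes the weight vanish, so
  taking no copy is correct.\<close>

lemma weight_points:
  fixes z :: "nat \<Rightarrow> complex" and mu :: "nat \<Rightarrow> gen \<Rightarrow> complex"
  assumes "\<forall>i\<in>{1..s}. inPplus (mu i)"
  shows "\<exists>ps :: (complex \<times> complex) list. \<forall>r.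
    (\<Sum>i=1..s. z i ^ r * mu i H1) = (\<Sum>(\<zeta>, \<alpha>)\<leftarrow>ps. \<zeta> ^ r * \<alpha>) \<and>
    (\<Sum>i=1..s. z i ^ r * mu i H2) = (\<Sum>(\<zeta>, \<alpha>)\<leftarrow>ps. \<zeta> ^ r)"
  using assms
proof (induction s)
  case 0
  show ?case by (rule exI[of _ "[]"]) simp
next
  case (Suc s)
  then obtain ps where ps: "\<And>r. (\<Sum>i=1..s. z i ^ r * mu i H1) = (\<Sum>(\<zeta>, \<alpha>)\<leftarrow>ps. \<zeta> ^ r * \<alpha>)"
    "\<And>r. (\<Sum>i=1..s. z i ^ r * mu i H2) = (\<Sum>(\<zeta>, \<alpha>)\<leftarrow>ps. \<zeta> ^ r)" by auto
  obtain k :: nat where k: "mu (Suc s) H2 = of_nat k" "k = 0 \<Longrightarrow> mu (Suc s) H1 = 0"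
    using Suc.prems unfolding inPplus_def by (metis atLeastAtMost_iff le_add1 of_nat_0 order_refl plus_1_eq_Suc less_irrefl)
  \<comment> \<open>For k = 0 this is division by zero with value 0, and no copy is taken.\<close>
  define a where "a = mu (Suc s) H1 / of_nat k"
  have a: "of_nat k * a = mu (Suc s) H1" using k by (cases "k = 0") (auto simp: a_def)
  show ?case
  proof (intro exI[of _ "replicate k (z (Suc s), a) @ ps"] allI conjI)
    fix r
    have "of_nat k * (z (Suc s) ^ r * a) = z (Suc s) ^ r * mu (Suc s) H1"
      by (simp add: a mult.left_commute)
    then show "(\<Sum>i=1..Suc s. z i ^ r * mu i H1) = (\<Sum>(\<zeta>, \<alpha>)\<leftarrow>replicate k (z (Suc s), a) @ ps. \<zeta> ^ r * \<alpha>)"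
      using ps(1)[of r] by (auto simp: sum_list_replicate)
    show "(\<Sum>i=1..Suc s. z i ^ r * mu i H2) = (\<Sum>(\<zeta>, \<alpha>)\<leftarrow>replicate k (z (Suc s), a) @ ps. \<zeta> ^ r)"
      using ps(2)[of r] by (simp add: sum_list_replicate k(1))
  qed
qed

text \<open>The relations read \<open>psi\<close> on Cartan generators only, so a deformed weight
  may be given by one formula on all generators.\<close>

lemma Wker_mono:
  assumes "\<And>a r. a \<in> hgens \<Longrightarrow> psi a r = psi' a r"
  shows "Wker psi n \<subseteq> Wker psi' n"
proof
  fix f assume "f \<in> Wker psi n"
  then show "f \<in> Wker psi' n"
  proof induction
    case (left \<rho> u)
    then have "\<rho> \<in> Wrels psi' n" using assms by (fastforce simp: Wrels_def)
    then show ?case by (rule Wker.left)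
  qed (auto intro: Wker.intros)
qed

lemma Wker_cong:
  "(\<And>a r. a \<in> hgens \<Longrightarrow> psi a r = psi' a r) \<Longrightarrow> Wker psi n = Wker psi' n"
  by (intro subset_antisym Wker_mono) simp_all

text \<open>Two points with distinct slopes meet for a single value of \<open>e\<close>, so only
  finitely many values are excluded.\<close>

lemma infinite_injective_parameters:
  fixes \<zeta> :: "nat \<Rightarrow> complex"
  shows "infinite {e. inj_on (\<lambda>i. \<zeta> i + e * of_nat i) {..<n}}"
proof -
  have "- {e. inj_on (\<lambda>i. \<zeta> i + e * of_nat i) {..<n}} \<subseteq>
      (\<lambda>(i, j). (\<zeta> i - \<zeta> j) / (of_nat j - of_nat i)) ` ({..<n} \<times> {..<n})"
  proof
    fix e assume "e \<in> - {e. inj_on (\<lambda>i. \<zeta> i + e * of_nat i) {..<n}}"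
    then obtain i j where ij: "i < n" "j < n" "i \<noteq> j" "\<zeta> i + e * of_nat i = \<zeta> j + e * of_nat j"
      by (auto simp: inj_on_def)
    then have "(of_nat j - of_nat i :: complex) \<noteq> 0" by simp
    moreover have "e * (of_nat j - of_nat i) = \<zeta> i - \<zeta> j" using ij(4) by (simp add: algebra_simps)
    ultimately have "e = (\<zeta> i - \<zeta> j) / (of_nat j - of_nat i)" by (simp add: field_simps)
    then show "e \<in> (\<lambda>(i, j). (\<zeta> i - \<zeta> j) / (of_nat j - of_nat i)) ` ({..<n} \<times> {..<n})"
      using ij by force
  qed
  then have "finite (- {e. inj_on (\<lambda>i. \<zeta> i + e * of_nat i) {..<n}})"
    by (rule finite_subset) simp
  moreover have "infinite (UNIV :: complex set)" by (rule infinite_UNIV_char_0)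
  ultimately show ?thesis by (metis Compl_partition finite_Un)
qed

theorem mainTheorem2:
  fixes psi :: "gen \<Rightarrow> nat \<Rightarrow> complex" and s :: nat
    and mu :: "nat \<Rightarrow> gen \<Rightarrow> complex" and z :: "nat \<Rightarrow> complex" and n :: nat
  assumes "\<forall>i\<in>{1..s}. inPplus (mu i)"
    and "inj_on z {1..s}"
    and "\<forall>h\<in>hgens. \<forall>p. psi h p = (\<Sum>i=1..s. z i ^ p * mu i h)"
    and "psi H2 0 = of_nat n"
  shows "(\<forall>F c. finite F \<and> F \<subseteq> superPOPs n
            \<and> (\<lambda>w. \<Sum>P\<in>F. c P * wmono (spop_word n P) w) \<in> Wker psi n
            \<longrightarrow> (\<forall>P\<in>F. c P = 0))
       \<and> (\<forall>f. finite {w. f w \<noteq> 0} \<longrightarrow>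
            (\<exists>F c. finite F \<and> F \<subseteq> superPOPs n
               \<and> (\<lambda>w. f w - (\<Sum>P\<in>F. c P * wmono (spop_word n P) w)) \<in> Wker psi n))"
proof -
  obtain ps :: "(complex \<times> complex) list" where ps:
    "\<And>r. (\<Sum>i=1..s. z i ^ r * mu i H1) = (\<Sum>(\<zeta>, \<alpha>)\<leftarrow>ps. \<zeta> ^ r * \<alpha>)"
    "\<And>r. (\<Sum>i=1..s. z i ^ r * mu i H2) = (\<Sum>(\<zeta>, \<alpha>)\<leftarrow>ps. \<zeta> ^ r)"
    using weight_points[OF assms(1), of z] by blast
  define as where "as = map snd ps"
  define \<zeta> where "\<zeta> i = fst (ps ! i)" for i
  have "of_nat n = (\<Sum>(\<zeta>, \<alpha>)\<leftarrow>ps. \<zeta> ^ 0 :: complex)"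
    using assms(3,4) ps(2)[of 0] by (simp add: hgens_def)
  also have "\<dots> = of_nat (length ps)" by (induction ps) auto
  finally have len: "length ps = n" by (simp only: of_nat_eq_iff)
  then have n: "length as = n" by (simp add: as_def)
  have psi: "psi a r = (\<Sum>i<n. \<zeta> i ^ r * (if a = H1 then as ! i else 1))" if "a \<in> hgens" for a r
    using that assms(3) ps[of r] len
    by (auto simp: hgens_def sum_list_sum_nth split_beta \<zeta>_def as_def atLeast0LessThan)

  \<comment> \<open>The points move along lines with slopes i while the h1-values stay fixed.
    \<open>Psi\<close> is the resulting weight with polynomial entries, equal to \<open>psi\<close>
    at parameter 0.\<close>
  define Z where "Z i = [:\<zeta> i, of_nat i:]" for i
  define Psi where "Psi a r = (\<Sum>i<n. smult (if a = H1 then as ! i else 1) (Z i ^ r))" for a :: gen and r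
  define zz where "zz e i = \<zeta> i + e * of_nat i" for e i
  have polyZ: "poly (Z i) e = zz e i" for i e by (simp add: Z_def zz_def)
  have Psi: "poly (Psi a r) e = (\<Sum>i<n. zz e i ^ r * (if a = H1 then as ! i else 1))" for a r e
    by (simp add: Psi_def poly_sum polyZ mult.commute)
  have Psi_psi: "poly (Psi a r) 0 = psi a r" if "a \<in> hgens" for a r
    unfolding Psi psi[OF that] by (simp add: zz_def)
  have Wker_0: "Wker (\<lambda>a r. poly (Psi a r) 0) n = Wker psi n"
    using Psi_psi by (rule Wker_cong)

  define I where "I = superPOPs n"
  have I: "finite I" "card I \<le> 4 ^ length as" using superPOPs_card[of n] by (auto simp: I_def n)
  have "Psi H2 0 = of_nat n" by (simp add: Psi_def)
  then have "\<forall>u. \<exists>d. \<forall>e. (\<lambda>w. wmono u w - (\<Sum>P\<in>I. poly (d P) e * wmono (spop_word n P) w))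
      \<in> Wker (\<lambda>a r. poly (Psi a r) e) n"
    unfolding I_def using family_spanning[of Psi n] by simp
  then obtain d where d: "\<And>u e. (\<lambda>w. wmono u w - (\<Sum>P\<in>I. poly (d u P) e * wmono (spop_word n P) w))
      \<in> Wker (\<lambda>a r. poly (Psi a r) e) n" by (auto dest!: choice)

  define V where "V e = wv as (zz e)" for e
  define generic where "generic = {e. inj_on (zz e) {..<n}}"
  have inf: "infinite generic"
    unfolding generic_def zz_def by (rule infinite_injective_parameters)
  have lin_spop: "lin l (\<lambda>w. \<Sum>P\<in>J. c P * wmono (spop_word n P) w) = (\<Sum>P\<in>J. c P * l (spop_word n P))"
    and fin_spop: "(\<lambda>w. \<Sum>P\<in>J. c P * wmono (spop_word n P) w) \<in> fin_supp" for l J and c :: "_ \<Rightarrow> complex"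
    using fin_supp_sum[of J "\<lambda>P w. c P * wmono (spop_word n P) w" l] by (simp_all add: fin_supp_scale)
  \<comment> \<open>Evaluation in the tensor product annihilates the relations at every parameter,
    so the coordinates found in the Weyl module also expand vectors of the tensor product.\<close>
  have V_expand: "V e u xs = (\<Sum>P\<in>I. poly (d u P) e * V e (spop_word n P) xs)" for e u xs
  proof -
    have "lin (\<lambda>u. V e u xs) (\<lambda>w. wmono u w - (\<Sum>P\<in>I. poly (d u P) e * wmono (spop_word n P) w)) = 0"
    proof (rule Wker_lin[THEN conjunct2])
      show "V e (u @ [(a, r)]) xs = poly (Psi a r) e * V e u xs" if "a \<in> hgens" for u a r
        using that by (simp add: V_def wv_hgens Psi n)
      show "V e (u @ replicate (Suc n) (Y2, 0)) xs = 0" for u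
        unfolding V_def n[symmetric] by (rule wv_Y2)
      show "(\<lambda>w. wmono u w - (\<Sum>P\<in>I. poly (d u P) e * wmono (spop_word n P) w)) \<in> Wker (\<lambda>a r. poly (Psi a r) e) n"
        by (rule d)
    qed (simp_all only: V_def wv_bracket wv_nplus)
    then show ?thesis by (simp add: fin_supp_diff fin_spop lin_spop)
  qed
  have V_indep: "c P = 0"
    if "e \<in> generic" "\<And>xs. (\<Sum>P\<in>I. c P * V e (spop_word n P) xs) = 0" "P \<in> I" for e c P
  proof (rule cyclic_independent[where v = "\<lambda>P. V e (spop_word n P)" and I = I and as = as and z = "zz e"])
    show "wv as (zz e) u \<in> fock.span ((\<lambda>P. V e (spop_word n P)) ` I)" for u
    proof -
      have "wv as (zz e) u = (\<Sum>P\<in>I. (\<lambda>xs. poly (d u P) e * V e (spop_word n P) xs))"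
        using V_expand[of e u] by (simp add: fun_eq_iff fock_sum_apply V_def)
      then show ?thesis
        by (simp only:) (intro fock.span_sum fock.span_scale fock.span_base imageI)
    qed
  qed (use that I n in \<open>auto simp: generic_def\<close>)
  txt \<open>Structure constants that are polynomial in the parameter vanish identically, in particular at
    the possibly degenerate parameter 0, as soon as they vanish for generic parameters.\<close>
  have poly_zero: "D P = 0"
    if "\<And>e xs. e \<in> generic \<Longrightarrow> (\<Sum>P\<in>I. poly (D P) e * V e (spop_word n P) xs) = 0" "P \<in> I" for D :: "_ \<Rightarrow> complex poly" and P
  proof (rule ccontr)
    assume "D P \<noteq> 0"
    then have "finite {e. poly (D P) e = 0}" by (rule poly_roots_finite)
    moreover have "generic \<subseteq> {e. poly (D P) e = 0}"
      using V_indep[of _ "\<lambda>P. poly (D P) _" P] that by blast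
    ultimately show False using inf finite_subset by blast
  qed

  \<comment> \<open>Coordinates at parameter 0, the candidates for the dual basis on W(psi).\<close>
  define L where "L P u = poly (d u P) 0" for P u
  have L_Wker: "lin (L P) f = 0" if "P \<in> I" "f \<in> Wker psi n" for P f
  proof (rule Wker_lin[THEN conjunct2, OF _ _ _ _ that(2)])
    fix u v a b r q
    \<comment> \<open>\<open>D\<close> combines the coordinate polynomials of the words in one
      relation. The relation holds in the tensor product, so \<open>poly_zero\<close> makes
      \<open>D P\<close> the zero polynomial, and its value at 0 is the required identity for
      \<open>L\<close>.\<close>
    define D where "D P = d (u @ (a, r) # (b, q) # v) P - smult ((-1) ^ (par a * par b)) (d (u @ (b, q) # (a, r) # v) P)
        - (\<Sum>c\<in>gens. smult (coord (sbracket a b) c) (d (u @ (c, r + q) # v) P))" for P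
    have "(\<Sum>P\<in>I. poly (D P) e * V e (spop_word n P) xs) =
        V e (u @ (a, r) # (b, q) # v) xs - (-1) ^ (par a * par b) * V e (u @ (b, q) # (a, r) # v) xs
        - (\<Sum>c\<in>gens. coord (sbracket a b) c * V e (u @ (c, r + q) # v) xs)" for e xs
      unfolding V_expand[of e "u @ _"] D_def
      by (simp add: poly_sum left_diff_distrib sum_subtractf sum_distrib_left sum_distrib_right mult.assoc
          sum.swap[of _ gens I])
    then have "D P = 0" using that(1) by (intro poly_zero) (simp_all add: V_def wv_bracket)
    then have "poly (D P) 0 = 0" by simp
    then show "L P (u @ (a, r) # (b, q) # v) - (-1) ^ (par a * par b) * L P (u @ (b, q) # (a, r) # v)
      = (\<Sum>c\<in>gens. coord (sbracket a b) c * L P (u @ (c, r + q) # v))"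
      by (simp add: D_def L_def poly_sum)
  next
    fix u a r assume "a \<in> nplus"
    then have "V e (u @ [(a, r)]) xs = 0" for e xs by (simp add: V_def wv_nplus)
    then have "d (u @ [(a, r)]) P = 0" using that(1) by (intro poly_zero) (simp_all flip: V_expand)
    then show "L P (u @ [(a, r)]) = 0" by (simp add: L_def)
  next
    fix u a r assume a: "a \<in> hgens"
    \<comment> \<open>The weight itself depends on the parameter: it enters as the polynomial
      \<open>Psi a r\<close> and becomes \<open>psi a r\<close> at 0.\<close>
    define D where "D P = d (u @ [(a, r)]) P - Psi a r * d u P" for P
    have "(\<Sum>P\<in>I. poly (D P) e * V e (spop_word n P) xs) = V e (u @ [(a, r)]) xs - poly (Psi a r) e * V e u xs" for e xs
      unfolding V_expand[of e "u @ _"] V_expand[of e u] D_def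
      by (simp add: left_diff_distrib sum_subtractf sum_distrib_left mult.assoc)
    also have "\<And>e xs. V e (u @ [(a, r)]) xs - poly (Psi a r) e * V e u xs = 0"
      using a by (simp add: V_def wv_hgens Psi n)
    finally have "D P = 0" using that(1) by (intro poly_zero)
    then have "poly (D P) 0 = 0" by simp
    then show "L P (u @ [(a, r)]) = psi a r * L P u"
      using a by (simp add: D_def L_def Psi_psi)
  next
    fix u
    have "V e (u @ replicate (Suc n) (Y2, 0)) xs = 0" for e xs
      unfolding V_def n[symmetric] by (rule wv_Y2)
    then have "d (u @ replicate (Suc n) (Y2, 0)) P = 0"
      using that(1) by (intro poly_zero) (simp_all del: replicate.simps flip: V_expand)
    then show "L P (u @ replicate (Suc n) (Y2, 0)) = 0" by (simp add: L_def)
  qed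
  \<comment> \<open>A super POP word is one expansion of itself; uniqueness at generic parameters
    identifies it with the one given by \<open>d\<close>.\<close>
  have L_dual: "L P (spop_word n Q) = (if P = Q then 1 else 0)" if PQ: "P \<in> I" "Q \<in> I" for P Q
  proof -
    define D where "D P = d (spop_word n Q) P - (if P = Q then 1 else 0)" for P
    have "(\<Sum>P\<in>I. poly (D P) e * V e (spop_word n P) xs) = 0" for e xs
    proof -
      have "(\<Sum>P\<in>I. poly (D P) e * V e (spop_word n P) xs) =
          V e (spop_word n Q) xs - (\<Sum>P\<in>I. if P = Q then V e (spop_word n P) xs else 0)"
        unfolding V_expand[of e "spop_word n Q"] D_def sum_subtractf[symmetric]
        by (intro sum.cong) (auto simp: algebra_simps)
      then show ?thesis using I PQ by simp
    qed
    then have "D P = 0" using PQ(1) by (intro poly_zero)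
    then have "poly (D P) 0 = 0" by simp
    then show ?thesis by (auto simp: D_def L_def)
  qed

  show ?thesis
  proof (intro conjI allI impI)
    fix F and c :: "(nat \<Rightarrow> nat \<Rightarrow> nat) \<times> nat \<times> nat list \<Rightarrow> complex"
    assume F: "finite F \<and> F \<subseteq> superPOPs n
      \<and> (\<lambda>w. \<Sum>P\<in>F. c P * wmono (spop_word n P) w) \<in> Wker psi n"
    show "\<forall>P\<in>F. c P = 0"
    proof
      fix P assume P: "P \<in> F"
      then have "P \<in> I" using F by (auto simp: I_def)
      then have "0 = lin (L P) (\<lambda>w. \<Sum>P\<in>F. c P * wmono (spop_word n P) w)"
        using L_Wker F by simp
      also have "\<dots> = (\<Sum>Q\<in>F. c Q * L P (spop_word n Q))"
        by (rule lin_spop)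
      also have "\<dots> = (\<Sum>Q\<in>F. if Q = P then c Q else 0)"
        using F \<open>P \<in> I\<close> by (intro sum.cong) (auto simp: L_dual I_def)
      finally show "c P = 0" using F P by simp
    qed
  next
    fix f :: tens assume "finite {w. f w \<noteq> 0}"
    then have f: "f \<in> fin_supp" by (simp add: fin_supp_def)
    define c where "c P = (\<Sum>u | f u \<noteq> 0. f u * L P u)" for P
    have "(\<lambda>w. wmono u w - (\<Sum>P\<in>I. L P u * wmono (spop_word n P) w)) \<in> Wker psi n" for u
      using d[of u 0] by (simp only: Wker_0 L_def)
    then have "(\<lambda>w. \<Sum>u | f u \<noteq> 0. f u * (wmono u w - (\<Sum>P\<in>I. L P u * wmono (spop_word n P) w))) \<in> Wker psi n"
      by (intro Wker_sum Wker.smult)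
    also have "(\<lambda>w. \<Sum>u | f u \<noteq> 0. f u * (wmono u w - (\<Sum>P\<in>I. L P u * wmono (spop_word n P) w)))
        = (\<lambda>w. f w - (\<Sum>P\<in>I. c P * wmono (spop_word n P) w))"
    proof
      fix w
      have "f w = (\<Sum>u | f u \<noteq> 0. f u * wmono u w)"
        using fin_supp_expand[OF f] by (rule fun_cong)
      then show "(\<Sum>u | f u \<noteq> 0. f u * (wmono u w - (\<Sum>P\<in>I. L P u * wmono (spop_word n P) w)))
        = f w - (\<Sum>P\<in>I. c P * wmono (spop_word n P) w)"
        by (simp add: right_diff_distrib sum_subtractf c_def sum_distrib_left sum_distrib_right mult.assoc
            sum.swap[of _ I "{u. f u \<noteq> 0}"])
    qed
    finally show "\<exists>F c. finite F \<and> F \<subseteq> superPOPs n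
      \<and> (\<lambda>w. f w - (\<Sum>P\<in>F. c P * wmono (spop_word n P) w)) \<in> Wker psi n"
      using I by (intro exI[of _ I] exI[of _ c]) (simp add: I_def)
  qed
qed

end
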